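(* Let $(M^{2n+1},\phi,\xi,\eta,g)$ be an almost $\alpha$-paracosymplectic manifold. Then $M$ has para-Kaehler leaves if and only if, for all vector fields $X,Y$ on $M$, $$(\nabla_X\phi)Y=\alpha\, g(\phi X,Y)\xi+g(hX,Y)\xi-\alpha\,\eta(Y)\phi X-\eta(Y)hX .$$
   Context: An almost paracontact metric manifold is a smooth manifold $M$ of dimension $2n+1$ with a $(1,1)$-tensor field $\phi$, a vector field $\xi$, a 1-form $\eta$ and a pseudo-Riemannian metric $g$ of signature $(n+1,n)$ such that $\eta(\xi)=1$, $\phi^2=\mathrm{Id}-\eta\otimes\xi$, the eigendistributions of $\phi|_{\ker\eta}$ for the eigenvalues $+1$ and $-1$ both have rank $n$, and $g(\phi X,\phi Y)=-g(X,Y)+\eta(X)\eta(Y)$ (hence $\eta(X)=g(X,\xi)$, $\phi\xi=0$, $\eta\circ\phi=0$). Its fundamental 2-form is $\Phi(X,Y)=g(\phi X,Y)$. It is almost $\alpha$-paracosymplectic, where $\alpha$ is a smooth real function on $M$ (possibly constant), if $d\eta=0$ and $d\Phi=2\alpha\,\eta\wedge\Phi$ (with $d$ and $\wedge$ normalized compatibly, so that the cyclic sum of $(\nabla_X\Phi)(Y,Z)$ equals $2\alpha$ times the cyclic sum of $\eta(X)\Phi(Y,Z)$). $\nabla$ is the Levi-Civita connection of $g$ and $h=\frac12\mathcal{L}_\xi\phi$ (Lie derivative). Since $d\eta=0$, the distribution $\ker\eta$ is integrable. Each leaf carries the almost para-Hermitian structure $J\bar X=\phi\bar X$, $\langle\bar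 X,\bar Y\rangle=g(\bar X,\bar Y)$ for $\bar X,\bar Y$ tangent to the leaf ($J^2=\mathrm{Id}$, $\langle J\bar X,J\bar Y\rangle=-\langle\bar X,\bar Y\rangle$). A leaf is para-Kaehler if $\bar\nabla J=0$ for the Levi-Civita connection $\bar\nabla$ of $\langle\cdot,\cdot\rangle$ on the leaf. $M$ has para-Kaehler leaves if every leaf is para-Kaehler. *)

theory Defs
  imports "HOL-Analysis.Analysis" "HOL-Library.Function_Algebras"
begin

text \<open>Addition on functions is pointwise (\<^theory>\<open>HOL-Library.Function_Algebras\<close>); the
  matching scalar multiplication makes tangent vectors and vector fields, which are functions
  below, elements of real vector spaces.\<close>

instantiation "fun" :: (type, real_vector) real_vector
begin

definition "scaleR_fun (r::real) (f::'a \<Rightarrow> 'b) = (\<lambda>x. r *\<^sub>R f x)"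

instance
  by standard (simp_all add: scaleR_fun_def fun_eq_iff scaleR_add_right scaleR_add_left)

end

section \<open>Smooth manifolds\<close>

text \<open>Intended for open \<open>S\<close>: existence and continuity on \<open>S\<close> of all iterated directional
  derivatives up to order \<open>k\<close>, together with total differentiability at each stage.\<close>

primrec Ck_on :: "nat \<Rightarrow> ('a::real_normed_vector \<Rightarrow> 'b::real_normed_vector) \<Rightarrow> 'a set \<Rightarrow> bool" where
  "Ck_on 0 f S \<longleftrightarrow> continuous_on S f"
| "Ck_on (Suc k) f S \<longleftrightarrow>
     f differentiable_on S \<and> (\<forall>v. Ck_on k (\<lambda>x. frechet_derivative f (at x) v) S)"

definition smooth_on :: "('a::real_normed_vector \<Rightarrow> 'b::real_normed_vector) \<Rightarrow> 'a set \<Rightarrow> bool" where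
  "smooth_on f S \<longleftrightarrow> (\<forall>k. Ck_on k f S)"

text \<open>A chart is a pair of a domain and a coordinate map; the values of the coordinate map
  outside the domain are irrelevant. A manifold is given by an atlas \<open>A\<close>, which need not be
  maximal; its points are the union of the chart domains.\<close>

type_synonym ('p, 'e) chart = "'p set \<times> ('p \<Rightarrow> 'e)"
type_synonym ('p, 'e) atlas = "('p, 'e) chart set"

abbreviation chart_dom :: "('p, 'e) chart \<Rightarrow> 'p set" where
  "chart_dom \<equiv> fst"

abbreviation coord :: "('p, 'e) chart \<Rightarrow> 'p \<Rightarrow> 'e" where
  "coord \<equiv> snd"

definition coord_inv :: "('p, 'e) chart \<Rightarrow> 'e \<Rightarrow> 'p" where
  "coord_inv c = inv_into (chart_dom c) (coord c)"

definition points :: "('p, 'e) atlas \<Rightarrow> 'p set" where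
  "points A = (\<Union>c\<in>A. chart_dom c)"

definition charts_at :: "('p, 'e) atlas \<Rightarrow> 'p \<Rightarrow> ('p, 'e) chart set" where
  "charts_at A p = {c \<in> A. p \<in> chart_dom c}"

definition transition :: "('p, 'e) chart \<Rightarrow> ('p, 'e) chart \<Rightarrow> 'e \<Rightarrow> 'e" where
  "transition c d = coord d \<circ> coord_inv c"

definition smooth_atlas :: "('p, 'e::euclidean_space) atlas \<Rightarrow> bool" where
  "smooth_atlas A \<longleftrightarrow>
     (\<forall>c\<in>A. inj_on (coord c) (chart_dom c) \<and> open (coord c ` chart_dom c)) \<and>
     (\<forall>c\<in>A. \<forall>d\<in>A.
        open (coord c ` (chart_dom c \<inter> chart_dom d)) \<and>
        smooth_on (transition c d) (coord c ` (chart_dom c \<inter> chart_dom d)))"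

definition manifold_topology :: "('p, 'e::euclidean_space) atlas \<Rightarrow> 'p topology" where
  "manifold_topology A =
     topology (\<lambda>W. W \<subseteq> points A \<and> (\<forall>c\<in>A. open (coord c ` (W \<inter> chart_dom c))))"

definition smooth_manifold :: "('p, 'e::euclidean_space) atlas \<Rightarrow> bool" where
  "smooth_manifold A \<longleftrightarrow>
     smooth_atlas A \<and> Hausdorff_space (manifold_topology A) \<and>
     second_countable (manifold_topology A)"

definition smooth_fun :: "('p, 'e::euclidean_space) atlas \<Rightarrow> ('p \<Rightarrow> real) \<Rightarrow> bool" where
  "smooth_fun A f \<longleftrightarrow> (\<forall>c\<in>A. smooth_on (f \<circ> coord_inv c) (coord c ` chart_dom c))"

definition smooth_map ::
  "('p, 'd::euclidean_space) atlas \<Rightarrow> ('q, 'e::euclidean_space) atlas \<Rightarrow> ('p \<Rightarrow> 'q) \<Rightarrow> bool" where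
  "smooth_map B A F \<longleftrightarrow>
     F ` points B \<subseteq> points A \<and>
     (\<forall>b\<in>B. \<forall>c\<in>A.
        open (coord b ` (chart_dom b \<inter> F -` chart_dom c)) \<and>
        smooth_on (coord c \<circ> F \<circ> coord_inv b) (coord b ` (chart_dom b \<inter> F -` chart_dom c)))"

section \<open>Tangent vectors and vector fields\<close>

text \<open>A tangent vector at \<open>p\<close> is the family of its coordinate vectors in all charts at \<open>p\<close>,
  related by the derivatives of the transition maps. Entries at the other charts are set to
  \<open>0\<close>, so that equality of tangent vectors is equality of functions; at a \<open>p\<close> outside
  the manifold the tangent space is \<open>{0}\<close>.\<close>

type_synonym ('p, 'e) tangent = "('p, 'e) chart \<Rightarrow> 'e"
type_synonym ('p, 'e) vfield = "'p \<Rightarrow> ('p, 'e) tangent"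

definition tangent_space :: "('p, 'e::euclidean_space) atlas \<Rightarrow> 'p \<Rightarrow> ('p, 'e) tangent set" where
  "tangent_space A p =
     {v. (\<forall>c. c \<notin> charts_at A p \<longrightarrow> v c = 0) \<and>
         (\<forall>c\<in>charts_at A p. \<forall>d\<in>charts_at A p.
            v d = frechet_derivative (transition c d) (at (coord c p)) (v c))}"

definition vector_fields :: "('p, 'e::euclidean_space) atlas \<Rightarrow> ('p, 'e) vfield set" where
  "vector_fields A =
     {X. (\<forall>p. X p \<in> tangent_space A p) \<and>
         (\<forall>c\<in>A. smooth_on (\<lambda>x. X (coord_inv c x) c) (coord c ` chart_dom c))}"

definition some_chart :: "('p, 'e) atlas \<Rightarrow> 'p \<Rightarrow> ('p, 'e) chart" where
  "some_chart A p = (SOME c. c \<in> charts_at A p)"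

text \<open>By the chain rule the next two notions do not depend on the chosen chart.\<close>

definition dir_deriv ::
  "('p, 'e::euclidean_space) atlas \<Rightarrow> 'p \<Rightarrow> ('p, 'e) tangent \<Rightarrow> ('p \<Rightarrow> real) \<Rightarrow> real" where
  "dir_deriv A p v f =
     (let c = some_chart A p in frechet_derivative (f \<circ> coord_inv c) (at (coord c p)) (v c))"

definition tangent_map ::
  "('p, 'd::euclidean_space) atlas \<Rightarrow> ('q, 'e::euclidean_space) atlas \<Rightarrow> ('p \<Rightarrow> 'q) \<Rightarrow>
   'p \<Rightarrow> ('p, 'd) tangent \<Rightarrow> ('q, 'e) tangent" where
  "tangent_map B A F p v =
     (\<lambda>c. if c \<in> charts_at A (F p)
          then let b = some_chart B p
               in frechet_derivative (coord c \<circ> F \<circ> coord_inv b) (at (coord b p)) (v b)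
          else 0)"

definition vf_deriv ::
  "('p, 'e::euclidean_space) atlas \<Rightarrow> ('p, 'e) vfield \<Rightarrow> ('p \<Rightarrow> real) \<Rightarrow> 'p \<Rightarrow> real" where
  "vf_deriv A X f p = dir_deriv A p (X p) f"

definition lie_bracket ::
  "('p, 'e::euclidean_space) atlas \<Rightarrow> ('p, 'e) vfield \<Rightarrow> ('p, 'e) vfield \<Rightarrow> ('p, 'e) vfield" where
  "lie_bracket A X Y =
     (\<lambda>p c. if c \<in> charts_at A p
            then frechet_derivative (\<lambda>x. Y (coord_inv c x) c) (at (coord c p)) (X p c)
               - frechet_derivative (\<lambda>x. X (coord_inv c x) c) (at (coord c p)) (Y p c)
            else 0)"

section \<open>Tensor fields\<close>

text \<open>Tensor fields act pointwise on tangent vectors; smoothness means that smooth vector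
  fields are sent to smooth functions or smooth vector fields.\<close>

type_synonym ('p, 'e) form1 = "'p \<Rightarrow> ('p, 'e) tangent \<Rightarrow> real"
type_synonym ('p, 'e) form2 = "'p \<Rightarrow> ('p, 'e) tangent \<Rightarrow> ('p, 'e) tangent \<Rightarrow> real"
type_synonym ('p, 'e) endo = "'p \<Rightarrow> ('p, 'e) tangent \<Rightarrow> ('p, 'e) tangent"

definition linear_on_subspace :: "'v::real_vector set \<Rightarrow> ('v \<Rightarrow> 'w::real_vector) \<Rightarrow> bool" where
  "linear_on_subspace V f \<longleftrightarrow>
     (\<forall>u\<in>V. \<forall>v\<in>V. f (u + v) = f u + f v) \<and> (\<forall>r. \<forall>v\<in>V. f (r *\<^sub>R v) = r *\<^sub>R f v)"

definition one_form :: "('p, 'e::euclidean_space) atlas \<Rightarrow> ('p, 'e) form1 \<Rightarrow> bool" where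
  "one_form A \<eta> \<longleftrightarrow>
     (\<forall>p. linear_on_subspace (tangent_space A p) (\<eta> p)) \<and>
     (\<forall>X\<in>vector_fields A. smooth_fun A (\<lambda>p. \<eta> p (X p)))"

definition endo_app :: "('p, 'e) endo \<Rightarrow> ('p, 'e) vfield \<Rightarrow> ('p, 'e) vfield" where
  "endo_app \<phi> X = (\<lambda>p. \<phi> p (X p))"

definition endo_field :: "('p, 'e::euclidean_space) atlas \<Rightarrow> ('p, 'e) endo \<Rightarrow> bool" where
  "endo_field A \<phi> \<longleftrightarrow>
     (\<forall>p. linear_on_subspace (tangent_space A p) (\<phi> p) \<and>
          \<phi> p ` tangent_space A p \<subseteq> tangent_space A p) \<and>
     (\<forall>X\<in>vector_fields A. endo_app \<phi> X \<in> vector_fields A)"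

definition bilinear_field :: "('p, 'e::euclidean_space) atlas \<Rightarrow> ('p, 'e) form2 \<Rightarrow> bool" where
  "bilinear_field A \<omega> \<longleftrightarrow>
     (\<forall>p. \<forall>u\<in>tangent_space A p.
        linear_on_subspace (tangent_space A p) (\<omega> p u) \<and>
        linear_on_subspace (tangent_space A p) (\<lambda>v. \<omega> p v u)) \<and>
     (\<forall>X\<in>vector_fields A. \<forall>Y\<in>vector_fields A. smooth_fun A (\<lambda>p. \<omega> p (X p) (Y p)))"

definition has_signature ::
  "'v::real_vector set \<Rightarrow> ('v \<Rightarrow> 'v \<Rightarrow> real) \<Rightarrow> nat \<Rightarrow> nat \<Rightarrow> bool" where
  "has_signature V b r s \<longleftrightarrow>
     (\<exists>P N. finite P \<and> card P = r \<and> finite N \<and> card N = s \<and> P \<inter> N = {} \<and>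
        independent (P \<union> N) \<and> span (P \<union> N) = V \<and>
        (\<forall>u\<in>P \<union> N. \<forall>v\<in>P \<union> N. u \<noteq> v \<longrightarrow> b u v = 0) \<and>
        (\<forall>u\<in>P. b u u = 1) \<and> (\<forall>u\<in>N. b u u = - 1))"

definition pseudo_metric ::
  "('p, 'e::euclidean_space) atlas \<Rightarrow> ('p, 'e) form2 \<Rightarrow> nat \<Rightarrow> nat \<Rightarrow> bool" where
  "pseudo_metric A g r s \<longleftrightarrow>
     bilinear_field A g \<and>
     (\<forall>p\<in>points A. (\<forall>u\<in>tangent_space A p. \<forall>v\<in>tangent_space A p. g p u v = g p v u) \<and>
        has_signature (tangent_space A p) (g p) r s)"

text \<open>Exterior derivative and wedge product without numerical factors: with this
  normalisation \<open>d\<omega>\<close> is the cyclic sum of \<open>(\<nabla>\<^sub>X \<omega>) (Y, Z)\<close> for any torsion-free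
  connection, and \<open>\<eta> \<and> \<omega>\<close> is the cyclic sum of \<open>\<eta>(X) \<omega>(Y, Z)\<close>.\<close>

definition ext_deriv1 ::
  "('p, 'e::euclidean_space) atlas \<Rightarrow> ('p, 'e) form1 \<Rightarrow>
   ('p, 'e) vfield \<Rightarrow> ('p, 'e) vfield \<Rightarrow> 'p \<Rightarrow> real" where
  "ext_deriv1 A \<eta> X Y p =
     vf_deriv A X (\<lambda>q. \<eta> q (Y q)) p - vf_deriv A Y (\<lambda>q. \<eta> q (X q)) p
     - \<eta> p (lie_bracket A X Y p)"

definition ext_deriv2 ::
  "('p, 'e::euclidean_space) atlas \<Rightarrow> ('p, 'e) form2 \<Rightarrow>
   ('p, 'e) vfield \<Rightarrow> ('p, 'e) vfield \<Rightarrow> ('p, 'e) vfield \<Rightarrow> 'p \<Rightarrow> real" where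
  "ext_deriv2 A \<omega> X Y Z p =
     vf_deriv A X (\<lambda>q. \<omega> q (Y q) (Z q)) p
     + vf_deriv A Y (\<lambda>q. \<omega> q (Z q) (X q)) p
     + vf_deriv A Z (\<lambda>q. \<omega> q (X q) (Y q)) p
     - \<omega> p (lie_bracket A X Y p) (Z p)
     - \<omega> p (lie_bracket A Y Z p) (X p)
     - \<omega> p (lie_bracket A Z X p) (Y p)"

definition wedge12 ::
  "('p, 'e) form1 \<Rightarrow> ('p, 'e) form2 \<Rightarrow>
   ('p, 'e) vfield \<Rightarrow> ('p, 'e) vfield \<Rightarrow> ('p, 'e) vfield \<Rightarrow> 'p \<Rightarrow> real" where
  "wedge12 \<eta> \<omega> X Y Z p =
     \<eta> p (X p) * \<omega> p (Y p) (Z p) + \<eta> p (Y p) * \<omega> p (Z p) (X p) + \<eta> p (Z p) * \<omega> p (X p) (Y p)"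

definition lie_deriv_endo ::
  "('p, 'e::euclidean_space) atlas \<Rightarrow> ('p, 'e) vfield \<Rightarrow> ('p, 'e) endo \<Rightarrow>
   ('p, 'e) vfield \<Rightarrow> ('p, 'e) vfield" where
  "lie_deriv_endo A \<xi> \<phi> X = lie_bracket A \<xi> (endo_app \<phi> X) - endo_app \<phi> (lie_bracket A \<xi> X)"

section \<open>The Levi-Civita connection\<close>

type_synonym ('p, 'e) connection = "('p, 'e) vfield \<Rightarrow> ('p, 'e) vfield \<Rightarrow> ('p, 'e) vfield"

definition fun_scale :: "('p \<Rightarrow> real) \<Rightarrow> ('p, 'e::euclidean_space) vfield \<Rightarrow> ('p, 'e) vfield" where
  "fun_scale f X = (\<lambda>p. f p *\<^sub>R X p)"

definition affine_connection ::
  "('p, 'e::euclidean_space) atlas \<Rightarrow> ('p, 'e) connection \<Rightarrow> bool" where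
  "affine_connection A nabla \<longleftrightarrow>
     (\<forall>X\<in>vector_fields A. \<forall>Y\<in>vector_fields A. nabla X Y \<in> vector_fields A) \<and>
     (\<forall>X\<in>vector_fields A. \<forall>X'\<in>vector_fields A. \<forall>Y\<in>vector_fields A.
        nabla (X + X') Y = nabla X Y + nabla X' Y) \<and>
     (\<forall>X\<in>vector_fields A. \<forall>Y\<in>vector_fields A. \<forall>Y'\<in>vector_fields A.
        nabla X (Y + Y') = nabla X Y + nabla X Y') \<and>
     (\<forall>f X Y. smooth_fun A f \<longrightarrow> X \<in> vector_fields A \<longrightarrow> Y \<in> vector_fields A \<longrightarrow>
        nabla (fun_scale f X) Y = fun_scale f (nabla X Y) \<and>
        nabla X (fun_scale f Y) = fun_scale (vf_deriv A X f) Y + fun_scale f (nabla X Y))"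

definition is_levi_civita ::
  "('p, 'e::euclidean_space) atlas \<Rightarrow> ('p, 'e) form2 \<Rightarrow> ('p, 'e) connection \<Rightarrow> bool" where
  "is_levi_civita A g nabla \<longleftrightarrow>
     affine_connection A nabla \<and>
     (\<forall>X\<in>vector_fields A. \<forall>Y\<in>vector_fields A.
        nabla X Y - nabla Y X = lie_bracket A X Y) \<and>
     (\<forall>X\<in>vector_fields A. \<forall>Y\<in>vector_fields A. \<forall>Z\<in>vector_fields A. \<forall>p\<in>points A.
        vf_deriv A X (\<lambda>q. g q (Y q) (Z q)) p =
          g p (nabla X Y p) (Z p) + g p (Y p) (nabla X Z p))"

text \<open>For a pseudo-Riemannian \<open>g\<close> on a Hausdorff manifold the choice is unique on smooth
  vector fields.\<close>

definition levi_civita ::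
  "('p, 'e::euclidean_space) atlas \<Rightarrow> ('p, 'e) form2 \<Rightarrow> ('p, 'e) connection" where
  "levi_civita A g = (SOME nabla. is_levi_civita A g nabla)"

definition cov_deriv_endo ::
  "('p, 'e) connection \<Rightarrow> ('p, 'e::euclidean_space) endo \<Rightarrow>
   ('p, 'e) vfield \<Rightarrow> ('p, 'e) vfield \<Rightarrow> ('p, 'e) vfield" where
  "cov_deriv_endo nabla \<phi> X Y = nabla X (endo_app \<phi> Y) - endo_app \<phi> (nabla X Y)"

section \<open>Almost paracontact metric and almost paracosymplectic structures\<close>

definition ker_form :: "('p, 'e::euclidean_space) atlas \<Rightarrow> ('p, 'e) form1 \<Rightarrow> 'p \<Rightarrow> ('p, 'e) tangent set"
  where "ker_form A \<eta> p = {v \<in> tangent_space A p. \<eta> p v = 0}"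

definition almost_paracontact_metric ::
  "nat \<Rightarrow> ('p, 'm::euclidean_space) atlas \<Rightarrow> ('p, 'm) endo \<Rightarrow> ('p, 'm) vfield \<Rightarrow>
   ('p, 'm) form1 \<Rightarrow> ('p, 'm) form2 \<Rightarrow> bool" where
  "almost_paracontact_metric n M \<phi> \<xi> \<eta> g \<longleftrightarrow>
     DIM('m) = 2 * n + 1 \<and> smooth_manifold M \<and>
     endo_field M \<phi> \<and> \<xi> \<in> vector_fields M \<and> one_form M \<eta> \<and> pseudo_metric M g (n + 1) n \<and>
     (\<forall>p\<in>points M.
        \<eta> p (\<xi> p) = 1 \<and>
        (\<forall>u\<in>tangent_space M p. \<phi> p (\<phi> p u) = u - \<eta> p u *\<^sub>R \<xi> p) \<and>
        dim {u \<in> ker_form M \<eta> p. \<phi> p u = u} = n \<and>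
        dim {u \<in> ker_form M \<eta> p. \<phi> p u = - u} = n \<and>
        (\<forall>u\<in>tangent_space M p. \<forall>v\<in>tangent_space M p.
           g p (\<phi> p u) (\<phi> p v) = - g p u v + \<eta> p u * \<eta> p v))"

definition fundamental_form :: "('p, 'e) endo \<Rightarrow> ('p, 'e) form2 \<Rightarrow> ('p, 'e) form2" where
  "fundamental_form \<phi> g = (\<lambda>p u v. g p (\<phi> p u) v)"

definition almost_paracosymplectic ::
  "nat \<Rightarrow> ('p, 'm::euclidean_space) atlas \<Rightarrow> ('p \<Rightarrow> real) \<Rightarrow> ('p, 'm) endo \<Rightarrow>
   ('p, 'm) vfield \<Rightarrow> ('p, 'm) form1 \<Rightarrow> ('p, 'm) form2 \<Rightarrow> bool" where
  "almost_paracosymplectic n M \<alpha> \<phi> \<xi> \<eta> g \<longleftrightarrow>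
     almost_paracontact_metric n M \<phi> \<xi> \<eta> g \<and> smooth_fun M \<alpha> \<and>
     (\<forall>X\<in>vector_fields M. \<forall>Y\<in>vector_fields M. \<forall>p\<in>points M. ext_deriv1 M \<eta> X Y p = 0) \<and>
     (\<forall>X\<in>vector_fields M. \<forall>Y\<in>vector_fields M. \<forall>Z\<in>vector_fields M. \<forall>p\<in>points M.
        ext_deriv2 M (fundamental_form \<phi> g) X Y Z p =
          2 * \<alpha> p * wedge12 \<eta> (fundamental_form \<phi> g) X Y Z p)"

definition h_op ::
  "('p, 'm::euclidean_space) atlas \<Rightarrow> ('p, 'm) endo \<Rightarrow> ('p, 'm) vfield \<Rightarrow>
   ('p, 'm) vfield \<Rightarrow> ('p, 'm) vfield" where
  "h_op M \<phi> \<xi> X = (1 / 2) *\<^sub>R lie_deriv_endo M \<xi> \<phi> X"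

section \<open>Leaves\<close>

text \<open>An integral manifold of \<open>ker \<eta>\<close> is an immersed submanifold: a subset of \<open>M\<close> with
  its own atlas \<open>L\<close> (hence its own topology) whose inclusion map is an immersion with tangent
  spaces \<open>ker \<eta>\<close>. Second countability is not required of \<open>L\<close>: it is automatic for
  connected integral manifolds in a second countable manifold.\<close>

abbreviation incl_map ::
  "('p, 'l::euclidean_space) atlas \<Rightarrow> ('p, 'm::euclidean_space) atlas \<Rightarrow>
   'p \<Rightarrow> ('p, 'l) tangent \<Rightarrow> ('p, 'm) tangent" where
  "incl_map L M \<equiv> tangent_map L M (\<lambda>p. p)"

definition connected_integral_manifold ::
  "('p, 'm::euclidean_space) atlas \<Rightarrow> ('p, 'm) form1 \<Rightarrow> ('p, 'l::euclidean_space) atlas \<Rightarrow> bool" where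
  "connected_integral_manifold M \<eta> L \<longleftrightarrow>
     smooth_atlas L \<and> Hausdorff_space (manifold_topology L) \<and>
     connected_space (manifold_topology L) \<and> points L \<noteq> {} \<and>
     smooth_map L M (\<lambda>p. p) \<and>
     (\<forall>p\<in>points L. inj_on (incl_map L M p) (tangent_space L p) \<and>
        incl_map L M p ` tangent_space L p = ker_form M \<eta> p)"

definition leaf ::
  "('p, 'm::euclidean_space) atlas \<Rightarrow> ('p, 'm) form1 \<Rightarrow> ('p, 'l::euclidean_space) atlas \<Rightarrow> bool" where
  "leaf M \<eta> L \<longleftrightarrow>
     connected_integral_manifold M \<eta> L \<and>
     (\<forall>L' :: ('p, 'l) atlas.
        connected_integral_manifold M \<eta> L' \<longrightarrow> points L \<subseteq> points L' \<longrightarrow> points L' = points L)"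

definition leaf_metric ::
  "('p, 'm::euclidean_space) atlas \<Rightarrow> ('p, 'm) form2 \<Rightarrow> ('p, 'l::euclidean_space) atlas \<Rightarrow>
   ('p, 'l) form2" where
  "leaf_metric M g L = (\<lambda>p u v. g p (incl_map L M p u) (incl_map L M p v))"

text \<open>Under the identification of the tangent spaces of \<open>L\<close> with \<open>ker \<eta>\<close>, the next
  definition is the restriction of \<open>\<phi>\<close>, which preserves \<open>ker \<eta>\<close>.\<close>

definition leaf_endo ::
  "('p, 'm::euclidean_space) atlas \<Rightarrow> ('p, 'm) endo \<Rightarrow> ('p, 'l::euclidean_space) atlas \<Rightarrow>
   ('p, 'l) endo" where
  "leaf_endo M \<phi> L =
     (\<lambda>p u. if p \<in> points L
            then inv_into (tangent_space L p) (incl_map L M p) (\<phi> p (incl_map L M p u))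
            else 0)"

definition para_kaehler ::
  "('p, 'l::euclidean_space) atlas \<Rightarrow> ('p, 'l) endo \<Rightarrow> ('p, 'l) form2 \<Rightarrow> bool" where
  "para_kaehler L J gL \<longleftrightarrow>
     (\<forall>X\<in>vector_fields L. \<forall>Y\<in>vector_fields L. \<forall>p\<in>points L.
        cov_deriv_endo (levi_civita L gL) J X Y p = 0)"

text \<open>The type \<open>'l\<close> is the model space of the leaves; leaves exist only if its
  dimension is one less than that of \<open>'m\<close>.\<close>

definition para_kaehler_leaves ::
  "'l::euclidean_space itself \<Rightarrow> ('p, 'm::euclidean_space) atlas \<Rightarrow> ('p, 'm) endo \<Rightarrow>
   ('p, 'm) form1 \<Rightarrow> ('p, 'm) form2 \<Rightarrow> bool" where
  "para_kaehler_leaves TYPE('l) M \<phi> \<eta> g \<longleftrightarrow>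
     (\<forall>L :: ('p, 'l) atlas. leaf M \<eta> L \<longrightarrow>
        para_kaehler L (leaf_endo M \<phi> L) (leaf_metric M g L))"

end

theory Submission
  imports Defs
begin

text \<open>Let \<open>S X = \<nabla>\<^sub>X \<xi>\<close>. Closedness of \<open>\<eta>\<close> makes \<open>S\<close> self-adjoint with \<open>S \<xi> = 0\<close>, and the formula for \<open>d\<Phi>\<close>
  gives \<open>\<nabla>\<^sub>\<xi> \<phi> = 2 \<alpha> \<phi> - \<phi> S - S \<phi>\<close>. The right-hand side commutes with \<open>\<phi>\<close>, the left-hand side
  anticommutes with it, so both vanish and \<open>\<phi> S = \<alpha> \<phi> + h\<close>. Hence all components of \<open>\<nabla>\<phi>\<close> in which
  \<open>\<xi>\<close> occurs have the asserted value automatically, and the identity says precisely that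
  \<open>g ((\<nabla>\<^sub>X \<phi>) Y) Z = 0\<close> for \<open>X\<close>, \<open>Y\<close>, \<open>Z\<close> tangent to \<open>ker \<eta>\<close>. By the Koszul formula this expression
  equals \<open>\<langle>(\<nabla>\<^sub>X J) Y, Z\<rangle>\<close> on a leaf for the restricted fields. Leaves exist through every
  point: locally \<open>\<eta>\<close> is exact, and a primitive is straightened by the inverse function theorem.\<close>

section \<open>Smooth maps between Euclidean spaces\<close>

text \<open>The constant \<open>levi_civita\<close> is a bare choice, so nothing is known about it
  until a connection satisfying \<open>is_levi_civita\<close> has been constructed, on
  \<open>M\<close> and on each leaf. Smoothness of tensor fields is given only through global vector
  fields, whereas computations take place in charts; bump functions, and with them the Hausdorff
  axiom, bridge the two. That \<open>\<nabla>\<^sub>\<xi> \<phi>\<close> anticommutes with \<phi>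
  comes from differentiating \<open>\<phi>\<^sup>2 = Id - \<eta> \<otimes> \<xi>\<close> along
  \<xi>, where \<open>S \<xi> = 0\<close> makes \<eta> and \<xi> constant. Commuting and
  anticommuting together show only that \<phi> annihilates the values of
  \<open>\<nabla>\<^sub>\<xi> \<phi>\<close>; their \<xi>-component vanishes separately, again
  because \<open>S \<xi> = 0\<close>. A field on an immersed leaf need not be the restriction of a
  field on \<open>M\<close>. The leaf is therefore compared with \<open>M\<close> at one point at a
  time, through fields of \<open>M\<close> with the right value there; this suffices because the
  covariant derivatives of J and \<phi> are tensorial. Conversely, a condition on all leaves
  controls a point of \<open>M\<close> only if a maximal integral manifold passes through
  it.\<close>

abbreviation fderiv :: "('a::real_normed_vector \<Rightarrow> 'b::real_normed_vector) \<Rightarrow> 'a \<Rightarrow> 'a \<Rightarrow> 'b" where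
  "fderiv f x \<equiv> frechet_derivative f (at x)"

section \<open>Functions of class C^k: locality, products, composition\<close>

lemma has_derivative_fderiv: "f differentiable at x \<Longrightarrow> (f has_derivative fderiv f x) (at x)"
  using frechet_derivative_works by blast

lemma fderiv_eq: "(f has_derivative f') (at x) \<Longrightarrow> fderiv f x = f'"
  using frechet_derivative_at by metis

text \<open>The chosen derivative depends only on the relation \<open>has_derivative\<close>, and
  that relation only on the germ of the function at \<open>x\<close>.\<close>

lemma fderiv_cong:
  assumes "open S" "x \<in> S" "\<And>y. y \<in> S \<Longrightarrow> f y = g y"
  shows "fderiv f x = fderiv g x"
proof -
  have "(f has_derivative D) (at x) \<longleftrightarrow> (g has_derivative D) (at x)" for D
    using assms has_derivative_transform_within_open[of f D x UNIV S g]
      has_derivative_transform_within_open[of g D x UNIV S f] by auto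
  then show ?thesis by (simp add: frechet_derivative_def)
qed

lemma differentiable_on_open_cong:
  assumes "open S" "\<And>y. y \<in> S \<Longrightarrow> f y = g y" "f differentiable_on S"
  shows "g differentiable_on S"
  using assms unfolding differentiable_on_def differentiable_def
  by (metis at_within_open has_derivative_transform_within_open)

lemma Ck_on_cong:
  assumes "open S" "\<And>x. x \<in> S \<Longrightarrow> f x = g x" "Ck_on k f S"
  shows "Ck_on k g S"
  using assms(2,3)
proof (induction k arbitrary: f g)
  case 0
  then show ?case by (auto cong: continuous_on_cong)
next
  case (Suc k)
  have *: "fderiv f x = fderiv g x" if "x \<in> S" for x
    using fderiv_cong[OF assms(1) that] Suc.prems(1) by blast
  have "Ck_on k (\<lambda>x. fderiv g x v) S" for v
    by (rule Suc.IH[of "\<lambda>x. fderiv f x v"]) (use Suc.prems(2) * in simp_all)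
  then show ?case
    using Suc.prems differentiable_on_open_cong[OF assms(1), of f g] by auto
qed

text \<open>Introduction rule for the inductions on the order: any derivative found by a
  differentiation rule may be supplied in place of the chosen \<open>fderiv\<close>.\<close>

lemma Ck_on_Suc_intro:
  assumes "open S" "\<And>x. x \<in> S \<Longrightarrow> (f has_derivative f' x) (at x)"
    "\<And>v. Ck_on k (\<lambda>x. f' x v) S"
  shows "Ck_on (Suc k) f S"
proof -
  have "f differentiable_on S"
    using assms(1,2) by (meson differentiable_def differentiable_at_imp_differentiable_on)
  moreover have "Ck_on k (\<lambda>x. fderiv f x v) S" for v
    by (rule Ck_on_cong[OF assms(1) _ assms(3)[of v]]) (simp add: fderiv_eq[OF assms(2)])
  ultimately show ?thesis by simp
qed

lemma Ck_on_SucD: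
  assumes "open S" "Ck_on (Suc k) f S"
  shows "x \<in> S \<Longrightarrow> (f has_derivative fderiv f x) (at x)" "Ck_on k (\<lambda>x. fderiv f x v) S"
proof -
  show "(f has_derivative fderiv f x) (at x)" if "x \<in> S"
    using assms that by (metis Ck_on.simps(2) at_within_open differentiable_on_def frechet_derivative_works)
  show "Ck_on k (\<lambda>x. fderiv f x v) S" using assms by simp
qed

lemma Ck_on_subset:
  assumes "open T" "T \<subseteq> S" "Ck_on k f S"
  shows "Ck_on k f T"
  using assms(3)
  by (induction k arbitrary: f)
    (use assms in \<open>auto intro: continuous_on_subset differentiable_on_subset\<close>)

lemma Ck_on_Suc_imp:
  assumes "open S" "Ck_on (Suc k) f S"
  shows "Ck_on k f S"
  using assms(2)
proof (induction k arbitrary: f)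
  case 0
  then show ?case by (simp add: differentiable_imp_continuous_on)
next
  case (Suc k)
  then show ?case by simp
qed

text \<open>Regularity can thus be checked on pieces, such as overlaps of charts, on which an
  explicit formula is available.\<close>

lemma Ck_on_local:
  assumes "\<And>x. x \<in> S \<Longrightarrow> \<exists>T. open T \<and> x \<in> T \<and> Ck_on k f T"
  shows "Ck_on k f S"
  using assms
proof (induction k arbitrary: f)
  case 0
  show ?case
  proof (simp add: continuous_on_eq_continuous_within, intro ballI)
    fix x assume "x \<in> S"
    then obtain T where "open T" "x \<in> T" "continuous_on T f" using 0 by auto
    then show "continuous (at x within S) f"
      using continuous_on_eq_continuous_at continuous_at_imp_continuous_within by blast
  qed
next
  case (Suc k)
  have "f differentiable_on S" unfolding differentiable_on_def
  proof
    fix x assume "x \<in> S"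
    then obtain T where "open T" "x \<in> T" "f differentiable_on T" using Suc.prems by auto
    then show "f differentiable at x within S"
      by (metis at_within_open differentiable_at_withinI differentiable_on_def)
  qed
  moreover have "Ck_on k (\<lambda>x. fderiv f x v) S" for v
    by (rule Suc.IH) (use Suc.prems in fastforce)
  ultimately show ?case by simp
qed

lemma Ck_on_const: "Ck_on k (\<lambda>x. c) S"
  by (induction k arbitrary: c) (auto simp: frechet_derivative_const)

lemma Ck_on_bounded_linear:
  assumes "bounded_linear L" "open S"
  shows "Ck_on k L S"
proof (cases k)
  case 0
  then show ?thesis using assms by (simp add: linear_continuous_on)
next
  case (Suc l)
  show ?thesis unfolding Suc
    by (rule Ck_on_Suc_intro[where f' = "\<lambda>x. L"])
      (use assms in \<open>auto intro: bounded_linear_imp_has_derivative Ck_on_const\<close>)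
qed

lemma Ck_on_add:
  assumes "open S" "Ck_on k f S" "Ck_on k g S"
  shows "Ck_on k (\<lambda>x. f x + g x) S"
  using assms(2,3)
proof (induction k arbitrary: f g)
  case 0
  then show ?case by (auto intro: continuous_intros)
next
  case (Suc k)
  show ?case
  proof (rule Ck_on_Suc_intro[where f' = "\<lambda>x v. fderiv f x v + fderiv g x v"])
    show "((\<lambda>x. f x + g x) has_derivative (\<lambda>v. fderiv f x v + fderiv g x v)) (at x)" if "x \<in> S" for x
      by (rule has_derivative_add) (rule Ck_on_SucD(1)[OF assms(1) _ that], rule Suc.prems)+
    show "Ck_on k (\<lambda>x. fderiv f x v + fderiv g x v) S" for v
      by (rule Suc.IH) (rule Ck_on_SucD(2)[OF assms(1)], rule Suc.prems)+
  qed (rule assms(1))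
qed

text \<open>Leibniz rule: each term of the derivative pairs an undifferentiated with a
  differentiated factor, and both are of class C^k, so the induction hypothesis applies.\<close>

lemma Ck_on_bilinear:
  assumes "bounded_bilinear B" "open S" "Ck_on k f S" "Ck_on k g S"
  shows "Ck_on k (\<lambda>x. B (f x) (g x)) S"
proof -
  interpret bounded_bilinear B by fact
  show ?thesis using assms(3,4)
  proof (induction k arbitrary: f g)
    case 0
    then show ?case by (auto intro: continuous_on)
  next
    case (Suc k)
    show ?case
    proof (rule Ck_on_Suc_intro[where f' = "\<lambda>x v. B (f x) (fderiv g x v) + B (fderiv f x v) (g x)"])
      show "((\<lambda>x. B (f x) (g x)) has_derivative (\<lambda>v. B (f x) (fderiv g x v) + B (fderiv f x v) (g x))) (at x)"
        if "x \<in> S" for x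
        by (rule FDERIV) (rule Ck_on_SucD(1)[OF assms(2) _ that], rule Suc.prems)+
      show "Ck_on k (\<lambda>x. B (f x) (fderiv g x v) + B (fderiv f x v) (g x)) S" for v
        by (rule Ck_on_add[OF assms(2)]; rule Suc.IH)
          (rule Suc.prems[THEN Ck_on_SucD(2)[OF assms(2)]] Suc.prems[THEN Ck_on_Suc_imp[OF assms(2)]])+
    qed (rule assms(2))
  qed
qed

lemma Ck_on_linear_comp:
  assumes "bounded_linear L" "open S" "Ck_on k f S"
  shows "Ck_on k (\<lambda>x. L (f x)) S"
  using assms(3)
proof (induction k arbitrary: f)
  case 0
  then show ?case using assms by (auto intro: bounded_linear.continuous_on)
next
  case (Suc k)
  show ?case
  proof (rule Ck_on_Suc_intro[where f' = "\<lambda>x v. L (fderiv f x v)"])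
    show "((\<lambda>x. L (f x)) has_derivative (\<lambda>v. L (fderiv f x v))) (at x)" if "x \<in> S" for x
      by (rule bounded_linear.has_derivative[OF assms(1) Ck_on_SucD(1)[OF assms(2) Suc.prems that]])
    show "Ck_on k (\<lambda>x. L (fderiv f x v)) S" for v
      by (rule Suc.IH[OF Ck_on_SucD(2)[OF assms(2) Suc.prems]])
  qed (rule assms(2))
qed

lemma Ck_on_sum:
  assumes "open S" "\<And>i. i \<in> I \<Longrightarrow> Ck_on k (f i) S"
  shows "Ck_on k (\<lambda>x. \<Sum>i\<in>I. f i x) S"
  using assms(2)
  by (induction I rule: infinite_finite_induct) (auto intro: Ck_on_const Ck_on_add assms(1))

lemma linear_euclid_expand:
  fixes f :: "'a::euclidean_space \<Rightarrow> 'b::real_vector"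
  assumes "linear f"
  shows "f v = (\<Sum>b\<in>Basis. (v \<bullet> b) *\<^sub>R f b)"
proof -
  have "f v = f (\<Sum>b\<in>Basis. (v \<bullet> b) *\<^sub>R b)" by (simp add: euclidean_representation)
  also have "\<dots> = (\<Sum>b\<in>Basis. (v \<bullet> b) *\<^sub>R f b)" by (simp add: linear_sum[OF assms] linear_cmul[OF assms])
  finally show ?thesis .
qed

text \<open>In the chain rule the vector argument \<open>fderiv g x v\<close> varies with
  \<open>x\<close>, so the derivative is not itself a composition with \<open>g\<close>. Expanded in
  the standard basis it becomes a finite sum of scalars times such compositions.\<close>

lemma Ck_on_compose:
  fixes g :: "'a::real_normed_vector \<Rightarrow> 'b::euclidean_space" and f :: "'b \<Rightarrow> 'c::real_normed_vector"
  assumes "open S" "open T" "g ` S \<subseteq> T" "Ck_on k g S" "Ck_on k f T"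
  shows "Ck_on k (\<lambda>x. f (g x)) S"
  using assms(4,5)
proof (induction k arbitrary: f)
  case 0
  then show ?case using assms(3) by (auto intro: continuous_on_compose2)
next
  case (Suc k)
  have lin: "linear (fderiv f (g x))" if "x \<in> S" for x
    using Ck_on_SucD(1)[OF assms(2) Suc.prems(2), of "g x"] that assms(3)
    by (auto intro: has_derivative_linear)
  show ?case
  proof (rule Ck_on_Suc_intro[where f' = "\<lambda>x v. fderiv f (g x) (fderiv g x v)"])
    show "((\<lambda>x. f (g x)) has_derivative (\<lambda>v. fderiv f (g x) (fderiv g x v))) (at x)" if "x \<in> S" for x
      using Ck_on_SucD(1)[OF assms(2) Suc.prems(2), of "g x"] Ck_on_SucD(1)[OF assms(1) Suc.prems(1) that]
        that assms(3) by (auto intro: has_derivative_compose)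
    show "Ck_on k (\<lambda>x. fderiv f (g x) (fderiv g x v)) S" for v
    proof (rule Ck_on_cong[OF assms(1)])
      show "Ck_on k (\<lambda>x. \<Sum>b\<in>Basis. (fderiv g x v \<bullet> b) *\<^sub>R fderiv f (g x) b) S"
      proof (rule Ck_on_sum[OF assms(1)], rule Ck_on_bilinear[OF bounded_bilinear_scaleR assms(1)])
        fix b :: 'b
        show "Ck_on k (\<lambda>x. fderiv g x v \<bullet> b) S"
          by (rule Ck_on_linear_comp[OF bounded_linear_inner_left assms(1)]) (use Suc.prems in simp)
        show "Ck_on k (\<lambda>x. fderiv f (g x) b) S"
          by (rule Suc.IH[OF Ck_on_Suc_imp[OF assms(1) Suc.prems(1)] Ck_on_SucD(2)[OF assms(2) Suc.prems(2)]])
      qed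
    qed (rule linear_euclid_expand[OF lin, symmetric])
  qed (rule assms(1))
qed

section \<open>Rules for smooth functions and for families of linear maps\<close>

lemma smooth_on_cong:
  "open S \<Longrightarrow> (\<And>x. x \<in> S \<Longrightarrow> f x = g x) \<Longrightarrow> smooth_on f S \<Longrightarrow> smooth_on g S"
  unfolding smooth_on_def using Ck_on_cong by blast

lemma smooth_on_subset: "smooth_on f S \<Longrightarrow> open T \<Longrightarrow> T \<subseteq> S \<Longrightarrow> smooth_on f T"
  unfolding smooth_on_def using Ck_on_subset by blast

lemma smooth_on_local:
  assumes "\<And>x. x \<in> S \<Longrightarrow> \<exists>T. open T \<and> x \<in> T \<and> smooth_on f T"
  shows "smooth_on f S"
  unfolding smooth_on_def using assms Ck_on_local unfolding smooth_on_def by metis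

lemma smooth_on_continuous: "smooth_on f S \<Longrightarrow> continuous_on S f"
  unfolding smooth_on_def using Ck_on.simps(1) by blast

lemma smooth_on_has_derivative:
  "smooth_on f S \<Longrightarrow> open S \<Longrightarrow> x \<in> S \<Longrightarrow> (f has_derivative fderiv f x) (at x)"
  unfolding smooth_on_def using Ck_on_SucD by blast

lemma smooth_on_fderiv: "smooth_on f S \<Longrightarrow> smooth_on (\<lambda>x. fderiv f x v) S"
  unfolding smooth_on_def using Ck_on.simps(2) by blast

lemma smooth_on_linear_fderiv:
  "smooth_on f S \<Longrightarrow> open S \<Longrightarrow> x \<in> S \<Longrightarrow> linear (fderiv f x)"
  using smooth_on_has_derivative has_derivative_linear by blast

lemma smooth_on_const: "smooth_on (\<lambda>x. c) S"
  unfolding smooth_on_def using Ck_on_const by blast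

lemma smooth_on_bounded_linear: "bounded_linear L \<Longrightarrow> open S \<Longrightarrow> smooth_on L S"
  unfolding smooth_on_def using Ck_on_bounded_linear by blast

lemma smooth_on_id: "open S \<Longrightarrow> smooth_on (\<lambda>x. x) S"
  using smooth_on_bounded_linear bounded_linear_ident by blast

lemma smooth_on_bilinear:
  "bounded_bilinear B \<Longrightarrow> open S \<Longrightarrow> smooth_on f S \<Longrightarrow> smooth_on g S \<Longrightarrow> smooth_on (\<lambda>x. B (f x) (g x)) S"
  unfolding smooth_on_def using Ck_on_bilinear by blast

lemmas smooth_on_mult = smooth_on_bilinear[OF bounded_bilinear_mult]
lemmas smooth_on_scaleR = smooth_on_bilinear[OF bounded_bilinear_scaleR]
lemmas smooth_on_inner = smooth_on_bilinear[OF bounded_bilinear_inner]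

lemma smooth_on_linear_comp:
  "bounded_linear L \<Longrightarrow> open S \<Longrightarrow> smooth_on f S \<Longrightarrow> smooth_on (\<lambda>x. L (f x)) S"
  unfolding smooth_on_def using Ck_on_linear_comp by blast

lemma smooth_on_add: "open S \<Longrightarrow> smooth_on f S \<Longrightarrow> smooth_on g S \<Longrightarrow> smooth_on (\<lambda>x. f x + g x) S"
  unfolding smooth_on_def using Ck_on_add by blast

lemma smooth_on_minus: "open S \<Longrightarrow> smooth_on f S \<Longrightarrow> smooth_on (\<lambda>x. - f x) S"
  by (rule smooth_on_linear_comp[OF bounded_linear_minus[OF bounded_linear_ident]])

lemma smooth_on_diff: "open S \<Longrightarrow> smooth_on f S \<Longrightarrow> smooth_on g S \<Longrightarrow> smooth_on (\<lambda>x. f x - g x) S"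
  using smooth_on_add[of S f "\<lambda>x. - g x"] smooth_on_minus[of S g] by simp

lemma smooth_on_sum:
  "open S \<Longrightarrow> (\<And>i. i \<in> I \<Longrightarrow> smooth_on (f i) S) \<Longrightarrow> smooth_on (\<lambda>x. \<Sum>i\<in>I. f i x) S"
  unfolding smooth_on_def by (simp add: Ck_on_sum)

lemma smooth_on_compose:
  fixes g :: "'a::real_normed_vector \<Rightarrow> 'b::euclidean_space"
  assumes "open S" "open T" "g ` S \<subseteq> T" "smooth_on g S" "smooth_on f T"
  shows "smooth_on (\<lambda>x. f (g x)) S"
  using assms unfolding smooth_on_def by (auto intro: Ck_on_compose)

text \<open>Linearity in a finite-dimensional argument replaces joint smoothness: the basis
  expansion leaves products of smooth coefficients with the functions
  \<open>\<lambda>x. L x b\<close>.\<close>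

lemma smooth_on_linear_family:
  fixes L :: "'a::real_normed_vector \<Rightarrow> 'b::euclidean_space \<Rightarrow> 'c::real_normed_vector"
  assumes "open S" "\<And>x. x \<in> S \<Longrightarrow> linear (L x)" "\<And>u. smooth_on (\<lambda>x. L x u) S" "smooth_on f S"
  shows "smooth_on (\<lambda>x. L x (f x)) S"
proof (rule smooth_on_cong[OF assms(1)])
  show "smooth_on (\<lambda>x. \<Sum>b\<in>Basis. (f x \<bullet> b) *\<^sub>R L x b) S"
    by (intro smooth_on_sum[OF assms(1)] smooth_on_scaleR[OF assms(1)] smooth_on_inner[OF assms(1)]
        smooth_on_const assms(3,4))
qed (rule linear_euclid_expand[OF assms(2), symmetric])

text \<open>Sums and multiples in \<open>u\<close> pass through the derivative in \<open>x\<close>,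
  and derivatives are unique.\<close>

lemma linear_fderiv_family:
  fixes L :: "'a::real_normed_vector \<Rightarrow> 'b::euclidean_space \<Rightarrow> 'c::real_normed_vector"
  assumes S: "open S" "x \<in> S" and lin: "\<And>x. x \<in> S \<Longrightarrow> linear (L x)"
    and L: "\<And>u. ((\<lambda>x. L x u) has_derivative L' u) (at x)"
  shows "linear (\<lambda>u. L' u v)"
proof
  fix u1 u2 :: 'b and r :: real
  have "((\<lambda>x. L x u1 + L x u2) has_derivative (\<lambda>v. L' u1 v + L' u2 v)) (at x)"
    by (intro derivative_intros L)
  then have "((\<lambda>x. L x (u1 + u2)) has_derivative (\<lambda>v. L' u1 v + L' u2 v)) (at x)"
    by (rule has_derivative_transform_within_open[OF _ S]) (use lin linear_add in metis)
  from has_derivative_unique[OF this L] show "L' (u1 + u2) v = L' u1 v + L' u2 v" by metis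
  have "((\<lambda>x. r *\<^sub>R L x u1) has_derivative (\<lambda>v. r *\<^sub>R L' u1 v)) (at x)"
    by (intro derivative_intros L)
  then have "((\<lambda>x. L x (r *\<^sub>R u1)) has_derivative (\<lambda>v. r *\<^sub>R L' u1 v)) (at x)"
    by (rule has_derivative_transform_within_open[OF _ S]) (use lin linear_cmul in metis)
  from has_derivative_unique[OF this L] show "L' (r *\<^sub>R u1) v = r *\<^sub>R L' u1 v" by metis
qed

lemma has_derivative_linear_family:
  fixes L :: "'a::real_normed_vector \<Rightarrow> 'b::euclidean_space \<Rightarrow> 'c::real_normed_vector"
  assumes "open S" "x \<in> S" "\<And>x. x \<in> S \<Longrightarrow> linear (L x)"
    and L: "\<And>u. ((\<lambda>x. L x u) has_derivative L' u) (at x)" and f: "(f has_derivative f') (at x)"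
  shows "((\<lambda>x. L x (f x)) has_derivative (\<lambda>v. L' (f x) v + L x (f' v))) (at x)"
proof -
  have linL': "linear (\<lambda>u. L' u v)" for v
    by (rule linear_fderiv_family[OF assms(1-3) L])
  have "((\<lambda>x. \<Sum>b\<in>Basis. (f x \<bullet> b) *\<^sub>R L x b) has_derivative
      (\<lambda>v. \<Sum>b\<in>Basis. (f x \<bullet> b) *\<^sub>R L' b v + (f' v \<bullet> b) *\<^sub>R L x b)) (at x)"
    by (intro has_derivative_sum has_derivative_scaleR has_derivative_inner_left L f)
  also have "(\<lambda>v. \<Sum>b\<in>Basis. (f x \<bullet> b) *\<^sub>R L' b v + (f' v \<bullet> b) *\<^sub>R L x b) = (\<lambda>v. L' (f x) v + L x (f' v))"
    unfolding sum.distrib linear_euclid_expand[OF linL', of "f x", symmetric]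
      linear_euclid_expand[OF assms(3)[OF assms(2)], symmetric] ..
  finally show ?thesis
    by (rule has_derivative_transform_within_open[OF _ assms(1,2)])
      (rule linear_euclid_expand[OF assms(3), symmetric])
qed

section \<open>Regularity of solutions of linear systems, and the smooth inverse function
  theorem\<close>

text \<open>The remainder splits into \<open>c\<close> times the remainder of \<open>e\<close>, and
  \<open>c - c x0\<close> times the linear part \<open>e'\<close>. The second is small because
  \<open>c\<close> is continuous and \<open>e'\<close> bounded. This differentiates a product one
  factor of which is only known to be continuous.\<close>

lemma has_derivative_continuous_mult_vanishing:
  fixes e :: "'a::real_normed_vector \<Rightarrow> 'b::real_normed_vector"
  assumes c: "isCont c x0" and e: "(e has_derivative e') (at x0)" and e0: "e x0 = 0"
  shows "((\<lambda>x. c x *\<^sub>R e x) has_derivative (\<lambda>v. c x0 *\<^sub>R e' v)) (at x0)"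
proof -
  have bl: "bounded_linear e'" using e by (rule has_derivative_bounded_linear)
  then obtain K where K: "\<And>v. norm (e' v) \<le> norm v * K" using bounded_linear.bounded by blast
  define q where "q y = inverse (norm (y - x0)) *\<^sub>R (e y - e' (y - x0))" for y
  have q: "(q \<longlongrightarrow> 0) (at x0)"
    using e e0 unfolding has_derivative_at_within q_def by (simp add: divideR_right inverse_eq_divide)
  have cc: "((\<lambda>y. c y - c x0) \<longlongrightarrow> 0) (at x0)"
    using c by (simp add: isCont_def LIM_zero)
  have b: "((\<lambda>y. (c y - c x0) *\<^sub>R (inverse (norm (y - x0)) *\<^sub>R e' (y - x0))) \<longlongrightarrow> 0) (at x0)"
  proof (rule tendsto_norm_zero_cancel, rule Lim_null_comparison)
    show "((\<lambda>y. \<bar>c y - c x0\<bar> * \<bar>K\<bar>) \<longlongrightarrow> 0) (at x0)"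
      by (rule tendsto_mult_left_zero, rule tendsto_rabs_zero[OF cc])
    show "eventually (\<lambda>y. norm (norm ((c y - c x0) *\<^sub>R (inverse (norm (y - x0)) *\<^sub>R e' (y - x0)))) \<le> \<bar>c y - c x0\<bar> * \<bar>K\<bar>) (at x0)"
    proof (rule always_eventually, rule allI)
      fix y
      have "inverse (norm (y - x0)) * norm (e' (y - x0)) \<le> \<bar>K\<bar>"
      proof (cases "y = x0")
        case False
        have "norm (e' (y - x0)) \<le> norm (y - x0) * \<bar>K\<bar>"
          by (rule order_trans[OF K]) (simp add: mult_left_mono)
        with False show ?thesis by (simp add: field_simps)
      qed simp
      from mult_left_mono[OF this abs_ge_zero[of "c y - c x0"]]
      show "norm (norm ((c y - c x0) *\<^sub>R (inverse (norm (y - x0)) *\<^sub>R e' (y - x0)))) \<le> \<bar>c y - c x0\<bar> * \<bar>K\<bar>"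
        by (simp add: abs_mult mult.assoc)
    qed
  qed
  have a: "((\<lambda>y. c y *\<^sub>R q y) \<longlongrightarrow> 0) (at x0)"
    using tendsto_scaleR[OF c[unfolded isCont_def] q] by simp
  have eq: "c y *\<^sub>R q y + (c y - c x0) *\<^sub>R (inverse (norm (y - x0)) *\<^sub>R e' (y - x0))
      = inverse (norm (y - x0)) *\<^sub>R (c y *\<^sub>R e y - c x0 *\<^sub>R e' (y - x0))" for y
    by (simp add: q_def algebra_simps)
  have "((\<lambda>y. inverse (norm (y - x0)) *\<^sub>R (c y *\<^sub>R e y - c x0 *\<^sub>R e' (y - x0))) \<longlongrightarrow> 0) (at x0)"
    using tendsto_add[OF a b] unfolding eq by simp
  then show ?thesis
    using e0 bl unfolding has_derivative_at_within
    by (auto intro: bounded_linear_const_scaleR simp: divideR_right inverse_eq_divide)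
qed

text \<open>The solution \<open>a\<close> is compared with its value at a point \<open>x0\<close> through a left inverse of
  \<open>G x0\<close>; its derivatives solve systems with the same left-hand side, which gives the
  induction on \<open>k\<close>. The system may be overdetermined.\<close>

lemma Ck_on_linear_solve:
  fixes G :: "'a::real_normed_vector \<Rightarrow> 'b::euclidean_space \<Rightarrow> 'c::euclidean_space"
  assumes S: "open S" and lin: "\<And>x. x \<in> S \<Longrightarrow> linear (G x)" and inj: "\<And>x. x \<in> S \<Longrightarrow> inj (G x)"
    and "\<And>u. Ck_on k (\<lambda>x. G x u) S" "Ck_on k rhs S" "\<And>x. x \<in> S \<Longrightarrow> G x (a x) = rhs x"
  shows "Ck_on k a S"
proof -
  have cont: "isCont a x0"
    if x0: "x0 \<in> S" and cG: "\<And>u. continuous_on S (\<lambda>x. G x u)" and cr: "continuous_on S rhs"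
      and eq: "\<And>x. x \<in> S \<Longrightarrow> G x (a x) = rhs x" for rhs x0 and a :: "'a \<Rightarrow> 'b"
  proof -
    obtain P where P: "linear P" "P \<circ> G x0 = id"
      using linear_injective_left_inverse[OF lin[OF x0] inj[OF x0]] by blast
    have Pb: "bounded_linear P" using P(1) by (rule linear_conv_bounded_linear[THEN iffD1])
    \<comment> \<open>\<open>E x\<close> measures how far the left inverse \<open>P\<close> at
      \<open>x0\<close> is from being a left inverse at \<open>x\<close>; it vanishes at
      \<open>x0\<close>.\<close>
    define E where "E x b = P (G x b) - b" for x b
    have E0: "E x0 b = 0" for b using P(2) by (simp add: E_def fun_eq_iff)
    have ev: "eventually (\<lambda>x. x \<in> S) (at x0)"
      using S x0 eventually_at_topological by blast
    have cGx: "isCont (\<lambda>x. G x u) x0" for u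
      using cG S x0 continuous_on_eq_continuous_at by blast
    have crx: "isCont rhs x0"
      using cr S x0 continuous_on_eq_continuous_at by blast
    have cE: "isCont (\<lambda>x. E x b) x0" for b unfolding E_def
      by (intro continuous_intros bounded_linear.isCont[OF Pb] cGx)
    have expand: "P (G x u) = u + (\<Sum>b\<in>Basis. (u \<bullet> b) *\<^sub>R E x b)" if "x \<in> S" for x u
    proof -
      have "P (G x u) = (\<Sum>b\<in>Basis. (u \<bullet> b) *\<^sub>R P (G x b))"
        using linear_euclid_expand[OF linear_compose[OF lin[OF that] P(1)], of u] by (simp add: o_def)
      then show ?thesis
        by (simp add: E_def scaleR_diff_right sum_subtractf euclidean_representation)
    qed
    have "((\<lambda>x. \<Sum>b\<in>Basis. norm (E x b)) \<longlongrightarrow> (\<Sum>b\<in>Basis. norm (E x0 b))) (at x0)"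
      by (intro tendsto_intros cE[unfolded isCont_def])
    then have "eventually (\<lambda>x. (\<Sum>b\<in>Basis. norm (E x b)) < 1/2) (at x0)"
      by (intro order_tendstoD(2)) (auto simp: E0)
    \<comment> \<open>Once the norms of the \<open>E x b\<close> sum to less than 1/2, the error
      term absorbs at most half of \<open>norm (a x - a x0)\<close>; this is the origin of the
      factor 2.\<close>
    then have half: "eventually (\<lambda>x. norm (a x - a x0) \<le> norm (2 *\<^sub>R P (rhs x - G x (a x0)))) (at x0)"
      using ev
    proof eventually_elim
      case (elim x)
      define u where "u = a x - a x0"
      have Pu: "P (G x u) = P (rhs x - G x (a x0))"
        unfolding u_def using lin elim(2) eq by (simp add: linear_diff)
      have "norm (\<Sum>b\<in>Basis. (u \<bullet> b) *\<^sub>R E x b) \<le> (\<Sum>b\<in>Basis. norm u * norm (E x b))"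
        by (intro sum_norm_le) (simp add: Basis_le_norm mult_right_mono)
      also have "\<dots> \<le> norm u * (1/2)"
        unfolding sum_distrib_left[symmetric] using elim(1) by (intro mult_left_mono) auto
      finally have "norm u \<le> norm (P (G x u)) + norm u / 2"
        using expand[OF elim(2), of u] norm_triangle_ineq4[of "P (G x u)" "\<Sum>b\<in>Basis. (u \<bullet> b) *\<^sub>R E x b"] by simp
      then show ?case using Pu by (simp add: u_def)
    qed
    have "((\<lambda>x. 2 *\<^sub>R P (rhs x - G x (a x0))) \<longlongrightarrow> 2 *\<^sub>R P (rhs x0 - G x0 (a x0))) (at x0)"
      by (intro tendsto_intros bounded_linear.tendsto[OF Pb] crx[unfolded isCont_def] cGx[unfolded isCont_def])
    then have "((\<lambda>x. 2 *\<^sub>R P (rhs x - G x (a x0))) \<longlongrightarrow> 0) (at x0)"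
      using eq[OF x0] linear_0[OF P(1)] by simp
    then have "((\<lambda>x. a x - a x0) \<longlongrightarrow> 0) (at x0)"
      by (intro Lim_null_comparison[OF half tendsto_norm_zero])
    then show ?thesis unfolding isCont_def by (rule LIM_zero_cancel)
  qed
  have diff: "a differentiable at x0"
    if x0: "x0 \<in> S" and dG: "\<And>u. (\<lambda>x. G x u) differentiable at x0" and dr: "rhs differentiable at x0"
      and ca: "isCont a x0" and eq: "\<And>x. x \<in> S \<Longrightarrow> G x (a x) = rhs x" for rhs x0 and a :: "'a \<Rightarrow> 'b"
  proof -
    obtain P where P: "linear P" "P \<circ> G x0 = id"
      using linear_injective_left_inverse[OF lin[OF x0] inj[OF x0]] by blast
    have Pb: "bounded_linear P" using P(1) by (rule linear_conv_bounded_linear[THEN iffD1])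
    define E where "E x b = P (G x b) - b" for x b
    have E0: "E x0 b = 0" for b using P(2) by (simp add: E_def fun_eq_iff)
    have expand: "P (rhs x) - (\<Sum>b\<in>Basis. (a x \<bullet> b) *\<^sub>R E x b) = a x" if "x \<in> S" for x
    proof -
      have "P (G x (a x)) = (\<Sum>b\<in>Basis. (a x \<bullet> b) *\<^sub>R P (G x b))"
        using linear_euclid_expand[OF linear_compose[OF lin[OF that] P(1)], of "a x"] by (simp add: o_def)
      then show ?thesis
        using eq[OF that] by (simp add: E_def scaleR_diff_right sum_subtractf euclidean_representation)
    qed
    have dE: "((\<lambda>x. E x b) has_derivative (\<lambda>v. P (fderiv (\<lambda>x. G x b) x0 v) - 0)) (at x0)" for b
      unfolding E_def
      by (intro has_derivative_diff bounded_linear.has_derivative[OF Pb] has_derivative_fderiv dG has_derivative_const)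
    \<comment> \<open>On this side \<open>a\<close> occurs only multiplied by \<open>E\<close>,
      which vanishes at \<open>x0\<close>, so continuity of \<open>a\<close> is enough to
      differentiate.\<close>
    have "((\<lambda>x. P (rhs x) - (\<Sum>b\<in>Basis. (a x \<bullet> b) *\<^sub>R E x b)) has_derivative
        (\<lambda>v. P (fderiv rhs x0 v) - (\<Sum>b\<in>Basis. (a x0 \<bullet> b) *\<^sub>R (P (fderiv (\<lambda>x. G x b) x0 v) - 0)))) (at x0)"
      by (intro has_derivative_diff has_derivative_sum has_derivative_continuous_mult_vanishing dE E0
          bounded_linear.has_derivative[OF Pb] has_derivative_fderiv dr continuous_intros ca)
    then show ?thesis unfolding differentiable_def
      by - (rule exI, erule has_derivative_transform_within_open[OF _ S x0], rule expand)
  qed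
  show ?thesis using assms(4-)
  proof (induction k arbitrary: a rhs)
    case 0
    then show ?case using cont by (auto intro: continuous_at_imp_continuous_on)
  next
    case (Suc k)
    have G': "Ck_on k (\<lambda>x. G x u) S" "continuous_on S (\<lambda>x. G x u)" for u
      by (rule Ck_on_Suc_imp[OF S Suc.prems(1)], rule differentiable_imp_continuous_on)
        (use Suc.prems(1)[of u] in simp)
    have r': "Ck_on k rhs S" "continuous_on S rhs"
      by (rule Ck_on_Suc_imp[OF S Suc.prems(2)], rule differentiable_imp_continuous_on)
        (use Suc.prems(2) in simp)
    have da: "(a has_derivative fderiv a x) (at x)" if "x \<in> S" for x
      by (intro has_derivative_fderiv diff[OF that _ _ cont[OF that G'(2) r'(2) Suc.prems(3)] Suc.prems(3)]
          differentiableI[OF Ck_on_SucD(1)[OF S Suc.prems(1) that]]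
          differentiableI[OF Ck_on_SucD(1)[OF S Suc.prems(2) that]])
    have ka: "Ck_on k a S"
      by (rule Suc.IH[OF G'(1) r'(1) Suc.prems(3)])
    show ?case
    proof (rule Ck_on_Suc_intro[OF S da])
      fix v
      \<comment> \<open>Right-hand side of the system obtained by differentiating
        \<open>G x (a x) = rhs x\<close> in the direction \<open>v\<close>; the derivative of
        \<open>a\<close> is its unknown.\<close>
      define R where "R x = fderiv rhs x v - (\<Sum>b\<in>Basis. (a x \<bullet> b) *\<^sub>R fderiv (\<lambda>x. G x b) x v)" for x
      show "Ck_on k (\<lambda>x. fderiv a x v) S"
      proof (rule Suc.IH[OF G'(1)])
        have sum: "Ck_on k (\<lambda>x. \<Sum>b\<in>Basis. (a x \<bullet> b) *\<^sub>R fderiv (\<lambda>x. G x b) x v) S"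
          by (rule Ck_on_sum[OF S], rule Ck_on_bilinear[OF bounded_bilinear_scaleR S])
            (rule Ck_on_linear_comp[OF bounded_linear_inner_left S ka] Ck_on_SucD(2)[OF S Suc.prems(1)])+
        have "Ck_on k (\<lambda>x. - (\<Sum>b\<in>Basis. (a x \<bullet> b) *\<^sub>R fderiv (\<lambda>x. G x b) x v)) S"
          by (rule Ck_on_linear_comp[OF bounded_linear_minus[OF bounded_linear_ident] S sum])
        from Ck_on_add[OF S Ck_on_SucD(2)[OF S Suc.prems(2)] this, of v]
        show "Ck_on k R S" unfolding R_def by simp
        fix x assume x: "x \<in> S"
        have "((\<lambda>x. \<Sum>b\<in>Basis. (a x \<bullet> b) *\<^sub>R G x b) has_derivative
            (\<lambda>v. \<Sum>b\<in>Basis. (a x \<bullet> b) *\<^sub>R fderiv (\<lambda>x. G x b) x v + (fderiv a x v \<bullet> b) *\<^sub>R G x b)) (at x)"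
          by (intro has_derivative_sum has_derivative_scaleR has_derivative_inner_left
              Ck_on_SucD(1)[OF S Suc.prems(1) x] da[OF x])
        then have "(rhs has_derivative
            (\<lambda>v. \<Sum>b\<in>Basis. (a x \<bullet> b) *\<^sub>R fderiv (\<lambda>x. G x b) x v + (fderiv a x v \<bullet> b) *\<^sub>R G x b)) (at x)"
          by (rule has_derivative_transform_within_open[OF _ S x])
            (metis Suc.prems(3) lin linear_euclid_expand)
        from fderiv_eq[OF this]
        have "fderiv rhs x v = (\<Sum>b\<in>Basis. (a x \<bullet> b) *\<^sub>R fderiv (\<lambda>x. G x b) x v) + G x (fderiv a x v)"
          using linear_euclid_expand[OF lin[OF x], of "fderiv a x v"] by (simp add: sum.distrib)
        then show "G x (fderiv a x v) = R x" by (simp add: R_def)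
      qed
    qed
  qed
qed

lemma smooth_on_linear_solve:
  fixes G :: "'a::real_normed_vector \<Rightarrow> 'b::euclidean_space \<Rightarrow> 'c::euclidean_space"
  assumes "open S" "\<And>x. x \<in> S \<Longrightarrow> linear (G x)" "\<And>x. x \<in> S \<Longrightarrow> inj (G x)"
    and "\<And>u. smooth_on (\<lambda>x. G x u) S" "smooth_on rhs S" "\<And>x. x \<in> S \<Longrightarrow> G x (a x) = rhs x"
  shows "smooth_on a S"
  using assms Ck_on_linear_solve[of S G _ rhs a] unfolding smooth_on_def by auto

text \<open>The inverse function theorem gives a continuous inverse \<open>g\<close> with derivative
  \<open>g'\<close>. Higher orders follow by induction: \<open>g' y v\<close> solves the linear
  system of \<open>fderiv f (g y)\<close>, whose coefficients are as regular as
  \<open>g\<close>.\<close>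

lemma smooth_local_inverse:
  fixes f :: "'a::euclidean_space \<Rightarrow> 'a"
  assumes "smooth_on f U" "open U" "x0 \<in> U" "inj (fderiv f x0)"
  obtains U' V g where "open U'" "x0 \<in> U'" "U' \<subseteq> U" "open V" "f ` U' = V" "g ` V = U'"
    "\<And>x. x \<in> U' \<Longrightarrow> g (f x) = x" "\<And>y. y \<in> V \<Longrightarrow> f (g y) = y" "smooth_on g V"
    "\<And>x. x \<in> U' \<Longrightarrow> inj (fderiv f x)"
proof -
  have bl: "bounded_linear (fderiv f x)" if "x \<in> U" for x
    using smooth_on_has_derivative[OF assms(1,2) that] by (rule has_derivative_bounded_linear)
  define f' where "f' x = Blinfun (fderiv f x)" for x
  have f': "blinfun_apply (f' x) = fderiv f x" if "x \<in> U" for x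
    using bl[OF that] by (simp add: f'_def bounded_linear_Blinfun_apply)
  have cont: "continuous_on U f'"
  proof (rule continuous_on_blinfun_componentwise)
    fix i :: 'a
    have "continuous_on U (\<lambda>x. fderiv f x i)"
      using assms(1) smooth_on_fderiv smooth_on_continuous by blast
    then show "continuous_on U (\<lambda>x. f' x i)" using f' by (simp cong: continuous_on_cong)
  qed
  obtain P where P: "linear P" "P \<circ> fderiv f x0 = id"
    using linear_injective_left_inverse assms(4) bl[OF assms(3)] linear_conv_bounded_linear by blast
  have "Blinfun P o\<^sub>L f' x0 = id_blinfun"
    using P by (intro blinfun_eqI)
      (simp add: f'[OF assms(3)] bounded_linear_Blinfun_apply linear_conv_bounded_linear fun_eq_iff)
  then obtain U' V g g' where *: "open U'" "U' \<subseteq> U" "x0 \<in> U'" "open V" "f x0 \<in> V" "homeomorphism U' V f g"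
      "\<And>y. y \<in> V \<Longrightarrow> (g has_derivative (g' y)) (at y)" "\<And>y. y \<in> V \<Longrightarrow> g' y = inv (blinfun_apply (f' (g y)))"
      "\<And>y. y \<in> V \<Longrightarrow> bij (blinfun_apply (f' (g y)))"
    using inverse_function_theorem[OF assms(2) _ cont assms(3)] f' smooth_on_has_derivative[OF assms(1,2)]
    by (smt (verit, del_insts))
  have gV: "g y \<in> U" if "y \<in> V" for y using *(2,6) that by (auto simp: homeomorphism_def)
  have sm: "Ck_on k g V" for k
  proof (induction k)
    case 0
    then show ?case using *(6) by (simp add: homeomorphism_def)
  next
    case (Suc k)
    show ?case
    proof (rule Ck_on_Suc_intro[OF *(4,7)])
      fix v
      show "Ck_on k (\<lambda>y. g' y v) V"
      proof (rule Ck_on_linear_solve[where G = "\<lambda>y. fderiv f (g y)" and rhs = "\<lambda>y. v"])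
        show "Ck_on k (\<lambda>y. fderiv f (g y) u) V" for u
          by (rule Ck_on_compose[OF *(4) assms(2) _ Suc.IH])
            (use gV smooth_on_fderiv[OF assms(1)] in \<open>auto simp: smooth_on_def\<close>)
        show "inj (fderiv f (g y))" if "y \<in> V" for y
          using *(9)[OF that] f' gV that by (simp add: bij_def)
        show "linear (fderiv f (g y))" if "y \<in> V" for y
          using bl[OF gV[OF that]] bounded_linear.linear by blast
        show "fderiv f (g y) (g' y v) = v" if "y \<in> V" for y
          using *(8,9)[OF that] f' gV that by (simp add: bij_is_surj surj_f_inv_f)
      qed (use * in \<open>auto intro: Ck_on_const\<close>)
    qed
  qed
  show thesis
  proof (rule that[of U' V g])
    show "inj (fderiv f x)" if "x \<in> U'" for x
      using *(9)[of "f x"] *(6) f' *(2) that unfolding homeomorphism_def bij_def by (metis imageI subsetD)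
  qed (use * sm in \<open>auto simp: homeomorphism_def smooth_on_def\<close>)
qed


section \<open>Symmetry of second derivatives and brackets of related fields\<close>

text \<open>The mean value theorem is used twice: along \<open>v\<close> for the difference of
  \<open>f\<close> between the two edges parallel to \<open>v\<close>, then along \<open>w\<close>
  for the derivative in the direction \<open>v\<close>.\<close>

lemma second_difference_mean_value:
  fixes f :: "'a::euclidean_space \<Rightarrow> real"
  assumes "smooth_on f S" "open S" "0 < h"
    and sub: "\<And>s t. \<lbrakk>0 \<le> s; s \<le> h; 0 \<le> t; t \<le> h\<rbrakk> \<Longrightarrow> x + s *\<^sub>R v + t *\<^sub>R w \<in> S"
  shows "\<exists>s t. 0 < s \<and> s < h \<and> 0 < t \<and> t < h \<and>
    f (x + h *\<^sub>R v + h *\<^sub>R w) - f (x + h *\<^sub>R v) - f (x + h *\<^sub>R w) + f x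
      = h * (h * fderiv (\<lambda>y. fderiv f y v) (x + s *\<^sub>R v + t *\<^sub>R w) w)"
proof -
  have line: "DERIV (\<lambda>s. F (y + s *\<^sub>R u)) s :> fderiv F (y + s *\<^sub>R u) u"
    if "smooth_on F S" "y + s *\<^sub>R u \<in> S" for F :: "'a \<Rightarrow> real" and y u s
  proof -
    have "((\<lambda>s. F (y + s *\<^sub>R u)) has_derivative (\<lambda>r. fderiv F (y + s *\<^sub>R u) (r *\<^sub>R u))) (at s)"
      by (rule has_derivative_compose[where f = "\<lambda>s. y + s *\<^sub>R u" and g = F,
            OF _ smooth_on_has_derivative[OF that(1) assms(2) that(2)]])
        (auto intro!: derivative_eq_intros)
    moreover have "(\<lambda>r. fderiv F (y + s *\<^sub>R u) (r *\<^sub>R u)) = (*) (fderiv F (y + s *\<^sub>R u) u)"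
      using linear_cmul[OF smooth_on_linear_fderiv[OF that(1) assms(2) that(2)]] by auto
    ultimately show ?thesis by (simp add: has_field_derivative_def)
  qed
  define g where "g s = f ((x + h *\<^sub>R w) + s *\<^sub>R v) - f (x + s *\<^sub>R v)" for s
  have in1: "(x + h *\<^sub>R w) + s *\<^sub>R v \<in> S" "x + s *\<^sub>R v \<in> S" if "0 \<le> s" "s \<le> h" for s
    using sub[of s h] sub[of s 0] that assms(3) by (simp_all add: algebra_simps)
  have "DERIV g s :> fderiv f ((x + h *\<^sub>R w) + s *\<^sub>R v) v - fderiv f (x + s *\<^sub>R v) v" if "0 \<le> s" "s \<le> h" for s
    unfolding g_def by (intro DERIV_diff line assms(1) in1 that)
  then obtain s where s: "0 < s" "s < h"
    and gs: "g h - g 0 = (h - 0) * (fderiv f ((x + h *\<^sub>R w) + s *\<^sub>R v) v - fderiv f (x + s *\<^sub>R v) v)"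
    using MVT2[OF assms(3), of g "\<lambda>s. fderiv f ((x + h *\<^sub>R w) + s *\<^sub>R v) v - fderiv f (x + s *\<^sub>R v) v"] by blast
  define k where "k t = fderiv f ((x + s *\<^sub>R v) + t *\<^sub>R w) v" for t
  have "DERIV k t :> fderiv (\<lambda>y. fderiv f y v) ((x + s *\<^sub>R v) + t *\<^sub>R w) w" if "0 \<le> t" "t \<le> h" for t
    unfolding k_def using s that by (intro line[OF smooth_on_fderiv[OF assms(1)]] sub) auto
  then obtain t where t: "0 < t" "t < h"
    and kt: "k h - k 0 = (h - 0) * fderiv (\<lambda>y. fderiv f y v) ((x + s *\<^sub>R v) + t *\<^sub>R w) w"
    using MVT2[OF assms(3), of k "\<lambda>t. fderiv (\<lambda>y. fderiv f y v) ((x + s *\<^sub>R v) + t *\<^sub>R w) w"] by blast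
  have "g h - g 0 = h * (k h - k 0)" using gs by (simp add: k_def algebra_simps)
  then show ?thesis
    using s t kt by (intro exI[of _ s] exI[of _ t]) (simp add: g_def algebra_simps)
qed

text \<open>The second difference over a parallelogram is symmetric in \<open>v\<close> and
  \<open>w\<close>, so the two mixed derivatives agree when taken at suitable points close to
  \<open>x\<close>. If they differed at \<open>x\<close>, continuity would keep them apart
  nearby.\<close>

lemma fderiv_commute_real:
  fixes f :: "'a::euclidean_space \<Rightarrow> real"
  assumes f: "smooth_on f S" and S: "open S" and x: "x \<in> S"
  shows "fderiv (\<lambda>y. fderiv f y v) x w = fderiv (\<lambda>y. fderiv f y w) x v"
proof (rule ccontr)
  define A where "A = (\<lambda>x. fderiv (\<lambda>y. fderiv f y v) x w)"
  define B where "B = (\<lambda>x. fderiv (\<lambda>y. fderiv f y w) x v)"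
  assume "\<not> ?thesis"
  then have pos: "0 < \<bar>A x - B x\<bar> / 2" by (simp add: A_def B_def)
  have cont: "isCont A x" "isCont B x"
    unfolding A_def B_def using f S x smooth_on_continuous smooth_on_fderiv continuous_on_eq_continuous_at by metis+
  obtain d1 where d1: "d1 > 0" "\<And>y. dist y x < d1 \<Longrightarrow> dist (A y) (A x) < \<bar>A x - B x\<bar> / 2"
    using cont(1) pos unfolding continuous_at_eps_delta by meson
  obtain d2 where d2: "d2 > 0" "\<And>y. dist y x < d2 \<Longrightarrow> dist (B y) (B x) < \<bar>A x - B x\<bar> / 2"
    using cont(2) pos unfolding continuous_at_eps_delta by meson
  obtain d3 where d3: "d3 > 0" "ball x d3 \<subseteq> S" using S x open_contains_ball by blast
  define d where "d = min d1 (min d2 d3)"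
  \<comment> \<open>Keeps the whole parallelogram within \<open>d / 2\<close> of \<open>x\<close>;
    the summand 1 covers the case that \<open>v\<close> and \<open>w\<close> are zero.\<close>
  define h where "h = d / (2 * (norm v + norm w + 1))"
  have "d > 0" using d1 d2 d3 by (simp add: d_def)
  have nz: "norm v + norm w + 1 > 0" by (simp add: add_nonneg_pos)
  have h: "h > 0" using \<open>d > 0\<close> nz by (simp add: h_def)
  have near: "dist (x + s *\<^sub>R v + t *\<^sub>R w) x < d" if "0 \<le> s" "s \<le> h" "0 \<le> t" "t \<le> h" for s t
  proof -
    have "dist (x + s *\<^sub>R v + t *\<^sub>R w) x \<le> s * norm v + t * norm w"
      using norm_triangle_ineq[of "s *\<^sub>R v" "t *\<^sub>R w"] that by (simp add: dist_norm)
    also have "\<dots> \<le> h * norm v + h * norm w" using that by (intro add_mono mult_right_mono) auto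
    also have "\<dots> \<le> h * (norm v + norm w + 1)" using h by (simp add: algebra_simps)
    also have "\<dots> = d / 2" using nz by (simp add: h_def field_simps)
    finally show ?thesis using \<open>d > 0\<close> by simp
  qed
  have sub: "x + s *\<^sub>R v + t *\<^sub>R w \<in> S" if "0 \<le> s" "s \<le> h" "0 \<le> t" "t \<le> h" for s t
    using near[OF that] d3(2) by (auto simp: d_def dist_commute)
  obtain s t where 1: "0 < s" "s < h" "0 < t" "t < h"
      "f (x + h *\<^sub>R v + h *\<^sub>R w) - f (x + h *\<^sub>R v) - f (x + h *\<^sub>R w) + f x = h * (h * A (x + s *\<^sub>R v + t *\<^sub>R w))"
    using second_difference_mean_value[OF f S h sub] unfolding A_def by blast
  have sub': "x + s *\<^sub>R w + t *\<^sub>R v \<in> S" if "0 \<le> s" "s \<le> h" "0 \<le> t" "t \<le> h" for s t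
    using sub[OF that(3,4,1,2)] by (simp add: algebra_simps)
  obtain s' t' where 2: "0 < s'" "s' < h" "0 < t'" "t' < h"
      "f (x + h *\<^sub>R w + h *\<^sub>R v) - f (x + h *\<^sub>R w) - f (x + h *\<^sub>R v) + f x = h * (h * B (x + s' *\<^sub>R w + t' *\<^sub>R v))"
    using second_difference_mean_value[OF f S h sub'] unfolding B_def by blast
  have "A (x + s *\<^sub>R v + t *\<^sub>R w) = B (x + t' *\<^sub>R v + s' *\<^sub>R w)"
    using 1(5) 2(5) h by (simp add: algebra_simps)
  moreover have "dist (A (x + s *\<^sub>R v + t *\<^sub>R w)) (A x) < \<bar>A x - B x\<bar> / 2"
    using d1(2) near[of s t] 1 by (simp add: d_def)
  moreover have "dist (B (x + t' *\<^sub>R v + s' *\<^sub>R w)) (B x) < \<bar>A x - B x\<bar> / 2"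
    using d2(2) near[of t' s'] 2 by (simp add: d_def)
  ultimately have "dist (A x) (B x) < \<bar>A x - B x\<bar>" by (metis dist_triangle_half_r)
  then show False by (simp add: dist_real_def)
qed

lemma fderiv_commute:
  fixes f :: "'a::euclidean_space \<Rightarrow> 'b::euclidean_space"
  assumes f: "smooth_on f S" and S: "open S" and x: "x \<in> S"
  shows "fderiv (\<lambda>y. fderiv f y v) x w = fderiv (\<lambda>y. fderiv f y w) x v"
proof (rule euclidean_eqI)
  fix b :: 'b
  have comp: "fderiv (\<lambda>y. F y \<bullet> b) z u = fderiv F z u \<bullet> b" if "smooth_on F S" "z \<in> S" for F :: "'a \<Rightarrow> 'b" and z u
    using fderiv_eq[OF has_derivative_inner_left[OF smooth_on_has_derivative[OF that(1) S that(2)], of b]] by simp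
  have "fderiv (\<lambda>y. fderiv (\<lambda>y. f y \<bullet> b) y v) x w = fderiv (\<lambda>y. fderiv (\<lambda>y. f y \<bullet> b) y w) x v"
    by (rule fderiv_commute_real[OF _ S x]) (rule smooth_on_inner[OF S f smooth_on_const])
  moreover have "fderiv (\<lambda>y. fderiv (\<lambda>y. f y \<bullet> b) y u) x u' = fderiv (\<lambda>y. fderiv f y u) x u' \<bullet> b" for u u'
  proof -
    have "fderiv (\<lambda>y. fderiv (\<lambda>y. f y \<bullet> b) y u) x = fderiv (\<lambda>y. fderiv f y u \<bullet> b) x"
      by (rule fderiv_cong[OF S x]) (rule comp[OF f])
    then show ?thesis using comp[OF smooth_on_fderiv[OF f] x] by simp
  qed
  ultimately show "fderiv (\<lambda>y. fderiv f y v) x w \<bullet> b = fderiv (\<lambda>y. fderiv f y w) x v \<bullet> b" by simp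
qed

text \<open>Differentiating the relation for \<open>Y\<close> along \<open>X'\<close> and that for
  \<open>X\<close> along \<open>Y'\<close> produces second derivatives of \<open>i\<close>, which
  cancel by symmetry. It serves both for transition maps and for the inclusion of an integral
  manifold.\<close>

lemma bracket_related:
  fixes i :: "'a::euclidean_space \<Rightarrow> 'b::euclidean_space"
  assumes S: "open S" and T: "open T" and iS: "\<And>x. x \<in> S \<Longrightarrow> i x \<in> T" and i: "smooth_on i S"
    and X': "smooth_on X' S" and Y': "smooth_on Y' S" and X: "smooth_on X T" and Y: "smooth_on Y T"
    and relX: "\<And>x. x \<in> S \<Longrightarrow> fderiv i x (X' x) = X (i x)"
    and relY: "\<And>x. x \<in> S \<Longrightarrow> fderiv i x (Y' x) = Y (i x)" and x: "x \<in> S"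
  shows "fderiv i x (fderiv Y' x (X' x) - fderiv X' x (Y' x)) = fderiv Y (i x) (X (i x)) - fderiv X (i x) (Y (i x))"
proof -
  have *: "fderiv (\<lambda>y. fderiv i y (Q' x)) x (P' x) + fderiv i x (fderiv Q' x (P' x)) = fderiv Q (i x) (P (i x))"
    if "smooth_on Q' S" "smooth_on Q T" "\<And>x. x \<in> S \<Longrightarrow> fderiv i x (Q' x) = Q (i x)" "fderiv i x (P' x) = P (i x)"
    for P' Q' P Q
  proof -
    have "((\<lambda>x. fderiv i x (Q' x)) has_derivative
        (\<lambda>v. fderiv (\<lambda>y. fderiv i y (Q' x)) x v + fderiv i x (fderiv Q' x v))) (at x)"
      by (rule has_derivative_linear_family[OF S x smooth_on_linear_fderiv[OF i S]
            smooth_on_has_derivative[OF smooth_on_fderiv[OF i] S x] smooth_on_has_derivative[OF that(1) S x]])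
    then have 1: "((\<lambda>x. Q (i x)) has_derivative
        (\<lambda>v. fderiv (\<lambda>y. fderiv i y (Q' x)) x v + fderiv i x (fderiv Q' x v))) (at x)"
      by (rule has_derivative_transform_within_open[OF _ S x]) (rule that(3))
    have 2: "((\<lambda>x. Q (i x)) has_derivative (\<lambda>v. fderiv Q (i x) (fderiv i x v))) (at x)"
      by (rule has_derivative_compose[OF smooth_on_has_derivative[OF i S x] smooth_on_has_derivative[OF that(2) T iS[OF x]]])
    show ?thesis using fun_cong[OF has_derivative_unique[OF 1 2], of "P' x"] that(4) by simp
  qed
  have c: "fderiv (\<lambda>y. fderiv i y (Y' x)) x (X' x) = fderiv (\<lambda>y. fderiv i y (X' x)) x (Y' x)"
    by (rule fderiv_commute[OF i S x])
  have "fderiv i x (fderiv Y' x (X' x) - fderiv X' x (Y' x)) = fderiv i x (fderiv Y' x (X' x)) - fderiv i x (fderiv X' x (Y' x))"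
    by (rule linear_diff[OF smooth_on_linear_fderiv[OF i S x]])
  also have "\<dots> = (fderiv Y (i x) (X (i x)) - fderiv (\<lambda>y. fderiv i y (Y' x)) x (X' x))
      - (fderiv X (i x) (Y (i x)) - fderiv (\<lambda>y. fderiv i y (X' x)) x (Y' x))"
    using *[where P' = X' and Q' = Y' and P = X and Q = Y, OF Y' Y relY relX[OF x]]
      *[where P' = Y' and Q' = X' and P = Y and Q = X, OF X' X relX relY[OF x]]
    by (metis add_diff_cancel_left')
  finally show ?thesis by (simp add: c)
qed

section \<open>Bump functions\<close>

lemma Ck_on_inverse: "Ck_on k (inverse :: real \<Rightarrow> real) {0<..}"
proof (induction k)
  case 0
  then show ?case by (auto intro!: continuous_intros)
next
  case (Suc k)
  show ?case
  proof (rule Ck_on_Suc_intro[where f' = "\<lambda>x v. - (inverse x * v * inverse x)"])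
    show "Ck_on k (\<lambda>x. - (inverse x * v * inverse x)) {0<..}" for v :: real
      by (rule Ck_on_linear_comp[OF bounded_linear_minus[OF bounded_linear_ident]], simp)
        (intro Ck_on_bilinear[OF bounded_bilinear_mult] Suc.IH Ck_on_const open_greaterThan)
  qed (auto intro: has_derivative_inverse')
qed

lemma smooth_on_inverse:
  fixes f :: "'a::real_normed_vector \<Rightarrow> real"
  assumes "open S" "smooth_on f S" "\<And>x. x \<in> S \<Longrightarrow> 0 < f x"
  shows "smooth_on (\<lambda>x. inverse (f x)) S"
  by (rule smooth_on_compose[OF assms(1) open_greaterThan[of 0]])
    (use assms Ck_on_inverse in \<open>auto simp: smooth_on_def\<close>)

text \<open>The functions \<open>exp (- 1 / t) / t ^ n\<close>, extended by zero. Derivatives of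
  members are linear combinations of members, so one induction on the order, general in
  \<open>n\<close>, shows smoothness.\<close>

definition flat_fun :: "nat \<Rightarrow> real \<Rightarrow> real" where
  "flat_fun n t = (if 0 < t then (inverse t) ^ n * exp (- inverse t) else 0)"

lemma flat_fun_tendsto_0: "(flat_fun n \<longlongrightarrow> 0) (at 0)"
proof (rule filterlim_split_at)
  show "(flat_fun n \<longlongrightarrow> 0) (at_left 0)"
    by (rule tendsto_eventually) (auto simp: flat_fun_def eventually_at_filter)
  have "((\<lambda>t::real. (inverse t) ^ n / exp (inverse t)) \<longlongrightarrow> 0) (at_right 0)"
    by (rule filterlim_compose[OF tendsto_power_div_exp_0 filterlim_inverse_at_top_right])
  then show "(flat_fun n \<longlongrightarrow> 0) (at_right 0)"
    by (rule Lim_transform_eventually)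
      (auto simp: flat_fun_def eventually_at_filter exp_minus divide_inverse)
qed

lemma DERIV_flat_fun: "DERIV (flat_fun n) t :> flat_fun (n + 2) t - n * flat_fun (n + 1) t"
proof -
  consider "t < 0" | "t = 0" | "t > 0" by linarith
  then show ?thesis
  proof cases
    case 1
    have "DERIV (\<lambda>t. 0) t :> (0::real)" by simp
    then have "DERIV (flat_fun n) t :> 0"
      by (rule has_field_derivative_transform_within_open[of _ _ _ "{..<0}"]) (use 1 in \<open>auto simp: flat_fun_def\<close>)
    then show ?thesis using 1 by (simp add: flat_fun_def)
  next
    case 2
    \<comment> \<open>The difference quotient at 0 is the next member of the family.\<close>
    have "((\<lambda>y. (flat_fun n y - flat_fun n 0) / (y - 0)) \<longlongrightarrow> 0) (at 0)"
      by (rule Lim_transform_eventually[OF flat_fun_tendsto_0[of "n + 1"]])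
        (auto simp: flat_fun_def eventually_at_filter field_simps)
    then have "DERIV (flat_fun n) 0 :> 0" by (simp add: has_field_derivative_iff)
    then show ?thesis using 2 by (simp add: flat_fun_def)
  next
    case 3
    have "DERIV (\<lambda>t. (inverse t) ^ n * exp (- inverse t)) t :>
        (inverse t) ^ n * (exp (- inverse t) * (inverse t * inverse t))
        + (of_nat n * (- (inverse t * inverse t) * (inverse t) ^ (n - Suc 0))) * exp (- inverse t)"
      using 3 by (auto intro!: derivative_eq_intros simp: power2_eq_square)
    moreover have "(inverse t) ^ n * (exp (- inverse t) * (inverse t * inverse t))
        + (of_nat n * (- (inverse t * inverse t) * (inverse t) ^ (n - Suc 0))) * exp (- inverse t)
        = flat_fun (n + 2) t - n * flat_fun (n + 1) t"
      using 3 by (cases n) (auto simp: flat_fun_def algebra_simps)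
    ultimately have "DERIV (\<lambda>t. (inverse t) ^ n * exp (- inverse t)) t :> flat_fun (n + 2) t - n * flat_fun (n + 1) t"
      by simp
    then show ?thesis
      by (rule has_field_derivative_transform_within_open[of _ _ _ "{0<..}"]) (use 3 in \<open>auto simp: flat_fun_def\<close>)
  qed
qed

lemma smooth_on_flat_fun: "smooth_on (flat_fun n) UNIV"
proof -
  have "Ck_on k (flat_fun n) UNIV" for k
  proof (induction k arbitrary: n)
    case 0
    then show ?case using DERIV_flat_fun by (auto intro!: DERIV_isCont continuous_at_imp_continuous_on)
  next
    case (Suc k)
    show ?case
    proof (rule Ck_on_Suc_intro[where f' = "\<lambda>t v. (flat_fun (n + 2) t + (- real n) * flat_fun (n + 1) t) * v"])
      show "(flat_fun n has_derivative (\<lambda>v. (flat_fun (n + 2) t + (- real n) * flat_fun (n + 1) t) * v)) (at t)" for t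
        using DERIV_flat_fun[of n t] by (simp add: has_field_derivative_def)
      show "Ck_on k (\<lambda>t. (flat_fun (n + 2) t + (- real n) * flat_fun (n + 1) t) * v) UNIV" for v
        by (intro Ck_on_bilinear[OF bounded_bilinear_mult open_UNIV] Ck_on_add[OF open_UNIV] Suc.IH Ck_on_const)
    qed simp
  qed
  then show ?thesis by (simp add: smooth_on_def)
qed

text \<open>With F = \<open>flat_fun 0\<close>, the quotient F(t) / (F(t) + F(1 - t)) is 0 for t
  \<le> 0 and 1 for t \<ge> 1; it is composed with a quadratic function of the distance from
  \<open>x0\<close>.\<close>

lemma smooth_bump:
  fixes x0 :: "'a::euclidean_space"
  assumes r: "0 < r"
  obtains \<beta> :: "'a \<Rightarrow> real" where "smooth_on \<beta> UNIV" "\<And>x. x \<in> ball x0 (r / 2) \<Longrightarrow> \<beta> x = 1"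
    "\<And>x. x \<notin> cball x0 (3 * r / 4) \<Longrightarrow> \<beta> x = 0"
proof -
  \<comment> \<open>Greater than 1 at distance less than r / 2 and negative beyond r / sqrt 2, hence
    beyond 3 r / 4, since 9 / 16 > 1 / 2.\<close>
  define \<tau> where "\<tau> x = 2 + (- 4 / r\<^sup>2) * ((x - x0) \<bullet> (x - x0))" for x
  define \<beta> where "\<beta> x = flat_fun 0 (\<tau> x) * inverse (flat_fun 0 (\<tau> x) + flat_fun 0 (1 + (- 1) * \<tau> x))" for x
  have sub: "smooth_on (\<lambda>x. x - x0) UNIV"
    by (intro smooth_on_diff smooth_on_id smooth_on_const open_UNIV)
  have \<tau>: "smooth_on \<tau> UNIV" unfolding \<tau>_def
    by (intro smooth_on_add smooth_on_mult smooth_on_inner smooth_on_const sub open_UNIV)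
  have flat: "smooth_on (\<lambda>x. flat_fun 0 (\<tau>' x)) UNIV" if "smooth_on \<tau>' UNIV" for \<tau>' :: "'a \<Rightarrow> real"
    by (rule smooth_on_compose[OF open_UNIV open_UNIV _ that smooth_on_flat_fun]) simp
  have pos: "0 < flat_fun 0 t + flat_fun 0 (1 + (- 1) * t)" for t
    by (simp add: flat_fun_def add_pos_nonneg)
  have "smooth_on \<beta> UNIV" unfolding \<beta>_def
    by (intro smooth_on_mult smooth_on_inverse pos smooth_on_add flat \<tau> smooth_on_const open_UNIV)
  moreover have "\<beta> x = 1" if "x \<in> ball x0 (r / 2)" for x
  proof -
    have "norm (x - x0) < r / 2" using that by (simp add: dist_norm norm_minus_commute)
    then have "(norm (x - x0))\<^sup>2 < (r / 2)\<^sup>2" by (intro power_strict_mono) auto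
    then have "1 < \<tau> x" using r by (simp add: \<tau>_def dot_square_norm field_simps)
    then show ?thesis by (simp add: \<beta>_def flat_fun_def)
  qed
  moreover have "\<beta> x = 0" if "x \<notin> cball x0 (3 * r / 4)" for x
  proof -
    have "3 * r / 4 < norm (x - x0)" using that by (simp add: dist_norm norm_minus_commute)
    then have "(3 * r / 4)\<^sup>2 < (norm (x - x0))\<^sup>2" using r by (intro power_strict_mono) auto
    then have "r\<^sup>2 * 9 < 16 * (norm (x - x0))\<^sup>2" by (simp add: power2_eq_square field_simps)
    moreover have "0 < r\<^sup>2" using r by simp
    ultimately have "r\<^sup>2 * 2 < 4 * (norm (x - x0))\<^sup>2" by linarith
    then have "\<tau> x < 0" using r by (simp add: \<tau>_def dot_square_norm field_simps)
    then show ?thesis by (simp add: \<beta>_def flat_fun_def)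
  qed
  ultimately show thesis by (rule that)
qed

section \<open>The Poincare lemma for one-forms on a ball\<close>

text \<open>The primitive integrates \<omega> along segments from \<open>x0\<close>. Under the
  integral sign closedness turns the derivative of the integrand in direction \<open>v\<close> into
  the t-derivative of \<open>t * \<omega> (p x t) v\<close>, so the integral is its boundary value
  \<open>\<omega> x v\<close>.\<close>

lemma closed_one_form_primitive:
  fixes \<omega> :: "'a::euclidean_space \<Rightarrow> 'a \<Rightarrow> real"
  assumes sm: "\<And>u. smooth_on (\<lambda>x. \<omega> x u) (ball x0 r)"
    and lin: "\<And>x. x \<in> ball x0 r \<Longrightarrow> linear (\<omega> x)"
    and closed: "\<And>x u v. x \<in> ball x0 r \<Longrightarrow> fderiv (\<lambda>x. \<omega> x u) x v = fderiv (\<lambda>x. \<omega> x v) x u"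
  obtains f where "\<And>x. x \<in> ball x0 r \<Longrightarrow> (f has_derivative \<omega> x) (at x)"
proof -
  let ?B = "ball x0 r"
  define p where "p x t = x0 + t *\<^sub>R (x - x0)" for x and t :: real
  have pB: "p x t \<in> ?B" if "x \<in> ?B" "t \<in> cbox 0 1" for x t
  proof -
    have "norm (t *\<^sub>R (x - x0)) \<le> 1 * norm (x - x0)"
      using that by (simp add: mult_right_mono mult_left_le_one_le)
    then show ?thesis using that by (simp add: p_def dist_norm norm_minus_commute)
  qed
  define d\<omega> where "d\<omega> u q v = (\<Sum>b\<in>Basis. (u \<bullet> b) *\<^sub>R fderiv (\<lambda>x. \<omega> x b) q v)" for u q v
  have der: "((\<lambda>x. \<omega> x u) has_derivative d\<omega> u q) (at q)" if "q \<in> ?B" for u q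
  proof -
    have "((\<lambda>x. \<Sum>b\<in>Basis. (u \<bullet> b) *\<^sub>R \<omega> x b) has_derivative (\<lambda>v. \<Sum>b\<in>Basis. (u \<bullet> b) *\<^sub>R fderiv (\<lambda>x. \<omega> x b) q v)) (at q)"
      by (intro has_derivative_sum has_derivative_scaleR_right smooth_on_has_derivative[OF sm open_ball that])
    then show ?thesis unfolding d\<omega>_def
      by (rule has_derivative_transform_within_open[OF _ open_ball that])
        (rule linear_euclid_expand[OF lin, symmetric])
  qed
  \<comment> \<open>The derivative in \<open>x\<close> of the integrand
    \<open>\<omega> (p x t) (x - x0)\<close>; the factor \<open>t\<close> is the derivative of
    \<open>p x t\<close> in \<open>x\<close>.\<close>
  define F where "F x t v = t * d\<omega> (x - x0) (p x t) v + \<omega> (p x t) v" for x t v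
  have "((\<lambda>x. \<omega> (p x t) (x - x0)) has_derivative F x t) (at x)" if "x \<in> ?B" "t \<in> cbox 0 1" for x t
  proof -
    have "((\<lambda>x. \<omega> (p x t) u) has_derivative (\<lambda>v. d\<omega> u (p x t) (t *\<^sub>R v))) (at x)" for u
      by (rule has_derivative_compose[where f = "\<lambda>x. p x t" and g = "\<lambda>q. \<omega> q u", OF _ der[OF pB[OF that]]])
        (auto simp: p_def intro!: derivative_eq_intros)
    moreover have "((\<lambda>x. x - x0) has_derivative (\<lambda>v. v)) (at x)" by (auto intro!: derivative_eq_intros)
    ultimately have "((\<lambda>x. \<omega> (p x t) (x - x0)) has_derivative
        (\<lambda>v. d\<omega> (x - x0) (p x t) (t *\<^sub>R v) + \<omega> (p x t) v)) (at x)"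
      by (intro has_derivative_linear_family[OF open_ball that(1)]) (use lin pB that(2) in auto)
    moreover have "linear (d\<omega> (x - x0) (p x t))" using der[OF pB[OF that]] has_derivative_linear by blast
    ultimately show ?thesis by (simp add: F_def[abs_def] linear_cmul)
  qed note dF = this
  have blF: "bounded_linear (F x t)" if "x \<in> ?B" "t \<in> cbox 0 1" for x t
    using dF[OF that] has_derivative_bounded_linear by blast
  define fx where "fx x t = Blinfun (F x t)" for x t
  have fx: "blinfun_apply (fx x t) = F x t" if "x \<in> ?B" "t \<in> cbox 0 1" for x t
    using blF[OF that] by (simp add: fx_def bounded_linear_Blinfun_apply)
  have cp: "continuous_on (?B \<times> cbox 0 1) (\<lambda>z. K (p (fst z) (snd z)))"
    if "smooth_on K ?B" for K :: "'a \<Rightarrow> real"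
    by (rule continuous_on_compose2[OF smooth_on_continuous[OF that]])
      (auto simp: p_def[abs_def] intro!: continuous_intros pB[unfolded p_def])
  have cF: "continuous_on (?B \<times> cbox 0 1) (\<lambda>z. F (fst z) (snd z) v)" for v
    unfolding F_def d\<omega>_def
    by (intro continuous_intros cp[of "\<lambda>q. \<omega> q v"] sm cp[of "\<lambda>q. fderiv (\<lambda>x. \<omega> x b) q v" for b] smooth_on_fderiv)
  have cfx: "continuous_on (?B \<times> cbox 0 1) (\<lambda>(x, t). fx x t)"
  proof (rule continuous_on_blinfun_componentwise)
    fix v :: 'a
    show "continuous_on (?B \<times> cbox 0 1) (\<lambda>z. (case z of (x, t) \<Rightarrow> fx x t) v)"
      by (rule continuous_on_eq[OF cF[of v]]) (auto simp: fx)
  qed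
  define f where "f x = integral (cbox 0 1) (\<lambda>t. \<omega> (p x t) (x - x0))" for x
  have "(f has_derivative \<omega> x) (at x)" if x: "x \<in> ?B" for x
  proof -
    have cpx: "continuous_on (cbox 0 1) (\<lambda>t. \<omega> (p x t) u)" if "x \<in> ?B" for x u
      by (rule continuous_on_compose2[OF smooth_on_continuous[OF sm[of u]]])
        (auto simp: p_def[abs_def] intro!: continuous_intros pB[OF that, unfolded p_def])
    have "(f has_derivative integral (cbox 0 1) (fx x)) (at x within ?B)"
      unfolding f_def
    proof (rule leibniz_rule[OF _ _ cfx x convex_ball])
      show "((\<lambda>x. \<omega> (p x t) (x - x0)) has_derivative blinfun_apply (fx y t)) (at y within ?B)"
        if "y \<in> ?B" "t \<in> cbox 0 1" for y t
        using dF[OF that] fx[OF that] by (simp add: has_derivative_at_withinI)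
      show "(\<lambda>t. \<omega> (p y t) (y - x0)) integrable_on cbox 0 1" if "y \<in> ?B" for y
        by (rule integrable_continuous[OF cpx[OF that]])
    qed
    then have 1: "(f has_derivative integral (cbox 0 1) (fx x)) (at x)"
      unfolding at_within_open[OF x open_ball] .
    have "blinfun_apply (integral (cbox 0 1) (fx x)) v = \<omega> x v" for v
    proof -
      have int: "fx x integrable_on cbox 0 1"
        by (rule integrable_continuous) (rule continuous_on_compose2[OF cfx, of _ "\<lambda>t. (x, t)", simplified];
            use x in \<open>auto intro!: continuous_intros\<close>)
      have "blinfun_apply (integral (cbox 0 1) (fx x)) v = integral (cbox 0 1) (\<lambda>t. fx x t v)"
        using blinfun_apply_integral[OF int] by simp
      also have "\<dots> = integral (cbox 0 1) (\<lambda>t. F x t v)"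
        by (rule integral_cong) (use fx[OF x] in simp)
      finally have eq: "blinfun_apply (integral (cbox 0 1) (fx x)) v = integral (cbox 0 1) (\<lambda>t. F x t v)" .
      have "((\<lambda>t. F x t v) has_integral (1 * \<omega> (p x 1) v - 0 * \<omega> (p x 0) v)) {0..1}"
      proof (rule fundamental_theorem_of_calculus)
        fix t :: real assume t: "t \<in> {0..1}"
        then have q: "p x t \<in> ?B" using pB x by simp
        have "((\<lambda>t. \<omega> (p x t) v) has_derivative (\<lambda>s. d\<omega> v (p x t) (s *\<^sub>R (x - x0)))) (at t)"
          by (rule has_derivative_compose[where f = "p x" and g = "\<lambda>q. \<omega> q v", OF _ der[OF q]])
            (auto simp: p_def[abs_def] intro!: derivative_eq_intros)
        then have "((\<lambda>t. t * \<omega> (p x t) v) has_derivative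
            (\<lambda>s. t * d\<omega> v (p x t) (s *\<^sub>R (x - x0)) + s * \<omega> (p x t) v)) (at t)"
          by (rule has_derivative_mult[OF has_derivative_ident])
        \<comment> \<open>Closedness is used here: it exchanges the direction of differentiation
          with the argument of \<omega>.\<close>
        moreover have "d\<omega> v (p x t) (s *\<^sub>R (x - x0)) = s * d\<omega> (x - x0) (p x t) v" for s
          using closed[OF q, of v "x - x0"] fderiv_eq[OF der[OF q]]
            linear_cmul[OF has_derivative_linear[OF der[OF q]], of v s "x - x0"] by (metis real_scaleR_def)
        ultimately have "((\<lambda>t. t * \<omega> (p x t) v) has_derivative
            (\<lambda>s. t * (s * d\<omega> (x - x0) (p x t) v) + s * \<omega> (p x t) v)) (at t)"
          by simp
        then have "((\<lambda>t. t * \<omega> (p x t) v) has_derivative (\<lambda>s. s *\<^sub>R F x t v)) (at t)"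
          by (simp add: F_def algebra_simps)
        then show "((\<lambda>t. t * \<omega> (p x t) v) has_vector_derivative F x t v) (at t within {0..1})"
          unfolding has_vector_derivative_def by (rule has_derivative_at_withinI)
      qed simp
      then have "integral (cbox 0 1) (\<lambda>t. F x t v) = \<omega> x v"
        by (simp add: p_def integral_unique)
      then show ?thesis using eq by simp
    qed
    then have "blinfun_apply (integral (cbox 0 1) (fx x)) = \<omega> x" by (rule ext)
    then show ?thesis using 1 by metis
  qed
  then show thesis by (rule that)
qed

section \<open>Charts, tangent vectors and vector fields\<close>

abbreviation chart_img :: "('p, 'e) chart \<Rightarrow> 'e set" where
  "chart_img c \<equiv> coord c ` chart_dom c"

abbreviation overlap :: "('p, 'e) chart \<Rightarrow> ('p, 'e) chart \<Rightarrow> 'e set" where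
  "overlap c d \<equiv> coord c ` (chart_dom c \<inter> chart_dom d)"

text \<open>Inverse of the evaluation of a tangent vector at \<open>c\<close>: the entries at all
  other charts are rebuilt from the entry \<open>u\<close>.\<close>

definition tvec :: "('p, 'e::euclidean_space) atlas \<Rightarrow> 'p \<Rightarrow> ('p, 'e) chart \<Rightarrow> 'e \<Rightarrow> ('p, 'e) tangent" where
  "tvec A p c u = (\<lambda>d. if d \<in> charts_at A p then fderiv (transition c d) (coord c p) u else 0)"

definition vrep :: "('p, 'e) chart \<Rightarrow> ('p, 'e) vfield \<Rightarrow> 'e \<Rightarrow> 'e" where
  "vrep c X x = X (coord_inv c x) c"

text \<open>Charts are pairs, and quantified charts should not be split into domain and coordinate
  map by the simplifier.\<close>

declare split_paired_All [simp del] split_paired_Ex [simp del]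

lemma charts_atD: "c \<in> charts_at A p \<Longrightarrow> c \<in> A" "c \<in> charts_at A p \<Longrightarrow> p \<in> chart_dom c"
  by (simp_all add: charts_at_def)

lemma charts_at_points: "c \<in> charts_at A p \<Longrightarrow> p \<in> points A"
  by (auto simp: charts_at_def points_def)

lemma points_charts_at: "p \<in> points A \<Longrightarrow> \<exists>c. c \<in> charts_at A p"
  by (auto simp: charts_at_def points_def)

lemma chart_atE:
  assumes "p \<in> points A" obtains c where "c \<in> charts_at A p"
  using points_charts_at[OF assms] that by (rule exE)

lemma some_chart_at: "p \<in> points A \<Longrightarrow> some_chart A p \<in> charts_at A p"
  unfolding some_chart_def using points_charts_at by (metis someI)

locale smooth_mfd =
  fixes A :: "('p, 'e::euclidean_space) atlas"
  assumes atlas: "smooth_atlas A"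
begin

lemma inj_coord: "c \<in> A \<Longrightarrow> inj_on (coord c) (chart_dom c)"
  and open_chart_img: "c \<in> A \<Longrightarrow> open (chart_img c)"
  and open_overlap: "c \<in> A \<Longrightarrow> d \<in> A \<Longrightarrow> open (overlap c d)"
  and smooth_transition: "c \<in> A \<Longrightarrow> d \<in> A \<Longrightarrow> smooth_on (transition c d) (overlap c d)"
  using atlas unfolding smooth_atlas_def by blast+

lemma coord_inv_coord: "c \<in> A \<Longrightarrow> p \<in> chart_dom c \<Longrightarrow> coord_inv c (coord c p) = p"
  unfolding coord_inv_def using inj_coord by (simp add: inv_into_f_f)

lemma coord_coord_inv: "x \<in> chart_img c \<Longrightarrow> coord c (coord_inv c x) = x"
  unfolding coord_inv_def by (simp add: f_inv_into_f)

lemma coord_inv_in: "x \<in> chart_img c \<Longrightarrow> coord_inv c x \<in> chart_dom c"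
  unfolding coord_inv_def by (simp add: inv_into_into)

lemma coord_inv_charts_at: "c \<in> A \<Longrightarrow> x \<in> chart_img c \<Longrightarrow> c \<in> charts_at A (coord_inv c x)"
  by (simp add: charts_at_def coord_inv_in)

lemma coord_in_img: "c \<in> charts_at A p \<Longrightarrow> coord c p \<in> chart_img c"
  by (simp add: charts_at_def)

section \<open>The manifold topology\<close>

text \<open>Needed before anything can be said about the open sets of
  \<open>manifold_topology\<close>. Injectivity of the coordinate maps makes images commute with
  intersections.\<close>

lemma istopology_manifold:
  "istopology (\<lambda>W. W \<subseteq> points A \<and> (\<forall>c\<in>A. open (coord c ` (W \<inter> chart_dom c))))"
  unfolding istopology_def
proof (intro conjI allI impI ballI)
  fix S T c assume S: "S \<subseteq> points A \<and> (\<forall>c\<in>A. open (coord c ` (S \<inter> chart_dom c)))"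
    and T: "T \<subseteq> points A \<and> (\<forall>c\<in>A. open (coord c ` (T \<inter> chart_dom c)))"
  show "S \<inter> T \<subseteq> points A" using S by auto
  assume c: "c \<in> A"
  have "coord c ` (S \<inter> T \<inter> chart_dom c) = coord c ` (S \<inter> chart_dom c) \<inter> coord c ` (T \<inter> chart_dom c)"
    using inj_coord[OF c] by (auto simp: inj_on_def)
  then show "open (coord c ` (S \<inter> T \<inter> chart_dom c))" using S T c by auto
next
  fix K assume K: "\<forall>S\<in>K. S \<subseteq> points A \<and> (\<forall>c\<in>A. open (coord c ` (S \<inter> chart_dom c)))"
  then show "\<Union>K \<subseteq> points A" by auto
  fix c assume c: "c \<in> A"
  have "coord c ` (\<Union>K \<inter> chart_dom c) = (\<Union>S\<in>K. coord c ` (S \<inter> chart_dom c))" by auto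
  then show "open (coord c ` (\<Union>K \<inter> chart_dom c))" using K c by auto
qed

lemma openin_manifold:
  "openin (manifold_topology A) W \<longleftrightarrow> W \<subseteq> points A \<and> (\<forall>c\<in>A. open (coord c ` (W \<inter> chart_dom c)))"
  unfolding manifold_topology_def by (simp add: topology_inverse'[OF istopology_manifold])

lemma topspace_manifold: "topspace (manifold_topology A) = points A"
proof -
  have "points A \<inter> chart_dom c = chart_dom c" if "c \<in> A" for c using that by (auto simp: points_def)
  then have "openin (manifold_topology A) (points A)"
    by (simp add: openin_manifold open_chart_img)
  then show ?thesis using openin_manifold by (metis openin_subset openin_topspace subset_antisym)
qed

text \<open>Carries compactness and connectedness from a chart image to the manifold, as needed for
  supports of bump functions and for plaques.\<close>

lemma continuous_coord_inv:
  assumes cA: "c \<in> A"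
  shows "continuous_map (subtopology euclidean (chart_img c)) (manifold_topology A) (coord_inv c)"
  unfolding continuous_map_def
proof (intro conjI allI impI)
  show "coord_inv c \<in> topspace (subtopology euclidean (chart_img c)) \<rightarrow> topspace (manifold_topology A)"
  proof
    fix x assume "x \<in> topspace (subtopology euclidean (chart_img c))"
    then have "x \<in> chart_img c" by simp
    from charts_at_points[OF coord_inv_charts_at[OF cA this]]
    show "coord_inv c x \<in> topspace (manifold_topology A)" by (simp add: topspace_manifold)
  qed
  fix W assume "openin (manifold_topology A) W"
  then have "open (coord c ` (W \<inter> chart_dom c))" using openin_manifold cA by blast
  moreover have "{x \<in> topspace (subtopology euclidean (chart_img c)). coord_inv c x \<in> W} = coord c ` (W \<inter> chart_dom c)"
  proof (rule set_eqI)
    fix x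
    have "x \<in> coord c ` (W \<inter> chart_dom c)" if "x \<in> chart_img c" "coord_inv c x \<in> W"
      using that(2) coord_inv_in[OF that(1)] coord_coord_inv[OF that(1)] by (metis IntI imageI)
    moreover have "x \<in> chart_img c \<and> coord_inv c x \<in> W" if "x \<in> coord c ` (W \<inter> chart_dom c)"
      using that coord_inv_coord[OF cA] by auto
    ultimately show "x \<in> {x \<in> topspace (subtopology euclidean (chart_img c)). coord_inv c x \<in> W}
        \<longleftrightarrow> x \<in> coord c ` (W \<inter> chart_dom c)" by auto
  qed
  ultimately show "openin (subtopology euclidean (chart_img c))
      {x \<in> topspace (subtopology euclidean (chart_img c)). coord_inv c x \<in> W}"
    using open_chart_img[OF cA] by (auto simp: openin_open_eq)
qed

section \<open>Transition maps, tangent vectors and vector fields in charts\<close>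

lemma transition_coord:
  "c \<in> charts_at A p \<Longrightarrow> transition c d (coord c p) = coord d p"
  by (simp add: transition_def coord_inv_coord charts_at_def)

lemma overlapD:
  assumes "c \<in> A" "x \<in> overlap c d" "d \<in> A"
  shows "x \<in> chart_img c" "coord_inv c x \<in> chart_dom c" "coord_inv c x \<in> chart_dom d"
    "coord_inv d (transition c d x) = coord_inv c x"
  using assms(2) coord_inv_coord[OF assms(1)] coord_inv_coord[OF assms(3)] by (auto simp: transition_def)

lemma transition_overlap:
  assumes "c \<in> A" "d \<in> A" "x \<in> overlap c d"
  shows "transition c d x \<in> overlap d c"
  using assms(3) coord_inv_coord[OF assms(1)] by (auto simp: transition_def)

lemma overlap_memI: "c \<in> charts_at A p \<Longrightarrow> d \<in> charts_at A p \<Longrightarrow> coord c p \<in> overlap c d"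
  by (auto simp: charts_at_def)

lemma transition_deriv:
  "c \<in> charts_at A p \<Longrightarrow> d \<in> charts_at A p \<Longrightarrow>
    (transition c d has_derivative fderiv (transition c d) (coord c p)) (at (coord c p))"
  by (rule smooth_on_has_derivative[OF smooth_transition open_overlap overlap_memI]) (simp_all add: charts_at_def)

lemma linear_transition_deriv:
  "c \<in> charts_at A p \<Longrightarrow> d \<in> charts_at A p \<Longrightarrow> linear (fderiv (transition c d) (coord c p))"
  using transition_deriv has_derivative_linear by blast

text \<open>Chain rule for the cocycle identity of transition maps near \<open>coord c p\<close>;
  this is what makes \<open>tvec\<close> a tangent vector.\<close>

lemma transition_chain:
  assumes c: "c \<in> charts_at A p" and d: "d \<in> charts_at A p" and e: "e \<in> charts_at A p"
  shows "fderiv (transition d e) (coord d p) (fderiv (transition c d) (coord c p) u) =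
    fderiv (transition c e) (coord c p) u"
proof -
  note cA = charts_atD(1)[OF c] and dA = charts_atD(1)[OF d] and eA = charts_atD(1)[OF e]
  have "(transition d e has_derivative fderiv (transition d e) (coord d p)) (at (transition c d (coord c p)))"
    using transition_deriv[OF d e] transition_coord[OF c] by simp
  from has_derivative_compose[OF transition_deriv[OF c d] this]
  have 1: "((\<lambda>x. transition d e (transition c d x)) has_derivative
      (\<lambda>u. fderiv (transition d e) (coord d p) (fderiv (transition c d) (coord c p) u))) (at (coord c p))" .
  have "(transition c e has_derivative
      (\<lambda>u. fderiv (transition d e) (coord d p) (fderiv (transition c d) (coord c p) u))) (at (coord c p))"
  proof (rule has_derivative_transform_within_open[OF 1])
    show "open (overlap c d)" by (rule open_overlap[OF cA dA])
    show "coord c p \<in> overlap c d" by (rule overlap_memI[OF c d])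
    show "transition d e (transition c d x) = transition c e x" if "x \<in> overlap c d" for x
      using overlapD(4)[OF cA that dA] by (simp add: transition_def)
  qed
  from fderiv_eq[OF this] show ?thesis by simp
qed

lemma transition_self:
  assumes "c \<in> charts_at A p" shows "fderiv (transition c c) (coord c p) u = u"
proof -
  note cA = charts_atD(1)[OF assms]
  have "(transition c c has_derivative (\<lambda>u. u)) (at (coord c p))"
    by (rule has_derivative_transform_within_open[OF has_derivative_ident open_chart_img[OF cA] coord_in_img[OF assms]])
      (simp add: transition_def coord_coord_inv)
  then show ?thesis by (simp add: fderiv_eq)
qed

lemma tvec_in: "c \<in> charts_at A p \<Longrightarrow> tvec A p c u \<in> tangent_space A p"
  by (auto simp: tangent_space_def tvec_def transition_chain)

lemma tvec_at: "c \<in> charts_at A p \<Longrightarrow> tvec A p c u c = u"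
  by (simp add: tvec_def transition_self)

lemma tangent_transition:
  "v \<in> tangent_space A p \<Longrightarrow> c \<in> charts_at A p \<Longrightarrow> d \<in> charts_at A p \<Longrightarrow>
    v d = fderiv (transition c d) (coord c p) (v c)"
  unfolding tangent_space_def by blast

lemma tangent_eqI:
  assumes "u \<in> tangent_space A p" "v \<in> tangent_space A p" "c \<in> charts_at A p" "u c = v c"
  shows "u = v"
proof
  fix d show "u d = v d"
  proof (cases "d \<in> charts_at A p")
    case True
    then show ?thesis using tangent_transition assms by metis
  next
    case False
    then show ?thesis using assms(1,2) by (simp add: tangent_space_def)
  qed
qed

lemma tvec_of: "v \<in> tangent_space A p \<Longrightarrow> c \<in> charts_at A p \<Longrightarrow> tvec A p c (v c) = v"
  by (rule tangent_eqI[OF tvec_in _ _ tvec_at])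

lemma tangentI:
  assumes "\<And>c. c \<notin> charts_at A p \<Longrightarrow> v c = 0"
    "\<And>c d. c \<in> charts_at A p \<Longrightarrow> d \<in> charts_at A p \<Longrightarrow> v d = fderiv (transition c d) (coord c p) (v c)"
  shows "v \<in> tangent_space A p"
  unfolding tangent_space_def using assms by blast

lemma tangent_off: "v \<in> tangent_space A p \<Longrightarrow> c \<notin> charts_at A p \<Longrightarrow> v c = 0"
  by (simp add: tangent_space_def)

lemma tangent_zero: "0 \<in> tangent_space A p"
  by (rule tangentI) (simp_all add: linear_0[OF linear_transition_deriv])

lemma tangent_add:
  assumes "u \<in> tangent_space A p" "v \<in> tangent_space A p"
  shows "u + v \<in> tangent_space A p"
proof (rule tangentI)
  fix c d assume c: "c \<in> charts_at A p" and d: "d \<in> charts_at A p"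
  show "(u + v) d = fderiv (transition c d) (coord c p) ((u + v) c)"
    using assms[THEN tangent_transition, OF c d] linear_add[OF linear_transition_deriv[OF c d]]
    by (simp)
qed (use assms in \<open>simp add: tangent_off\<close>)

lemma tangent_diff:
  assumes "u \<in> tangent_space A p" "v \<in> tangent_space A p"
  shows "u - v \<in> tangent_space A p"
proof (rule tangentI)
  fix c d assume c: "c \<in> charts_at A p" and d: "d \<in> charts_at A p"
  show "(u - v) d = fderiv (transition c d) (coord c p) ((u - v) c)"
    using assms[THEN tangent_transition, OF c d] linear_diff[OF linear_transition_deriv[OF c d]]
    by (simp)
qed (use assms in \<open>simp add: tangent_off\<close>)

lemma tangent_scaleR:
  assumes "u \<in> tangent_space A p"
  shows "r *\<^sub>R u \<in> tangent_space A p"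
proof (rule tangentI)
  fix c d assume c: "c \<in> charts_at A p" and d: "d \<in> charts_at A p"
  show "(r *\<^sub>R u) d = fderiv (transition c d) (coord c p) ((r *\<^sub>R u) c)"
    using assms[THEN tangent_transition, OF c d] linear_cmul[OF linear_transition_deriv[OF c d]]
    by (simp add: scaleR_fun_def)
qed (use assms in \<open>simp add: scaleR_fun_def tangent_off\<close>)

lemma tangent_outside: "p \<notin> points A \<Longrightarrow> v \<in> tangent_space A p \<Longrightarrow> v = 0"
  by (rule ext) (metis charts_at_points tangent_off zero_fun_def)

lemma tvec_add: "c \<in> charts_at A p \<Longrightarrow> tvec A p c (u + v) = tvec A p c u + tvec A p c v"
  by (rule tangent_eqI[OF tvec_in tangent_add[OF tvec_in tvec_in]]) (auto simp: tvec_at)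

lemma tvec_scaleR: "c \<in> charts_at A p \<Longrightarrow> tvec A p c (r *\<^sub>R u) = r *\<^sub>R tvec A p c u"
  by (rule tangent_eqI[OF tvec_in tangent_scaleR[OF tvec_in]]) (auto simp: tvec_at scaleR_fun_def)

text \<open>The chain rule leads from the chart hidden in \<open>dir_deriv\<close> to an arbitrary
  one, so that a single chart can be fixed in every computation.\<close>

lemma dir_deriv_chart:
  assumes c: "c \<in> charts_at A p" and v: "v \<in> tangent_space A p"
    and F: "((F \<circ> coord_inv c) has_derivative F') (at (coord c p))"
  shows "dir_deriv A p v F = F' (v c)"
proof -
  define b where "b = some_chart A p"
  have b: "b \<in> charts_at A p" unfolding b_def by (rule some_chart_at[OF charts_at_points[OF c]])
  note cA = charts_atD(1)[OF c] and bA = charts_atD(1)[OF b]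
  have "((F \<circ> coord_inv c) has_derivative F') (at (transition b c (coord b p)))"
    using F transition_coord[OF b] by simp
  from has_derivative_compose[OF transition_deriv[OF b c] this]
  have "((F \<circ> coord_inv b) has_derivative (\<lambda>u. F' (fderiv (transition b c) (coord b p) u))) (at (coord b p))"
    by (rule has_derivative_transform_within_open[OF _ open_overlap[OF bA cA] overlap_memI[OF b c]])
      (use overlapD(4)[OF bA _ cA] in simp)
  from fderiv_eq[OF this] show ?thesis
    unfolding dir_deriv_def Let_def b_def[symmetric] using tangent_transition[OF v b c] by simp
qed

lemma dir_deriv_cong:
  assumes "p \<in> points A" "\<And>q. q \<in> points A \<Longrightarrow> F q = G q"
  shows "dir_deriv A p v F = dir_deriv A p v G"
proof -
  define b where "b = some_chart A p"
  have b: "b \<in> charts_at A p" unfolding b_def by (rule some_chart_at[OF assms(1)])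
  have "fderiv (F \<circ> coord_inv b) (coord b p) = fderiv (G \<circ> coord_inv b) (coord b p)"
    by (rule fderiv_cong[OF open_chart_img[OF charts_atD(1)[OF b]] coord_in_img[OF b]])
      (simp, rule assms(2), rule charts_at_points[OF coord_inv_charts_at[OF charts_atD(1)[OF b]]])
  then show ?thesis unfolding dir_deriv_def Let_def b_def[symmetric] by simp
qed

lemma smooth_fun_chart:
  assumes "smooth_fun A f" "c \<in> charts_at A p"
  shows "((f \<circ> coord_inv c) has_derivative fderiv (f \<circ> coord_inv c) (coord c p)) (at (coord c p))"
  using assms charts_atD[OF assms(2)] smooth_on_has_derivative open_chart_img unfolding smooth_fun_def by blast

lemma vf_deriv_chart:
  assumes "c \<in> charts_at A p" "X \<in> vector_fields A" "((F \<circ> coord_inv c) has_derivative F') (at (coord c p))"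
  shows "vf_deriv A X F p = F' (X p c)"
  unfolding vf_deriv_def using assms by (intro dir_deriv_chart) (auto simp: vector_fields_def)

lemma vf_tangent: "X \<in> vector_fields A \<Longrightarrow> X p \<in> tangent_space A p"
  by (simp add: vector_fields_def)

lemma vf_smooth: "X \<in> vector_fields A \<Longrightarrow> c \<in> A \<Longrightarrow> smooth_on (vrep c X) (chart_img c)"
  by (simp add: vector_fields_def vrep_def[abs_def])

lemma vrep_coord: "c \<in> charts_at A p \<Longrightarrow> vrep c X (coord c p) = X p c"
  by (simp add: vrep_def coord_inv_coord charts_at_def)

lemma vfI:
  assumes "\<And>p. X p \<in> tangent_space A p" "\<And>c. c \<in> A \<Longrightarrow> smooth_on (vrep c X) (chart_img c)"
  shows "X \<in> vector_fields A"
  using assms by (simp add: vector_fields_def vrep_def[abs_def])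

lemma vf_outside: "X \<in> vector_fields A \<Longrightarrow> p \<notin> points A \<Longrightarrow> X p = 0"
  using tangent_outside vf_tangent by blast

lemma vf_add:
  assumes X: "X \<in> vector_fields A" and Y: "Y \<in> vector_fields A"
  shows "X + Y \<in> vector_fields A"
proof (rule vfI)
  show "(X + Y) p \<in> tangent_space A p" for p
    using tangent_add assms vf_tangent by (simp)
  fix c assume c: "c \<in> A"
  have "vrep c (X + Y) = (\<lambda>x. vrep c X x + vrep c Y x)" by (simp add: fun_eq_iff vrep_def scaleR_fun_def fun_scale_def)
  then show "smooth_on (vrep c (X + Y)) (chart_img c)"
    using smooth_on_add[OF open_chart_img[OF c] vf_smooth[OF X c] vf_smooth[OF Y c]] by simp
qed

lemma vf_diff:
  assumes X: "X \<in> vector_fields A" and Y: "Y \<in> vector_fields A"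
  shows "X - Y \<in> vector_fields A"
proof (rule vfI)
  show "(X - Y) p \<in> tangent_space A p" for p
    using tangent_diff assms vf_tangent by (simp)
  fix c assume c: "c \<in> A"
  have "vrep c (X - Y) = (\<lambda>x. vrep c X x - vrep c Y x)" by (simp add: fun_eq_iff vrep_def scaleR_fun_def fun_scale_def)
  then show "smooth_on (vrep c (X - Y)) (chart_img c)"
    using smooth_on_diff[OF open_chart_img[OF c] vf_smooth[OF X c] vf_smooth[OF Y c]] by simp
qed

lemma vf_fun_scale:
  assumes f: "smooth_fun A f" and X: "X \<in> vector_fields A"
  shows "fun_scale f X \<in> vector_fields A"
proof (rule vfI)
  show "(fun_scale f X) p \<in> tangent_space A p" for p
    using tangent_scaleR[OF vf_tangent[OF X, of p], of "f p"] by (simp add: fun_scale_def)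
  fix c assume c: "c \<in> A"
  have "vrep c (fun_scale f X) = (\<lambda>x. f (coord_inv c x) *\<^sub>R vrep c X x)" by (simp add: fun_eq_iff vrep_def scaleR_fun_def fun_scale_def)
  then show "smooth_on (vrep c (fun_scale f X)) (chart_img c)"
    using smooth_on_scaleR[OF open_chart_img[OF c] _ vf_smooth[OF X c]] f c by (simp add: smooth_fun_def o_def)
qed

lemma lie_bracket_chart:
  "c \<in> charts_at A p \<Longrightarrow> lie_bracket A X Y p c =
    fderiv (vrep c Y) (coord c p) (X p c) - fderiv (vrep c X) (coord c p) (Y p c)"
  by (simp add: lie_bracket_def vrep_def[abs_def])

lemma vrep_related:
  assumes "X \<in> vector_fields A" "c \<in> A" "d \<in> A" "x \<in> overlap c d"
  shows "fderiv (transition c d) x (vrep c X x) = vrep d X (transition c d x)"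
proof -
  let ?q = "coord_inv c x"
  have c: "c \<in> charts_at A ?q" and d: "d \<in> charts_at A ?q"
    using overlapD(2,3)[OF assms(2,4,3)] assms by (auto simp: charts_at_def)
  have x: "coord c ?q = x" by (rule coord_coord_inv[OF overlapD(1)[OF assms(2,4,3)]])
  show ?thesis
    using tangent_transition[OF vf_tangent[OF assms(1)] c d] x overlapD(4)[OF assms(2,4,3)]
    by (simp add: vrep_def)
qed

text \<open>The representatives of a field in two charts are related by the transition map, hence so
  are the coordinate brackets by \<open>bracket_related\<close>.\<close>

lemma vf_lie_bracket:
  assumes X: "X \<in> vector_fields A" and Y: "Y \<in> vector_fields A"
  shows "lie_bracket A X Y \<in> vector_fields A"
proof (rule vfI)
  fix p
  have "lie_bracket A X Y p d = fderiv (transition c d) (coord c p) (lie_bracket A X Y p c)"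
    if c: "c \<in> charts_at A p" and d: "d \<in> charts_at A p" for c d
  proof -
    note cA = charts_atD(1)[OF c] and dA = charts_atD(1)[OF d]
    have "fderiv (transition c d) (coord c p)
        (fderiv (vrep c Y) (coord c p) (vrep c X (coord c p)) - fderiv (vrep c X) (coord c p) (vrep c Y (coord c p)))
      = fderiv (vrep d Y) (transition c d (coord c p)) (vrep d X (transition c d (coord c p)))
        - fderiv (vrep d X) (transition c d (coord c p)) (vrep d Y (transition c d (coord c p)))"
    proof (rule bracket_related[OF open_overlap[OF cA dA] open_overlap[OF dA cA]])
      show "smooth_on (vrep c X) (overlap c d)" "smooth_on (vrep c Y) (overlap c d)"
        using smooth_on_subset[OF vf_smooth[OF X cA] open_overlap[OF cA dA]]
          smooth_on_subset[OF vf_smooth[OF Y cA] open_overlap[OF cA dA]] by blast+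
      show "smooth_on (vrep d X) (overlap d c)" "smooth_on (vrep d Y) (overlap d c)"
        using smooth_on_subset[OF vf_smooth[OF X dA] open_overlap[OF dA cA]]
          smooth_on_subset[OF vf_smooth[OF Y dA] open_overlap[OF dA cA]] by blast+
    qed (rule transition_overlap[OF cA dA] smooth_transition[OF cA dA] vrep_related[OF X cA dA]
        vrep_related[OF Y cA dA] overlap_memI[OF c d]; assumption?)+
    then show ?thesis
      using c d by (simp add: lie_bracket_chart vrep_coord transition_coord)
  qed
  moreover have "lie_bracket A X Y p c = 0" if "c \<notin> charts_at A p" for c
    using that by (simp add: lie_bracket_def)
  ultimately show "lie_bracket A X Y p \<in> tangent_space A p" unfolding tangent_space_def by blast
next
  fix c assume c: "c \<in> A"
  note S = open_chart_img[OF c]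
  have fam: "smooth_on (\<lambda>x. fderiv (vrep c P) x (vrep c Q x)) (chart_img c)"
    if "P \<in> vector_fields A" "Q \<in> vector_fields A" for P Q
    by (rule smooth_on_linear_family[OF S smooth_on_linear_fderiv[OF vf_smooth[OF that(1) c] S]
          smooth_on_fderiv[OF vf_smooth[OF that(1) c]] vf_smooth[OF that(2) c]])
  show "smooth_on (vrep c (lie_bracket A X Y)) (chart_img c)"
  proof (rule smooth_on_cong[OF S _ smooth_on_diff[OF S fam[OF Y X] fam[OF X Y]]])
    fix x assume x: "x \<in> chart_img c"
    show "fderiv (vrep c Y) x (vrep c X x) - fderiv (vrep c X) x (vrep c Y x) = vrep c (lie_bracket A X Y) x"
      unfolding vrep_def[of c "lie_bracket A X Y"]
      using lie_bracket_chart[OF coord_inv_charts_at[OF c x], of X Y] coord_coord_inv[OF x]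
      by (simp add: vrep_def)
  qed
qed

end

section \<open>Extension of local data to global fields\<close>

locale hausdorff_mfd = smooth_mfd A for A :: "('p, 'e::euclidean_space) atlas" +
  assumes hausdorff: "Hausdorff_space (manifold_topology A)"
begin

text \<open>Cut off by a bump function supported in a ball of the chart; the extension by \<open>0\<close> is
  smooth because the compact support is closed in the Hausdorff space.\<close>

lemma extend_constant_field:
  assumes c: "c \<in> charts_at A p"
  obtains X S where "X \<in> vector_fields A" "open S" "coord c p \<in> S" "S \<subseteq> chart_img c"
    "\<And>x. x \<in> S \<Longrightarrow> vrep c X x = u"
proof -
  note cA = charts_atD(1)[OF c]
  define x0 where "x0 = coord c p"
  obtain r where r: "0 < r" "cball x0 r \<subseteq> chart_img c"
    using open_chart_img[OF cA] coord_in_img[OF c] unfolding x0_def open_contains_cball by blast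
  obtain \<beta> :: "'e \<Rightarrow> real" where \<beta>: "smooth_on \<beta> UNIV" "\<And>x. x \<in> ball x0 (r / 2) \<Longrightarrow> \<beta> x = 1"
    "\<And>x. x \<notin> cball x0 (3 * r / 4) \<Longrightarrow> \<beta> x = 0" using smooth_bump[OF r(1), of x0] by blast
  define K where "K = coord_inv c ` cball x0 (3 * r / 4)"
  have sub: "cball x0 (3 * r / 4) \<subseteq> chart_img c" using r by auto
  note continuous_coord_inv[OF cA]
  then have "compactin (manifold_topology A) K"
    unfolding K_def by (rule image_compactin[rotated]) (use sub in \<open>auto simp: compactin_subtopology\<close>)
  then have "closedin (manifold_topology A) K"
    using hausdorff by (rule compactin_imp_closedin[rotated])
  then have "openin (manifold_topology A) (points A - K)"
    by (simp add: closedin_def topspace_manifold)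
  then have openK: "open (coord d ` ((points A - K) \<inter> chart_dom d))" if "d \<in> A" for d
    using that openin_manifold by blast
  define X where "X q = (if q \<in> chart_dom c then tvec A q c (\<beta> (coord c q) *\<^sub>R u) else 0)" for q
  have X0: "X q = 0" if "q \<notin> K" for q
  proof (cases "q \<in> chart_dom c")
    case True
    then have q: "c \<in> charts_at A q" using cA by (simp add: charts_at_def)
    have "coord c q \<notin> cball x0 (3 * r / 4)"
      using that coord_inv_coord[OF cA True] unfolding K_def by (metis imageI)
    then have "\<beta> (coord c q) = 0" by (rule \<beta>(3))
    then have "X q = tvec A q c (0 *\<^sub>R u)" using True by (simp add: X_def)
    then show ?thesis unfolding tvec_scaleR[OF q] by simp
  qed (simp add: X_def)
  have XVF: "X \<in> vector_fields A"
  proof (rule vfI)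
    show "X q \<in> tangent_space A q" for q
      using cA by (auto simp: X_def tangent_zero charts_at_def intro: tvec_in)
    fix d assume dA: "d \<in> A"
    show "smooth_on (vrep d X) (chart_img d)"
    proof (rule smooth_on_local)
      fix y assume y: "y \<in> chart_img d"
      let ?q = "coord_inv d y"
      show "\<exists>T. open T \<and> y \<in> T \<and> smooth_on (vrep d X) T"
      \<comment> \<open>Inside the domain of \<open>c\<close> the field is an explicit smooth
        expression on the overlap; at all other points it vanishes on the open complement of
        \<open>K\<close>.\<close>
      proof (cases "?q \<in> chart_dom c")
        case True
        have y': "y \<in> overlap d c"
          using True coord_inv_in[OF y] coord_coord_inv[OF y] by force
        note S = open_overlap[OF dA cA]
        have tr: "smooth_on (transition d c) (overlap d c)" by (rule smooth_transition[OF dA cA])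
        have "smooth_on (\<lambda>y. fderiv (transition c d) (transition d c y) (\<beta> (transition d c y) *\<^sub>R u)) (overlap d c)"
        proof (rule smooth_on_linear_family[OF S, where L = "\<lambda>y. fderiv (transition c d) (transition d c y)"])
          show "linear (fderiv (transition c d) (transition d c y))" if "y \<in> overlap d c" for y
            by (rule smooth_on_linear_fderiv[OF smooth_transition[OF cA dA] open_overlap[OF cA dA]
                  transition_overlap[OF dA cA that]])
          show "smooth_on (\<lambda>y. fderiv (transition c d) (transition d c y) w) (overlap d c)" for w
            by (rule smooth_on_compose[OF S open_overlap[OF cA dA] _ tr smooth_on_fderiv[OF smooth_transition[OF cA dA]]])
              (use transition_overlap[OF dA cA] in auto)
          show "smooth_on (\<lambda>y. \<beta> (transition d c y) *\<^sub>R u) (overlap d c)"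
            by (intro smooth_on_scaleR[OF S] smooth_on_const smooth_on_compose[OF S open_UNIV _ tr \<beta>(1)]) auto
        qed
        then have "smooth_on (vrep d X) (overlap d c)"
        proof (rule smooth_on_cong[OF S, rotated])
          fix y assume y: "y \<in> overlap d c"
          note o = overlapD[OF dA y cA]
          have "d \<in> charts_at A (coord_inv d y)" using o(2) dA by (simp add: charts_at_def)
          moreover have "coord c (coord_inv d y) = transition d c y" by (simp add: transition_def)
          ultimately show "fderiv (transition c d) (transition d c y) (\<beta> (transition d c y) *\<^sub>R u) = vrep d X y"
            using o(3) by (simp add: vrep_def X_def tvec_def)
        qed
        then show ?thesis using y' S by blast
      next
        case False
        let ?W = "coord d ` ((points A - K) \<inter> chart_dom d)"
        have "K \<subseteq> chart_dom c" unfolding K_def by (rule image_subsetI, rule coord_inv_in) (use sub in blast)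
        then have "?q \<in> (points A - K) \<inter> chart_dom d"
          using False coord_inv_in[OF y] charts_at_points[OF coord_inv_charts_at[OF dA y]] by blast
        from imageI[OF this, of "coord d"] have "y \<in> ?W" by (simp only: coord_coord_inv[OF y])
        moreover have "smooth_on (vrep d X) ?W"
          by (rule smooth_on_cong[OF openK[OF dA] _ smooth_on_const[of 0]])
            (use X0 coord_inv_coord[OF dA] in \<open>force simp: vrep_def\<close>)
        ultimately show ?thesis using openK[OF dA] by blast
      qed
    qed
  qed
  show thesis
  proof (rule that[OF XVF, of "ball x0 (r / 2)"])
    show sub': "ball x0 (r / 2) \<subseteq> chart_img c" using r by auto
    show "vrep c X x = u" if "x \<in> ball x0 (r / 2)" for x
    proof -
      have x: "x \<in> chart_img c" using that sub' by blast
      then show ?thesis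
        using coord_inv_in[OF x] coord_coord_inv[OF x] tvec_at[OF coord_inv_charts_at[OF cA x]] \<beta>(2)[OF that]
        by (simp add: vrep_def X_def)
    qed
  qed (use r in \<open>simp_all add: x0_def\<close>)
qed

text \<open>The definitions test tensor fields and connections on global fields; through this
  extension such conditions become conditions on single tangent vectors.\<close>

lemma extend_tangent:
  assumes "v \<in> tangent_space A p"
  obtains X where "X \<in> vector_fields A" "X p = v"
proof (cases "p \<in> points A")
  case True
  then obtain c where c: "c \<in> charts_at A p" by (rule chart_atE)
  obtain X S where X: "X \<in> vector_fields A" "open S" "coord c p \<in> S" "S \<subseteq> chart_img c"
    "\<And>x. x \<in> S \<Longrightarrow> vrep c X x = v c" by (rule extend_constant_field[OF c, where u = "v c"]) (rule that)
  have "X p c = v c" using X(3,5) vrep_coord[OF c, of X] by simp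
  then have "X p = v" by (rule tangent_eqI[OF vf_tangent[OF X(1)] assms c])
  with X(1) show thesis by (rule that)
next
  case False
  have "(\<lambda>q. 0) \<in> vector_fields A"
    by (rule vfI) (simp_all add: tangent_zero vrep_def[abs_def] smooth_on_const)
  moreover have "(\<lambda>q. 0) p = v" using tangent_outside[OF False assms] by simp
  ultimately show thesis by (rule that)
qed

end

lemma linear_on_subspaceD:
  assumes "linear_on_subspace V f"
  shows "u \<in> V \<Longrightarrow> v \<in> V \<Longrightarrow> f (u + v) = f u + f v" "v \<in> V \<Longrightarrow> f (r *\<^sub>R v) = r *\<^sub>R f v"
  using assms unfolding linear_on_subspace_def by auto

lemma scaleR_fun_apply: "(r *\<^sub>R f) x = r *\<^sub>R f x" for f :: "'a \<Rightarrow> 'b::real_vector"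
  by (simp add: scaleR_fun_def)

lemma fun_scale_apply: "fun_scale f X p c = f p *\<^sub>R X p c"
  by (simp add: fun_scale_def scaleR_fun_def)

text \<open>\<open>frep\<close>, \<open>brep\<close> and \<open>erep\<close> are the coordinate
  expressions of one-forms, bilinear forms and endomorphism fields, as functions of a point and of
  vectors in the model space.\<close>

definition frep :: "('p, 'e::euclidean_space) atlas \<Rightarrow> ('p, 'e) chart \<Rightarrow> ('p, 'e) form1 \<Rightarrow> 'e \<Rightarrow> 'e \<Rightarrow> real" where
  "frep A c \<eta> x u = \<eta> (coord_inv c x) (tvec A (coord_inv c x) c u)"

definition brep :: "('p, 'e::euclidean_space) atlas \<Rightarrow> ('p, 'e) chart \<Rightarrow> ('p, 'e) form2 \<Rightarrow> 'e \<Rightarrow> 'e \<Rightarrow> 'e \<Rightarrow> real" where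
  "brep A c \<omega> x u v = \<omega> (coord_inv c x) (tvec A (coord_inv c x) c u) (tvec A (coord_inv c x) c v)"

definition erep :: "('p, 'e::euclidean_space) atlas \<Rightarrow> ('p, 'e) chart \<Rightarrow> ('p, 'e) endo \<Rightarrow> 'e \<Rightarrow> 'e \<Rightarrow> 'e" where
  "erep A c \<phi> x u = \<phi> (coord_inv c x) (tvec A (coord_inv c x) c u) c"

section \<open>Tensor fields in charts\<close>

context hausdorff_mfd
begin

lemma one_formD:
  assumes "one_form A \<eta>"
  shows "u \<in> tangent_space A p \<Longrightarrow> v \<in> tangent_space A p \<Longrightarrow> \<eta> p (u + v) = \<eta> p u + \<eta> p v"
    "u \<in> tangent_space A p \<Longrightarrow> \<eta> p (r *\<^sub>R u) = r * \<eta> p u"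
    "X \<in> vector_fields A \<Longrightarrow> smooth_fun A (\<lambda>p. \<eta> p (X p))"
  using assms linear_on_subspaceD[of "tangent_space A p" "\<eta> p"] unfolding one_form_def by auto

lemma bilinear_fieldD:
  assumes "bilinear_field A \<omega>" "u \<in> tangent_space A p" "v \<in> tangent_space A p" "w \<in> tangent_space A p"
  shows "\<omega> p (u + v) w = \<omega> p u w + \<omega> p v w" "\<omega> p w (u + v) = \<omega> p w u + \<omega> p w v"
    "\<omega> p (r *\<^sub>R u) w = r * \<omega> p u w" "\<omega> p w (r *\<^sub>R u) = r * \<omega> p w u"
proof -
  have 1: "linear_on_subspace (tangent_space A p) (\<omega> p w)"
    and 2: "linear_on_subspace (tangent_space A p) (\<lambda>v. \<omega> p v w)"
    using assms unfolding bilinear_field_def by auto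
  show "\<omega> p (u + v) w = \<omega> p u w + \<omega> p v w" using linear_on_subspaceD(1)[OF 2 assms(2,3)] .
  show "\<omega> p w (u + v) = \<omega> p w u + \<omega> p w v" using linear_on_subspaceD(1)[OF 1 assms(2,3)] .
  show "\<omega> p (r *\<^sub>R u) w = r * \<omega> p u w" using linear_on_subspaceD(2)[OF 2 assms(2)] by simp
  show "\<omega> p w (r *\<^sub>R u) = r * \<omega> p w u" using linear_on_subspaceD(2)[OF 1 assms(2)] by simp
qed

lemma bilinear_field_diff:
  assumes "bilinear_field A \<omega>" "u \<in> tangent_space A p" "v \<in> tangent_space A p" "w \<in> tangent_space A p"
  shows "\<omega> p (u - v) w = \<omega> p u w - \<omega> p v w" "\<omega> p w (u - v) = \<omega> p w u - \<omega> p w v"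
  using bilinear_fieldD(1,2)[OF assms(1) tangent_diff[OF assms(2,3)] assms(3,4)] by auto

lemma bilinear_field_smooth:
  "bilinear_field A \<omega> \<Longrightarrow> X \<in> vector_fields A \<Longrightarrow> Y \<in> vector_fields A \<Longrightarrow> smooth_fun A (\<lambda>p. \<omega> p (X p) (Y p))"
  unfolding bilinear_field_def by simp

lemma endo_fieldD:
  assumes "endo_field A \<phi>"
  shows "u \<in> tangent_space A p \<Longrightarrow> v \<in> tangent_space A p \<Longrightarrow> \<phi> p (u + v) = \<phi> p u + \<phi> p v"
    "u \<in> tangent_space A p \<Longrightarrow> \<phi> p (r *\<^sub>R u) = r *\<^sub>R \<phi> p u"
    "u \<in> tangent_space A p \<Longrightarrow> \<phi> p u \<in> tangent_space A p"
    "X \<in> vector_fields A \<Longrightarrow> endo_app \<phi> X \<in> vector_fields A"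
  using assms linear_on_subspaceD[of "tangent_space A p" "\<phi> p"] unfolding endo_field_def by (auto simp: image_subset_iff)

lemma linear_frep:
  assumes "one_form A \<eta>" "c \<in> A" "x \<in> chart_img c"
  shows "linear (frep A c \<eta> x)"
proof -
  note c = coord_inv_charts_at[OF assms(2,3)]
  show ?thesis
    by (rule linearI) (simp_all add: frep_def tvec_add[OF c] tvec_scaleR[OF c] one_formD[OF assms(1)] tvec_in[OF c])
qed

lemma linear_brep:
  assumes "bilinear_field A \<omega>" "c \<in> A" "x \<in> chart_img c"
  shows "linear (brep A c \<omega> x u)" "linear (\<lambda>u. brep A c \<omega> x u v)"
proof -
  note c = coord_inv_charts_at[OF assms(2,3)]
  note t = tvec_in[OF c]
  show "linear (brep A c \<omega> x u)"
    by (rule linearI) (simp_all add: brep_def tvec_add[OF c] tvec_scaleR[OF c] bilinear_fieldD(2,4)[OF assms(1) t t t])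
  show "linear (\<lambda>u. brep A c \<omega> x u v)"
    by (rule linearI) (simp_all add: brep_def tvec_add[OF c] tvec_scaleR[OF c] bilinear_fieldD(1,3)[OF assms(1) t t t])
qed

lemma linear_erep:
  assumes "endo_field A \<phi>" "c \<in> A" "x \<in> chart_img c"
  shows "linear (erep A c \<phi> x)"
proof -
  note c = coord_inv_charts_at[OF assms(2,3)]
  show ?thesis
    by (rule linearI)
      (simp_all add: erep_def tvec_add[OF c] tvec_scaleR[OF c] endo_fieldD(2)[OF assms(1) tvec_in[OF c]]
        endo_fieldD(1)[OF assms(1) tvec_in[OF c] tvec_in[OF c]] scaleR_fun_apply)
qed

lemma tvec_vrep:
  "X \<in> vector_fields A \<Longrightarrow> c \<in> A \<Longrightarrow> x \<in> chart_img c \<Longrightarrow> tvec A (coord_inv c x) c (vrep c X x) = X (coord_inv c x)"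
  unfolding vrep_def by (rule tvec_of[OF vf_tangent coord_inv_charts_at])

lemma frep_vrep:
  "X \<in> vector_fields A \<Longrightarrow> c \<in> A \<Longrightarrow> x \<in> chart_img c \<Longrightarrow> frep A c \<eta> x (vrep c X x) = \<eta> (coord_inv c x) (X (coord_inv c x))"
  by (simp add: frep_def tvec_vrep)

lemma brep_vrep:
  "X \<in> vector_fields A \<Longrightarrow> Y \<in> vector_fields A \<Longrightarrow> c \<in> A \<Longrightarrow> x \<in> chart_img c \<Longrightarrow>
    brep A c \<omega> x (vrep c X x) (vrep c Y x) = \<omega> (coord_inv c x) (X (coord_inv c x)) (Y (coord_inv c x))"
  by (simp add: brep_def tvec_vrep)

lemma erep_vrep:
  "X \<in> vector_fields A \<Longrightarrow> c \<in> A \<Longrightarrow> x \<in> chart_img c \<Longrightarrow> erep A c \<phi> x (vrep c X x) = vrep c (endo_app \<phi> X) x"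
  by (simp add: erep_def tvec_vrep) (simp add: vrep_def endo_app_def)

lemma frep_coord:
  "c \<in> charts_at A p \<Longrightarrow> v \<in> tangent_space A p \<Longrightarrow> frep A c \<eta> (coord c p) (v c) = \<eta> p v"
  using coord_inv_coord[OF charts_atD] tvec_of by (simp add: frep_def)

lemma brep_coord:
  "c \<in> charts_at A p \<Longrightarrow> u \<in> tangent_space A p \<Longrightarrow> v \<in> tangent_space A p \<Longrightarrow>
    brep A c \<omega> (coord c p) (u c) (v c) = \<omega> p u v"
  using coord_inv_coord[OF charts_atD] tvec_of by (simp add: brep_def)

lemma erep_coord:
  "c \<in> charts_at A p \<Longrightarrow> v \<in> tangent_space A p \<Longrightarrow> erep A c \<phi> (coord c p) (v c) = \<phi> p v c"
  using coord_inv_coord[OF charts_atD] tvec_of by (simp add: erep_def)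

text \<open>Smoothness of a tensor field is known only on global fields. Near each point there are
  global fields with constant components \<open>u\<close> and \<open>v\<close>, and on these the
  tensor takes the values of its components.\<close>

lemma smooth_by_constant_fields:
  assumes c: "c \<in> A"
    and F: "\<And>X Y S. \<lbrakk>X \<in> vector_fields A; Y \<in> vector_fields A; open S; S \<subseteq> chart_img c;
      \<And>x. x \<in> S \<Longrightarrow> vrep c X x = u; \<And>x. x \<in> S \<Longrightarrow> vrep c Y x = v\<rbrakk> \<Longrightarrow> smooth_on F S"
  shows "smooth_on F (chart_img c)"
proof (rule smooth_on_local)
  fix x assume x: "x \<in> chart_img c"
  note cx = coord_inv_charts_at[OF c x]
  obtain X S where X: "X \<in> vector_fields A" "open S" "coord c (coord_inv c x) \<in> S" "S \<subseteq> chart_img c"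
    "\<And>x. x \<in> S \<Longrightarrow> vrep c X x = u" by (rule extend_constant_field[OF cx, where u = u]) (rule that)
  obtain Y T where Y: "Y \<in> vector_fields A" "open T" "coord c (coord_inv c x) \<in> T" "T \<subseteq> chart_img c"
    "\<And>x. x \<in> T \<Longrightarrow> vrep c Y x = v" by (rule extend_constant_field[OF cx, where u = v]) (rule that)
  have "smooth_on F (S \<inter> T)"
    by (rule F[OF X(1) Y(1)]) (use X(2,4,5) Y(2,4,5) in auto)
  moreover have "x \<in> S \<inter> T" using X(3) Y(3) coord_coord_inv[OF x] by simp
  ultimately show "\<exists>T. open T \<and> x \<in> T \<and> smooth_on F T" using X(2) Y(2) open_Int by metis
qed

lemma smooth_frep:
  assumes "one_form A \<eta>" and c: "c \<in> A"
  shows "smooth_on (\<lambda>x. frep A c \<eta> x u) (chart_img c)"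
proof (rule smooth_by_constant_fields[OF c, where u = u and v = u])
  fix X S assume *: "X \<in> vector_fields A" "open S" "S \<subseteq> chart_img c" "\<And>x. x \<in> S \<Longrightarrow> vrep c X x = u"
  have sm: "smooth_on ((\<lambda>p. \<eta> p (X p)) \<circ> coord_inv c) (chart_img c)"
    using one_formD(3)[OF assms(1) *(1)] c by (simp add: smooth_fun_def)
  show "smooth_on (\<lambda>x. frep A c \<eta> x u) S"
  proof (rule smooth_on_cong[OF *(2) _ smooth_on_subset[OF sm *(2,3)]])
    fix x assume x: "x \<in> S"
    then have "x \<in> chart_img c" using *(3) by blast
    then show "((\<lambda>p. \<eta> p (X p)) \<circ> coord_inv c) x = frep A c \<eta> x u"
      using frep_vrep[OF *(1) c, of x \<eta>] *(4)[OF x] by simp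
  qed
qed

lemma smooth_brep:
  assumes "bilinear_field A \<omega>" and c: "c \<in> A"
  shows "smooth_on (\<lambda>x. brep A c \<omega> x u v) (chart_img c)"
proof (rule smooth_by_constant_fields[OF c, where u = u and v = v])
  fix X Y S assume *: "X \<in> vector_fields A" "Y \<in> vector_fields A" "open S" "S \<subseteq> chart_img c"
    "\<And>x. x \<in> S \<Longrightarrow> vrep c X x = u" "\<And>x. x \<in> S \<Longrightarrow> vrep c Y x = v"
  have sm: "smooth_on ((\<lambda>p. \<omega> p (X p) (Y p)) \<circ> coord_inv c) (chart_img c)"
    using bilinear_field_smooth[OF assms(1) *(1,2)] c by (simp add: smooth_fun_def)
  show "smooth_on (\<lambda>x. brep A c \<omega> x u v) S"
  proof (rule smooth_on_cong[OF *(3) _ smooth_on_subset[OF sm *(3,4)]])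
    fix x assume x: "x \<in> S"
    then have "x \<in> chart_img c" using *(4) by blast
    then show "((\<lambda>p. \<omega> p (X p) (Y p)) \<circ> coord_inv c) x = brep A c \<omega> x u v"
      using brep_vrep[OF *(1,2) c, of x \<omega>] *(5,6)[OF x] by simp
  qed
qed

lemma smooth_erep:
  assumes "endo_field A \<phi>" and c: "c \<in> A"
  shows "smooth_on (\<lambda>x. erep A c \<phi> x u) (chart_img c)"
proof (rule smooth_by_constant_fields[OF c, where u = u and v = u])
  fix X S assume *: "X \<in> vector_fields A" "open S" "S \<subseteq> chart_img c" "\<And>x. x \<in> S \<Longrightarrow> vrep c X x = u"
  show "smooth_on (\<lambda>x. erep A c \<phi> x u) S"
  proof (rule smooth_on_cong[OF *(2) _ smooth_on_subset[OF vf_smooth[OF endo_fieldD(4)[OF assms(1) *(1)] c] *(2,3)]])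
    fix x assume x: "x \<in> S"
    then have "x \<in> chart_img c" using *(3) by blast
    then show "vrep c (endo_app \<phi> X) x = erep A c \<phi> x u"
      using erep_vrep[OF *(1) c, of x \<phi>] *(4)[OF x] by simp
  qed
qed

section \<open>Derivatives of a bilinear form in a chart\<close>

text \<open>The derivative in direction \<open>v\<close> with both arguments frozen; for a metric
  these are the partial derivatives entering the Christoffel symbols.\<close>

definition brep_deriv :: "('p, 'e) chart \<Rightarrow> ('p, 'e) form2 \<Rightarrow> 'e \<Rightarrow> 'e \<Rightarrow> 'e \<Rightarrow> 'e \<Rightarrow> real" where
  "brep_deriv c \<omega> x v u w = fderiv (\<lambda>x. brep A c \<omega> x u w) x v"

text \<open>Leibniz rule for three factors, by two nested uses of the rule for families of linear
  maps.\<close>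

lemma brep_has_derivative:
  assumes \<omega>: "bilinear_field A \<omega>" and c: "c \<in> A" and x: "x \<in> chart_img c"
    and P: "(P has_derivative P') (at x)" and Q: "(Q has_derivative Q') (at x)"
  shows "((\<lambda>x. brep A c \<omega> x (P x) (Q x)) has_derivative
    (\<lambda>v. brep_deriv c \<omega> x v (P x) (Q x) + brep A c \<omega> x (P' v) (Q x) + brep A c \<omega> x (P x) (Q' v))) (at x)"
proof -
  note S = open_chart_img[OF c]
  have 1: "((\<lambda>x. brep A c \<omega> x u (Q x)) has_derivative
      (\<lambda>v. brep_deriv c \<omega> x v u (Q x) + brep A c \<omega> x u (Q' v))) (at x)" for u
    unfolding brep_deriv_def
    by (rule has_derivative_linear_family[where L = "\<lambda>x w. brep A c \<omega> x u w", OF S x linear_brep(1)[OF \<omega> c]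
          smooth_on_has_derivative[OF smooth_brep[OF \<omega> c] S x] Q])
  have "((\<lambda>x. brep A c \<omega> x (P x) (Q x)) has_derivative
      (\<lambda>v. (brep_deriv c \<omega> x v (P x) (Q x) + brep A c \<omega> x (P x) (Q' v)) + brep A c \<omega> x (P' v) (Q x))) (at x)"
    by (rule has_derivative_linear_family[where L = "\<lambda>x u. brep A c \<omega> x u (Q x)", OF S x linear_brep(2)[OF \<omega> c] 1 P])
  then show ?thesis by (simp add: add.commute add.left_commute)
qed

lemma linear_brep_deriv:
  assumes \<omega>: "bilinear_field A \<omega>" and c: "c \<in> A" and x: "x \<in> chart_img c"
  shows "linear (\<lambda>v. brep_deriv c \<omega> x v u w)" "linear (\<lambda>u. brep_deriv c \<omega> x v u w)"
    "linear (\<lambda>w. brep_deriv c \<omega> x v u w)"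
proof -
  note S = open_chart_img[OF c]
  note D = smooth_on_has_derivative[OF smooth_brep[OF \<omega> c] S x]
  show "linear (\<lambda>v. brep_deriv c \<omega> x v u w)"
    unfolding brep_deriv_def by (rule smooth_on_linear_fderiv[OF smooth_brep[OF \<omega> c] S x])
  show "linear (\<lambda>u. brep_deriv c \<omega> x v u w)" unfolding brep_deriv_def
    by (rule linear_fderiv_family[where L = "\<lambda>x u. brep A c \<omega> x u w", OF S x linear_brep(2)[OF \<omega> c] D])
  show "linear (\<lambda>w. brep_deriv c \<omega> x v u w)" unfolding brep_deriv_def
    by (rule linear_fderiv_family[where L = "\<lambda>x w. brep A c \<omega> x u w", OF S x linear_brep(1)[OF \<omega> c] D])
qed

lemma smooth_brep_comp:
  assumes \<omega>: "bilinear_field A \<omega>" and c: "c \<in> A" and S: "open S" and i: "smooth_on i S" "\<And>y. y \<in> S \<Longrightarrow> i y \<in> chart_img c"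
    and P: "smooth_on P S" and Q: "smooth_on Q S"
  shows "smooth_on (\<lambda>y. brep A c \<omega> (i y) (P y) (Q y)) S"
proof (rule smooth_on_linear_family[where L = "\<lambda>y u. brep A c \<omega> (i y) u (Q y)", OF S linear_brep(2)[OF \<omega> c i(2)] _ P])
  fix u
  show "smooth_on (\<lambda>y. brep A c \<omega> (i y) u (Q y)) S"
  proof (rule smooth_on_linear_family[where L = "\<lambda>y w. brep A c \<omega> (i y) u w", OF S linear_brep(1)[OF \<omega> c i(2)] _ Q])
    show "smooth_on (\<lambda>y. brep A c \<omega> (i y) u w) S" for w
      by (rule smooth_on_compose[OF S open_chart_img[OF c] _ i(1) smooth_brep[OF \<omega> c]]) (use i(2) in blast)
  qed
qed

lemma vf_deriv_form2:
  assumes \<omega>: "bilinear_field A \<omega>" and X: "X \<in> vector_fields A" and Y: "Y \<in> vector_fields A"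
    and Z: "Z \<in> vector_fields A" and c: "c \<in> charts_at A p"
  shows "vf_deriv A X (\<lambda>q. \<omega> q (Y q) (Z q)) p =
    brep_deriv c \<omega> (coord c p) (X p c) (Y p c) (Z p c)
    + brep A c \<omega> (coord c p) (fderiv (vrep c Y) (coord c p) (X p c)) (Z p c)
    + brep A c \<omega> (coord c p) (Y p c) (fderiv (vrep c Z) (coord c p) (X p c))"
proof -
  note cA = charts_atD(1)[OF c] and x = coord_in_img[OF c]
  note S = open_chart_img[OF cA]
  have "((\<lambda>x. brep A c \<omega> x (vrep c Y x) (vrep c Z x)) has_derivative
      (\<lambda>v. brep_deriv c \<omega> (coord c p) v (Y p c) (Z p c)
        + brep A c \<omega> (coord c p) (fderiv (vrep c Y) (coord c p) v) (Z p c)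
        + brep A c \<omega> (coord c p) (Y p c) (fderiv (vrep c Z) (coord c p) v))) (at (coord c p))"
    using brep_has_derivative[OF \<omega> cA x smooth_on_has_derivative[OF vf_smooth[OF Y cA] S x]
        smooth_on_has_derivative[OF vf_smooth[OF Z cA] S x]] by (simp add: vrep_coord[OF c])
  then have "((\<lambda>q. \<omega> q (Y q) (Z q)) \<circ> coord_inv c has_derivative
      (\<lambda>v. brep_deriv c \<omega> (coord c p) v (Y p c) (Z p c)
        + brep A c \<omega> (coord c p) (fderiv (vrep c Y) (coord c p) v) (Z p c)
        + brep A c \<omega> (coord c p) (Y p c) (fderiv (vrep c Z) (coord c p) v))) (at (coord c p))"
    by (rule has_derivative_transform_within_open[OF _ S x]) (simp add: brep_vrep[OF Y Z cA])
  from vf_deriv_chart[OF c X this] show ?thesis .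
qed

end

section \<open>The Levi-Civita connection\<close>

text \<open>Right-hand side of the Koszul formula for \<open>2 * g (nabla X Y) Z\<close>, which
  involves derivatives of the metric and brackets but no connection.\<close>

definition koszul ::
  "('p, 'e::euclidean_space) atlas \<Rightarrow> ('p, 'e) form2 \<Rightarrow> ('p, 'e) vfield \<Rightarrow> ('p, 'e) vfield \<Rightarrow> ('p, 'e) vfield \<Rightarrow> 'p \<Rightarrow> real" where
  "koszul A g X Y Z p =
     vf_deriv A X (\<lambda>q. g q (Y q) (Z q)) p + vf_deriv A Y (\<lambda>q. g q (X q) (Z q)) p
     - vf_deriv A Z (\<lambda>q. g q (X q) (Y q)) p + g p (lie_bracket A X Y p) (Z p)
     - g p (lie_bracket A X Z p) (Y p) - g p (lie_bracket A Y Z p) (X p)"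

text \<open>Formulated with nondegeneracy in place of a signature, so that the metric induced on a
  leaf is an instance as well.\<close>

locale metric_mfd = hausdorff_mfd A for A :: "('p, 'e::euclidean_space) atlas" +
  fixes g :: "('p, 'e) form2"
  assumes g: "bilinear_field A g"
    and g_sym: "\<And>p u v. p \<in> points A \<Longrightarrow> u \<in> tangent_space A p \<Longrightarrow> v \<in> tangent_space A p \<Longrightarrow> g p u v = g p v u"
    and g_nondeg: "\<And>p u. p \<in> points A \<Longrightarrow> u \<in> tangent_space A p \<Longrightarrow>
      (\<And>v. v \<in> tangent_space A p \<Longrightarrow> g p u v = 0) \<Longrightarrow> u = 0"
begin

lemma brep_sym:
  assumes "c \<in> A" "x \<in> chart_img c"
  shows "brep A c g x u v = brep A c g x v u"
  unfolding brep_def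
  by (rule g_sym) (rule charts_at_points tvec_in coord_inv_charts_at assms)+

lemma brep_deriv_sym:
  assumes c: "c \<in> A" and x: "x \<in> chart_img c"
  shows "brep_deriv c g x v u w = brep_deriv c g x v w u"
  unfolding brep_deriv_def
  using fderiv_cong[OF open_chart_img[OF c] x, of "\<lambda>x. brep A c g x u w" "\<lambda>x. brep A c g x w u"] brep_sym[OF c]
  by simp

lemma brep_nondeg:
  assumes c: "c \<in> A" and x: "x \<in> chart_img c" and 0: "\<And>v. brep A c g x u v = 0"
  shows "u = 0"
proof -
  note cx = coord_inv_charts_at[OF c x]
  have "tvec A (coord_inv c x) c u = 0"
  proof (rule g_nondeg[OF charts_at_points[OF cx] tvec_in[OF cx]])
    fix v assume "v \<in> tangent_space A (coord_inv c x)"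
    from tvec_of[OF this cx] show "g (coord_inv c x) (tvec A (coord_inv c x) c u) v = 0"
      using 0[of "v c"] by (simp add: brep_def)
  qed
  then show ?thesis using tvec_at[OF cx, of u] by simp
qed

lemma brep_cancel:
  assumes c: "c \<in> A" and x: "x \<in> chart_img c" and eq: "\<And>w. brep A c g x u w = brep A c g x v w"
  shows "u = v"
proof -
  have "u - v = 0"
    by (rule brep_nondeg[OF c x]) (simp add: linear_diff[OF linear_brep(2)[OF g c x]] eq)
  then show ?thesis by simp
qed

text \<open>Lowering of an index, with covectors identified with vectors through the standard basis.
  It brings equations tested against the metric into the form of
  \<open>smooth_on_linear_solve\<close>.\<close>

definition lower :: "('p, 'e) chart \<Rightarrow> 'e \<Rightarrow> 'e \<Rightarrow> 'e" where
  "lower c x u = (\<Sum>b\<in>Basis. brep A c g x u b *\<^sub>R b)"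

lemma lower_inner: "b \<in> Basis \<Longrightarrow> lower c x u \<bullet> b = brep A c g x u b"
  unfolding lower_def by simp

lemma linear_lower:
  assumes "c \<in> A" "x \<in> chart_img c" shows "linear (lower c x)"
  by (rule linearI)
    (simp_all add: lower_def linear_add[OF linear_brep(2)[OF g assms]] linear_cmul[OF linear_brep(2)[OF g assms]]
      scaleR_add_left sum.distrib scaleR_sum_right)

lemma inj_lower:
  assumes c: "c \<in> A" and x: "x \<in> chart_img c" shows "inj (lower c x)"
proof (rule injI)
  fix u v assume eq: "lower c x u = lower c x v"
  show "u = v"
  proof (rule brep_cancel[OF c x])
    fix w
    have "brep A c g x u b = brep A c g x v b" if "b \<in> Basis" for b
      using eq lower_inner[OF that] by metis
    then show "brep A c g x u w = brep A c g x v w"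
      by (subst (1 2) linear_euclid_expand[OF linear_brep(1)[OF g c x]]) simp
  qed
qed

lemma smooth_lower: "c \<in> A \<Longrightarrow> smooth_on (\<lambda>x. lower c x u) (chart_img c)"
  unfolding lower_def by (intro smooth_on_sum smooth_on_scaleR smooth_brep g smooth_on_const open_chart_img)

lemma represent_functional:
  assumes c: "c \<in> A" and x: "x \<in> chart_img c" and f: "linear f"
  obtains u where "\<And>w. brep A c g x u w = f w"
proof -
  have "surj (lower c x)"
    by (rule linear_injective_imp_surjective[OF linear_lower[OF c x] inj_lower[OF c x] refl])
  then obtain u where u: "lower c x u = (\<Sum>b\<in>Basis. f b *\<^sub>R b)" unfolding surj_def by metis
  have b: "brep A c g x u b = f b" if "b \<in> Basis" for b
    using lower_inner[OF that, of c x u] that by (simp add: u)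
  have "brep A c g x u w = f w" for w
    by (subst linear_euclid_expand[OF linear_brep(1)[OF g c x]], subst linear_euclid_expand[OF f]) (simp add: b)
  then show thesis by (rule that)
qed

text \<open>Twice the Christoffel symbol of the first kind.\<close>

definition christoffel :: "('p, 'e) chart \<Rightarrow> 'e \<Rightarrow> 'e \<Rightarrow> 'e \<Rightarrow> 'e \<Rightarrow> real" where
  "christoffel c x u v w = brep_deriv c g x u v w + brep_deriv c g x v u w - brep_deriv c g x w u v"

text \<open>The derivatives of the representatives of \<open>X\<close> and \<open>Z\<close> cancel
  against the brackets, and only that of \<open>Y\<close> survives. The expression thus depends on
  \<open>X\<close> and \<open>Z\<close> only through their values at the point.\<close>

lemma koszul_chart:
  assumes X: "X \<in> vector_fields A" and Y: "Y \<in> vector_fields A" and Z: "Z \<in> vector_fields A"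
    and c: "c \<in> charts_at A p"
  shows "koszul A g X Y Z p = 2 * brep A c g (coord c p) (fderiv (vrep c Y) (coord c p) (X p c)) (Z p c)
    + christoffel c (coord c p) (X p c) (Y p c) (Z p c)"
proof -
  note cA = charts_atD(1)[OF c] and x = coord_in_img[OF c]
  have br: "g p (lie_bracket A P Q p) (R p) = brep A c g (coord c p) (fderiv (vrep c Q) (coord c p) (P p c)) (R p c)
      - brep A c g (coord c p) (fderiv (vrep c P) (coord c p) (Q p c)) (R p c)"
    if "P \<in> vector_fields A" "Q \<in> vector_fields A" "R \<in> vector_fields A" for P Q R
    using brep_coord[OF c vf_tangent[OF vf_lie_bracket[OF that(1,2)]] vf_tangent[OF that(3)], of g]
    by (simp add: lie_bracket_chart[OF c] linear_diff[OF linear_brep(2)[OF g cA x]])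
  show ?thesis
    unfolding koszul_def christoffel_def
    using brep_sym[OF cA x] brep_deriv_sym[OF cA x]
    by (simp add: vf_deriv_form2[OF g X Y Z c] vf_deriv_form2[OF g Y X Z c] vf_deriv_form2[OF g Z X Y c]
        br[OF X Y Z] br[OF X Z Y] br[OF Y Z X])
qed

text \<open>The pointwise solution of the Koszul formula; by nondegeneracy the choice has only one
  possible outcome at a point of the manifold.\<close>

definition lc :: "('p, 'e) connection" where
  "lc X Y p = (if p \<in> points A
    then SOME w. w \<in> tangent_space A p \<and> (\<forall>Z\<in>vector_fields A. 2 * g p w (Z p) = koszul A g X Y Z p) else 0)"

text \<open>Every coordinate vector \<open>v\<close> is the value at \<open>p\<close> of a global
  field, so the identity for fields determines the product with all vectors.\<close>

lemma koszul_solution_chart: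
  assumes X: "X \<in> vector_fields A" and Y: "Y \<in> vector_fields A" and c: "c \<in> charts_at A p"
    and w: "w \<in> tangent_space A p" "\<And>Z. Z \<in> vector_fields A \<Longrightarrow> 2 * g p w (Z p) = koszul A g X Y Z p"
  shows "2 * brep A c g (coord c p) (w c) v =
    2 * brep A c g (coord c p) (fderiv (vrep c Y) (coord c p) (X p c)) v + christoffel c (coord c p) (X p c) (Y p c) v"
proof -
  obtain Z where Z: "Z \<in> vector_fields A" "Z p = tvec A p c v"
    by (rule extend_tangent[OF tvec_in[OF c]]) (rule that)
  have "Z p c = v" using Z(2) tvec_at[OF c] by simp
  then show ?thesis
    using w(2)[OF Z(1)] koszul_chart[OF X Y Z(1) c] brep_coord[OF c w(1) vf_tangent[OF Z(1)], of g] by simp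
qed

text \<open>In a chart the Koszul expression is a linear functional of the value of
  \<open>Z\<close>, and nondegeneracy represents it by a vector.\<close>

lemma lc_koszul:
  assumes X: "X \<in> vector_fields A" and Y: "Y \<in> vector_fields A"
  shows "lc X Y p \<in> tangent_space A p"
    "p \<in> points A \<Longrightarrow> Z \<in> vector_fields A \<Longrightarrow> 2 * g p (lc X Y p) (Z p) = koszul A g X Y Z p"
proof -
  have *: "lc X Y p \<in> tangent_space A p \<and> (\<forall>Z\<in>vector_fields A. 2 * g p (lc X Y p) (Z p) = koszul A g X Y Z p)"
    if p: "p \<in> points A"
  proof -
    obtain c where c: "c \<in> charts_at A p" using p by (rule chart_atE)
    note cA = charts_atD(1)[OF c] and x = coord_in_img[OF c]
    have "linear (\<lambda>w. christoffel c (coord c p) (X p c) (Y p c) w / 2)"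
      unfolding christoffel_def
      by (rule linearI)
        (simp_all add: linear_add[OF linear_brep_deriv(1)[OF g cA x]] linear_cmul[OF linear_brep_deriv(1)[OF g cA x]]
          linear_add[OF linear_brep_deriv(3)[OF g cA x]] linear_cmul[OF linear_brep_deriv(3)[OF g cA x]]
          diff_divide_distrib add_divide_distrib right_diff_distrib distrib_left)
    from represent_functional[OF cA x this]
    obtain u where u: "\<And>w. brep A c g (coord c p) u w = christoffel c (coord c p) (X p c) (Y p c) w / 2" by metis
    define w where "w = tvec A p c (fderiv (vrep c Y) (coord c p) (X p c) + u)"
    have w: "w \<in> tangent_space A p" "w c = fderiv (vrep c Y) (coord c p) (X p c) + u"
      by (simp_all add: w_def tvec_in[OF c] tvec_at[OF c])
    have "2 * g p w (Z p) = koszul A g X Y Z p" if Z: "Z \<in> vector_fields A" for Z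
      using koszul_chart[OF X Y Z c] brep_coord[OF c w(1) vf_tangent[OF Z], of g]
      by (simp add: w(2) linear_add[OF linear_brep(2)[OF g cA x]] u)
    then have "\<exists>w. w \<in> tangent_space A p \<and> (\<forall>Z\<in>vector_fields A. 2 * g p w (Z p) = koszul A g X Y Z p)"
      using w(1) by blast
    from someI_ex[OF this] show ?thesis using p by (simp add: lc_def)
  qed
  then show "lc X Y p \<in> tangent_space A p" by (cases "p \<in> points A") (auto simp: lc_def tangent_zero)
  show "p \<in> points A \<Longrightarrow> Z \<in> vector_fields A \<Longrightarrow> 2 * g p (lc X Y p) (Z p) = koszul A g X Y Z p" using * by blast
qed

lemma lc_chart:
  assumes "X \<in> vector_fields A" "Y \<in> vector_fields A" "c \<in> charts_at A p"
  shows "2 * brep A c g (coord c p) (lc X Y p c) v =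
    2 * brep A c g (coord c p) (fderiv (vrep c Y) (coord c p) (X p c)) v + christoffel c (coord c p) (X p c) (Y p c) v"
  by (rule koszul_solution_chart[OF assms lc_koszul(1)[OF assms(1,2)]])
    (rule lc_koszul(2)[OF assms(1,2) charts_at_points[OF assms(3)]])

lemma smooth_brep_deriv_comp:
  assumes c: "c \<in> A" and "smooth_on P (chart_img c)" "smooth_on Q (chart_img c)" "smooth_on R (chart_img c)"
  shows "smooth_on (\<lambda>x. brep_deriv c g x (P x) (Q x) (R x)) (chart_img c)"
proof -
  note S = open_chart_img[OF c] and D = linear_brep_deriv[OF g c]
  have 1: "smooth_on (\<lambda>x. brep_deriv c g x v u w) (chart_img c)" for u v w
    unfolding brep_deriv_def by (rule smooth_on_fderiv[OF smooth_brep[OF g c]])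
  have 2: "smooth_on (\<lambda>x. brep_deriv c g x (P x) u w) (chart_img c)" for u w
    by (rule smooth_on_linear_family[where L = "\<lambda>x v. brep_deriv c g x v u w", OF S D(1) 1 assms(2)])
  have 3: "smooth_on (\<lambda>x. brep_deriv c g x (P x) (Q x) w) (chart_img c)" for w
    by (rule smooth_on_linear_family[where L = "\<lambda>x u. brep_deriv c g x (P x) u w", OF S D(2) 2 assms(3)])
  show ?thesis
    by (rule smooth_on_linear_family[where L = "\<lambda>x w. brep_deriv c g x (P x) (Q x) w", OF S D(3) 3 assms(4)])
qed

lemma lc_vf:
  assumes X: "X \<in> vector_fields A" and Y: "Y \<in> vector_fields A"
  shows "lc X Y \<in> vector_fields A"
proof (rule vfI[OF lc_koszul(1)[OF X Y]])
  fix c assume c: "c \<in> A"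
  note S = open_chart_img[OF c]
  \<comment> \<open>Half of the Koszul expression with third argument \<open>b\<close>. These
    numbers form the right-hand side of the linear system for the components of
    \<open>lc X Y\<close>.\<close>
  define k where "k x b = brep A c g x (fderiv (vrep c Y) x (vrep c X x)) b
    + (1/2) * (brep_deriv c g x (vrep c X x) (vrep c Y x) b + brep_deriv c g x (vrep c Y x) (vrep c X x) b
      - brep_deriv c g x b (vrep c X x) (vrep c Y x))" for x b
  show "smooth_on (vrep c (lc X Y)) (chart_img c)"
  proof (rule smooth_on_linear_solve[where G = "lower c" and rhs = "\<lambda>x. \<Sum>b\<in>Basis. k x b *\<^sub>R b",
        OF S linear_lower[OF c] inj_lower[OF c] smooth_lower[OF c]])
    have 1: "smooth_on (\<lambda>x. fderiv (vrep c Y) x (vrep c X x)) (chart_img c)"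
      by (rule smooth_on_linear_family[OF S smooth_on_linear_fderiv[OF vf_smooth[OF Y c] S]
          smooth_on_fderiv[OF vf_smooth[OF Y c]] vf_smooth[OF X c]])
    have 2: "smooth_on (\<lambda>x. k x b) (chart_img c)" for b
      unfolding k_def
      by (rule smooth_on_add[OF S smooth_brep_comp[OF g c S smooth_on_id[OF S] _ 1 smooth_on_const]
            smooth_on_mult[OF S smooth_on_const smooth_on_diff[OF S smooth_on_add[OF S
            smooth_brep_deriv_comp[OF c vf_smooth[OF X c] vf_smooth[OF Y c] smooth_on_const]
            smooth_brep_deriv_comp[OF c vf_smooth[OF Y c] vf_smooth[OF X c] smooth_on_const]]
            smooth_brep_deriv_comp[OF c smooth_on_const vf_smooth[OF X c] vf_smooth[OF Y c]]]]])
    show "smooth_on (\<lambda>x. \<Sum>b\<in>Basis. k x b *\<^sub>R b) (chart_img c)"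
      by (intro smooth_on_sum[OF S] smooth_on_scaleR[OF S] smooth_on_const 2)
    fix x assume x: "x \<in> chart_img c"
    note cx = coord_inv_charts_at[OF c x]
    have "brep A c g x (vrep c (lc X Y) x) b = k x b" for b
      using lc_chart[OF X Y cx, of b] coord_coord_inv[OF x]
      by (simp add: k_def christoffel_def vrep_def field_simps)
    then show "lower c x (vrep c (lc X Y) x) = (\<Sum>b\<in>Basis. k x b *\<^sub>R b)" by (simp add: lower_def)
  qed
qed

lemma tangent_eq_brepI:
  assumes "c \<in> charts_at A p" "u \<in> tangent_space A p" "v \<in> tangent_space A p"
    "\<And>w. 2 * brep A c g (coord c p) (u c) w = 2 * brep A c g (coord c p) (v c) w"
  shows "u = v"
  by (rule tangent_eqI[OF assms(2,3,1)], rule brep_cancel[OF charts_atD(1)[OF assms(1)] coord_in_img[OF assms(1)]])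
    (use assms(4) in simp)

lemma christoffel_linear:
  assumes c: "c \<in> A" and x: "x \<in> chart_img c"
  shows "christoffel c x (u + u') v w = christoffel c x u v w + christoffel c x u' v w"
    "christoffel c x u (v + v') w = christoffel c x u v w + christoffel c x u v' w"
    "christoffel c x (r *\<^sub>R u) v w = r * christoffel c x u v w"
    "christoffel c x u (r *\<^sub>R v) w = r * christoffel c x u v w"
  unfolding christoffel_def
  using linear_brep_deriv[OF g c x, THEN linear_add] linear_brep_deriv[OF g c x, THEN linear_cmul]
  by (simp_all add: algebra_simps)

lemma fderiv_vrep_add:
  assumes "Y \<in> vector_fields A" "Y' \<in> vector_fields A" "c \<in> charts_at A p"
  shows "fderiv (vrep c (Y + Y')) (coord c p) v = fderiv (vrep c Y) (coord c p) v + fderiv (vrep c Y') (coord c p) v"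
proof -
  note cA = charts_atD(1)[OF assms(3)] and x = coord_in_img[OF assms(3)]
  have "vrep c (Y + Y') = (\<lambda>x. vrep c Y x + vrep c Y' x)" by (simp add: vrep_def fun_eq_iff)
  then show ?thesis
    using fderiv_eq[OF has_derivative_add[OF smooth_on_has_derivative[OF vf_smooth[OF assms(1) cA] open_chart_img[OF cA] x]
          smooth_on_has_derivative[OF vf_smooth[OF assms(2) cA] open_chart_img[OF cA] x]]] by simp
qed

lemma fderiv_vrep_fun_scale:
  assumes X: "X \<in> vector_fields A" and Y: "Y \<in> vector_fields A" and f: "smooth_fun A f" and c: "c \<in> charts_at A p"
  shows "fderiv (vrep c (fun_scale f Y)) (coord c p) (X p c) =
    vf_deriv A X f p *\<^sub>R Y p c + f p *\<^sub>R fderiv (vrep c Y) (coord c p) (X p c)"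
proof -
  note cA = charts_atD(1)[OF c] and x = coord_in_img[OF c]
  have "vrep c (fun_scale f Y) = (\<lambda>x. (f \<circ> coord_inv c) x *\<^sub>R vrep c Y x)"
    by (simp add: vrep_def fun_eq_iff fun_scale_def scaleR_fun_def)
  then show ?thesis
    using fderiv_eq[OF has_derivative_scaleR[OF smooth_fun_chart[OF f c]
          smooth_on_has_derivative[OF vf_smooth[OF Y cA] open_chart_img[OF cA] x]]]
      vf_deriv_chart[OF c X smooth_fun_chart[OF f c]] coord_inv_coord[OF cA charts_atD(2)[OF c]]
    by (simp add: vrep_coord[OF c])
qed

lemma connection_eqI:
  assumes "U \<in> vector_fields A" "V \<in> vector_fields A"
    "\<And>p c w. c \<in> charts_at A p \<Longrightarrow> 2 * brep A c g (coord c p) (U p c) w = 2 * brep A c g (coord c p) (V p c) w"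
  shows "U = V"
proof
  fix p show "U p = V p"
  proof (cases "p \<in> points A")
    case True
    then obtain c where c: "c \<in> charts_at A p" by (rule chart_atE)
    show ?thesis by (rule tangent_eq_brepI[OF c vf_tangent[OF assms(1)] vf_tangent[OF assms(2)] assms(3)[OF c]])
  next
    case False
    then show ?thesis using vf_outside assms(1,2) by simp
  qed
qed

text \<open>Each axiom is tested by products with arbitrary vectors in a chart, where
  \<open>lc_chart\<close> reduces it to linearity and symmetry of the derivatives of
  \<open>g\<close>.\<close>

lemma lc_is_levi_civita: "is_levi_civita A g lc"
  unfolding is_levi_civita_def affine_connection_def
proof (intro conjI ballI allI impI)
  fix X Y assume X: "X \<in> vector_fields A" and Y: "Y \<in> vector_fields A"
  show "lc X Y \<in> vector_fields A" by (rule lc_vf[OF X Y])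
  show "lc X Y - lc Y X = lie_bracket A X Y"
  proof (rule connection_eqI[OF vf_diff[OF lc_vf[OF X Y] lc_vf[OF Y X]] vf_lie_bracket[OF X Y]])
    fix p c w assume c: "c \<in> charts_at A p"
    note cA = charts_atD(1)[OF c] and x = coord_in_img[OF c]
    show "2 * brep A c g (coord c p) ((lc X Y - lc Y X) p c) w = 2 * brep A c g (coord c p) (lie_bracket A X Y p c) w"
      using lc_chart[OF X Y c, of w] lc_chart[OF Y X c, of w] brep_deriv_sym[OF cA x]
      by (simp add: lie_bracket_chart[OF c] linear_diff[OF linear_brep(2)[OF g cA x]] christoffel_def)
  qed
  {
    fix Z assume Z: "Z \<in> vector_fields A"
    show "lc (X + Y) Z = lc X Z + lc Y Z"
    proof (rule connection_eqI[OF lc_vf[OF vf_add[OF X Y] Z] vf_add[OF lc_vf[OF X Z] lc_vf[OF Y Z]]])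
      fix p c w assume c: "c \<in> charts_at A p"
      note cA = charts_atD(1)[OF c] and x = coord_in_img[OF c]
      have lin: "linear (fderiv (vrep c Z) (coord c p))"
        by (rule smooth_on_linear_fderiv[OF vf_smooth[OF Z cA] open_chart_img[OF cA] x])
      show "2 * brep A c g (coord c p) (lc (X + Y) Z p c) w = 2 * brep A c g (coord c p) ((lc X Z + lc Y Z) p c) w"
        using lc_chart[OF vf_add[OF X Y] Z c, of w] lc_chart[OF X Z c, of w] lc_chart[OF Y Z c, of w]
        by (simp add: linear_add[OF linear_brep(2)[OF g cA x]] linear_add[OF lin] christoffel_linear[OF cA x])
    qed
    show "lc X (Y + Z) = lc X Y + lc X Z"
    proof (rule connection_eqI[OF lc_vf[OF X vf_add[OF Y Z]] vf_add[OF lc_vf[OF X Y] lc_vf[OF X Z]]])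
      fix p c w assume c: "c \<in> charts_at A p"
      note cA = charts_atD(1)[OF c] and x = coord_in_img[OF c]
      show "2 * brep A c g (coord c p) (lc X (Y + Z) p c) w = 2 * brep A c g (coord c p) ((lc X Y + lc X Z) p c) w"
        using lc_chart[OF X vf_add[OF Y Z] c, of w] lc_chart[OF X Z c, of w] lc_chart[OF X Y c, of w]
        by (simp add: linear_add[OF linear_brep(2)[OF g cA x]] fderiv_vrep_add[OF Y Z c] christoffel_linear[OF cA x])
    qed
    fix p assume p: "p \<in> points A"
    then obtain c where c: "c \<in> charts_at A p" by (rule chart_atE)
    note cA = charts_atD(1)[OF c] and x = coord_in_img[OF c]
    note t = vf_tangent[OF lc_vf[OF X Y]] vf_tangent[OF lc_vf[OF X Z]] vf_tangent[OF Y] vf_tangent[OF Z]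
    show "vf_deriv A X (\<lambda>q. g q (Y q) (Z q)) p = g p (lc X Y p) (Z p) + g p (Y p) (lc X Z p)"
      using lc_chart[OF X Y c, of "Z p c"] lc_chart[OF X Z c, of "Y p c"] vf_deriv_form2[OF g X Y Z c]
        brep_sym[OF cA x] brep_deriv_sym[OF cA x]
        brep_coord[OF c t(1,4), of g] brep_coord[OF c t(3,2), of g]
      by (simp add: christoffel_def)
  }
next
  fix f X Y assume f: "smooth_fun A f" and X: "X \<in> vector_fields A" and Y: "Y \<in> vector_fields A"
  show "lc (fun_scale f X) Y = fun_scale f (lc X Y)"
  proof (rule connection_eqI[OF lc_vf[OF vf_fun_scale[OF f X] Y] vf_fun_scale[OF f lc_vf[OF X Y]]])
    fix p c w assume c: "c \<in> charts_at A p"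
    note cA = charts_atD(1)[OF c] and x = coord_in_img[OF c]
    have lin: "linear (fderiv (vrep c Y) (coord c p))"
      by (rule smooth_on_linear_fderiv[OF vf_smooth[OF Y cA] open_chart_img[OF cA] x])
    show "2 * brep A c g (coord c p) (lc (fun_scale f X) Y p c) w = 2 * brep A c g (coord c p) (fun_scale f (lc X Y) p c) w"
      using lc_chart[OF vf_fun_scale[OF f X] Y c, of w] lc_chart[OF X Y c, of w]
      by (simp add: fun_scale_apply linear_cmul[OF linear_brep(2)[OF g cA x]] linear_cmul[OF lin]
          christoffel_linear[OF cA x] algebra_simps)
  qed
  show "lc X (fun_scale f Y) = fun_scale (vf_deriv A X f) Y + fun_scale f (lc X Y)"
  proof
    \<comment> \<open>Compared point by point, because \<open>connection_eqI\<close> asks for smooth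
      fields, whereas the term with \<open>vf_deriv A X f\<close> is only shown to be tangent at
      each point.\<close>
    fix p show "lc X (fun_scale f Y) p = (fun_scale (vf_deriv A X f) Y + fun_scale f (lc X Y)) p"
    proof (cases "p \<in> points A")
      case True
      then obtain c where c: "c \<in> charts_at A p" by (rule chart_atE)
      note cA = charts_atD(1)[OF c] and x = coord_in_img[OF c]
      have t: "(fun_scale (vf_deriv A X f) Y + fun_scale f (lc X Y)) p \<in> tangent_space A p"
        using tangent_add[OF tangent_scaleR[OF vf_tangent[OF Y, of p]] tangent_scaleR[OF vf_tangent[OF lc_vf[OF X Y], of p]]]
        by (simp add: fun_scale_def)
      show ?thesis
      proof (rule tangent_eq_brepI[OF c vf_tangent[OF lc_vf[OF X vf_fun_scale[OF f Y]]] t])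
        fix w
        show "2 * brep A c g (coord c p) (lc X (fun_scale f Y) p c) w
            = 2 * brep A c g (coord c p) ((fun_scale (vf_deriv A X f) Y + fun_scale f (lc X Y)) p c) w"
          using lc_chart[OF X vf_fun_scale[OF f Y] c, of w] lc_chart[OF X Y c, of w]
          by (simp add: fderiv_vrep_fun_scale[OF X Y f c] fun_scale_apply
              linear_add[OF linear_brep(2)[OF g cA x]] linear_cmul[OF linear_brep(2)[OF g cA x]]
              christoffel_linear[OF cA x] algebra_simps)
      qed
    next
      case False
      then show ?thesis using vf_outside[OF Y] by (simp add: lc_def fun_scale_def)
    qed
  qed
qed

lemma levi_civita: "is_levi_civita A g (levi_civita A g)"
  unfolding levi_civita_def by (rule someI[of _ lc], rule lc_is_levi_civita)

end

lemma endo_app_apply: "endo_app \<phi> X p = \<phi> p (X p)"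
  by (simp add: endo_app_def)

context hausdorff_mfd
begin

lemma vf_deriv_uminus:
  assumes X: "X \<in> vector_fields A" and p: "p \<in> points A" and F: "smooth_fun A F"
    and G: "\<And>q. q \<in> points A \<Longrightarrow> G q = - F q"
  shows "vf_deriv A X G p = - vf_deriv A X F p"
proof -
  obtain c where c: "c \<in> charts_at A p" using p by (rule chart_atE)
  note D = smooth_fun_chart[OF F c]
  have "((\<lambda>q. - F q) \<circ> coord_inv c has_derivative (\<lambda>v. - fderiv (F \<circ> coord_inv c) (coord c p) v)) (at (coord c p))"
    using has_derivative_minus[OF D] by (simp add: o_def)
  from vf_deriv_chart[OF c X this] vf_deriv_chart[OF c X D]
  have "vf_deriv A X (\<lambda>q. - F q) p = - vf_deriv A X F p" by simp
  then show ?thesis unfolding vf_deriv_def using dir_deriv_cong[OF p, of G "\<lambda>q. - F q"] G by simp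
qed

lemma vf_deriv_const:
  assumes X: "X \<in> vector_fields A" and p: "p \<in> points A" and G: "\<And>q. q \<in> points A \<Longrightarrow> G q = k"
  shows "vf_deriv A X G p = 0"
proof -
  obtain c where c: "c \<in> charts_at A p" using p by (rule chart_atE)
  have "((\<lambda>q. k) \<circ> coord_inv c has_derivative (\<lambda>v. 0)) (at (coord c p))"
    by (simp add: o_def)
  from vf_deriv_chart[OF c X this] have "vf_deriv A X (\<lambda>q. k) p = 0" .
  then show ?thesis unfolding vf_deriv_def using dir_deriv_cong[OF p, of G "\<lambda>q. k"] G by simp
qed

lemma vf_deriv_cong:
  "p \<in> points A \<Longrightarrow> (\<And>q. q \<in> points A \<Longrightarrow> F q = G q) \<Longrightarrow> vf_deriv A X F p = vf_deriv A X G p"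
  unfolding vf_deriv_def by (rule dir_deriv_cong)

lemma vf_zero: "0 \<in> vector_fields A"
  by (rule vfI) (simp_all add: tangent_zero vrep_def[abs_def] smooth_on_const)

end

section \<open>Consequences of the Levi-Civita axioms\<close>

locale lc_mfd = metric_mfd A g for A :: "('p, 'e::euclidean_space) atlas" and g :: "('p, 'e) form2" +
  fixes nabla :: "('p, 'e) connection"
  assumes nabla: "is_levi_civita A g nabla"
begin

lemma nabla_vf: "X \<in> vector_fields A \<Longrightarrow> Y \<in> vector_fields A \<Longrightarrow> nabla X Y \<in> vector_fields A"
  using nabla unfolding is_levi_civita_def affine_connection_def by simp

lemma nabla_add:
  "X \<in> vector_fields A \<Longrightarrow> X' \<in> vector_fields A \<Longrightarrow> Y \<in> vector_fields A \<Longrightarrow>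
    nabla (X + X') Y = nabla X Y + nabla X' Y"
  "X \<in> vector_fields A \<Longrightarrow> Y \<in> vector_fields A \<Longrightarrow> Y' \<in> vector_fields A \<Longrightarrow>
    nabla X (Y + Y') = nabla X Y + nabla X Y'"
  using nabla unfolding is_levi_civita_def affine_connection_def by simp_all

lemma nabla_scale:
  assumes "smooth_fun A f" "X \<in> vector_fields A" "Y \<in> vector_fields A"
  shows "nabla (fun_scale f X) Y p = f p *\<^sub>R nabla X Y p"
    "nabla X (fun_scale f Y) p = vf_deriv A X f p *\<^sub>R Y p + f p *\<^sub>R nabla X Y p"
  using nabla assms unfolding is_levi_civita_def affine_connection_def by (simp_all add: fun_scale_def)

lemma nabla_diff:
  assumes "X \<in> vector_fields A" "X' \<in> vector_fields A" "Y \<in> vector_fields A"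
  shows "nabla (X - X') Y = nabla X Y - nabla X' Y" "nabla Y (X - X') = nabla Y X - nabla Y X'"
proof -
  have "nabla ((X - X') + X') Y = nabla (X - X') Y + nabla X' Y"
    by (rule nabla_add[OF vf_diff[OF assms(1,2)] assms(2,3)])
  then show "nabla (X - X') Y = nabla X Y - nabla X' Y" by (simp add: algebra_simps)
  have "nabla Y ((X - X') + X') = nabla Y (X - X') + nabla Y X'"
    by (rule nabla_add(2)[OF assms(3) vf_diff[OF assms(1,2)] assms(2)])
  then show "nabla Y (X - X') = nabla Y X - nabla Y X'" by (simp add: algebra_simps)
qed

lemma nabla_zero: "X \<in> vector_fields A \<Longrightarrow> nabla X 0 = 0"
  using nabla_diff(2)[OF vf_zero vf_zero, of X] by simp

lemma nabla_torsion:
  assumes "X \<in> vector_fields A" "Y \<in> vector_fields A"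
  shows "lie_bracket A X Y p = nabla X Y p - nabla Y X p"
proof -
  have "nabla X Y - nabla Y X = lie_bracket A X Y"
    using nabla assms unfolding is_levi_civita_def by simp
  from fun_cong[OF this, of p] show ?thesis by simp
qed

lemma nabla_metric:
  "X \<in> vector_fields A \<Longrightarrow> Y \<in> vector_fields A \<Longrightarrow> Z \<in> vector_fields A \<Longrightarrow> p \<in> points A \<Longrightarrow>
    vf_deriv A X (\<lambda>q. g q (Y q) (Z q)) p = g p (nabla X Y p) (Z p) + g p (Y p) (nabla X Z p)"
  using nabla unfolding is_levi_civita_def by simp

lemmas g_diff = bilinear_field_diff[OF g]

text \<open>Metric compatibility and vanishing torsion cancel all products but one: the uniqueness
  half of the fundamental theorem of pseudo-Riemannian geometry.\<close>

lemma nabla_koszul: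
  assumes X: "X \<in> vector_fields A" and Y: "Y \<in> vector_fields A" and Z: "Z \<in> vector_fields A" and p: "p \<in> points A"
  shows "2 * g p (nabla X Y p) (Z p) = koszul A g X Y Z p"
proof -
  note t = vf_tangent[OF X, of p] vf_tangent[OF Y, of p] vf_tangent[OF Z, of p]
  note n = nabla_vf[THEN vf_tangent, of _ _ p]
  show ?thesis
    unfolding koszul_def nabla_metric[OF X Y Z p] nabla_metric[OF Y X Z p] nabla_metric[OF Z X Y p]
      nabla_torsion[OF X Y] nabla_torsion[OF X Z] nabla_torsion[OF Y Z]
    using g_diff(1)[OF n[OF X Y] n[OF Y X] t(3)] g_diff(1)[OF n[OF X Z] n[OF Z X] t(2)]
      g_diff(1)[OF n[OF Y Z] n[OF Z Y] t(1)]
      g_sym[OF p n[OF X Z] t(2)] g_sym[OF p n[OF Y Z] t(1)] g_sym[OF p n[OF Z Y] t(1)] g_sym[OF p n[OF Z X] t(2)]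
    by simp
qed

text \<open>In the chart form of the Koszul expression only the value of \<open>X\<close> at the
  point enters.\<close>

lemma nabla_pointwise:
  assumes X: "X \<in> vector_fields A" and X': "X' \<in> vector_fields A" and Y: "Y \<in> vector_fields A"
    and p: "p \<in> points A" and eq: "X p = X' p"
  shows "nabla X Y p = nabla X' Y p"
proof -
  obtain c where c: "c \<in> charts_at A p" using p by (rule chart_atE)
  note n = vf_tangent[OF nabla_vf[OF X Y]] vf_tangent[OF nabla_vf[OF X' Y]]
  show ?thesis
    by (rule tangent_eq_brepI[OF c n])
      (use koszul_solution_chart[OF X Y c n(1) nabla_koszul[OF X Y _ p]]
        koszul_solution_chart[OF X' Y c n(2) nabla_koszul[OF X' Y _ p]] eq in simp)
qed

lemma tangent_eq_fieldI:
  assumes p: "p \<in> points A" and u: "u \<in> tangent_space A p" and v: "v \<in> tangent_space A p"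
    and eq: "\<And>Z. Z \<in> vector_fields A \<Longrightarrow> g p u (Z p) = g p v (Z p)"
  shows "u = v"
proof -
  have "u - v = 0"
  proof (rule g_nondeg[OF p tangent_diff[OF u v]])
    fix w assume w: "w \<in> tangent_space A p"
    then obtain Z where Z: "Z \<in> vector_fields A" "Z p = w" by (rule extend_tangent) (rule that)
    show "g p (u - v) w = 0" using eq[OF Z(1)] g_diff(1)[OF u v w] Z(2) by simp
  qed
  then show ?thesis by simp
qed

end

section \<open>Covariant derivative of a skew-adjoint endomorphism field\<close>

text \<open>Covers \<phi> on \<open>M\<close> as well as J on a leaf, so that skewness and
  tensoriality of the covariant derivative need only one proof.\<close>

locale skew_endo_mfd = lc_mfd A g nabla
  for A :: "('p, 'e::euclidean_space) atlas" and g :: "('p, 'e) form2" and nabla :: "('p, 'e) connection" +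
  fixes J :: "('p, 'e) endo"
  assumes J: "endo_field A J"
    and J_skew: "\<And>p u v. p \<in> points A \<Longrightarrow> u \<in> tangent_space A p \<Longrightarrow> v \<in> tangent_space A p \<Longrightarrow>
      g p (J p u) v = - g p u (J p v)"
begin

abbreviation "DJ \<equiv> cov_deriv_endo nabla J"

lemma J_vf: "X \<in> vector_fields A \<Longrightarrow> endo_app J X \<in> vector_fields A"
  by (rule endo_fieldD(4)[OF J])

lemma J_tangent: "u \<in> tangent_space A p \<Longrightarrow> J p u \<in> tangent_space A p"
  by (rule endo_fieldD(3)[OF J])

lemma J_add: "u \<in> tangent_space A p \<Longrightarrow> v \<in> tangent_space A p \<Longrightarrow> J p (u + v) = J p u + J p v"
  by (rule endo_fieldD(1)[OF J])

lemma J_scale: "u \<in> tangent_space A p \<Longrightarrow> J p (r *\<^sub>R u) = r *\<^sub>R J p u"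
  by (rule endo_fieldD(2)[OF J])

lemma J_diff: "u \<in> tangent_space A p \<Longrightarrow> v \<in> tangent_space A p \<Longrightarrow> J p (u - v) = J p u - J p v"
  using J_add[OF tangent_diff[of u p v], of v] by (simp add: algebra_simps)

lemma DJ_apply: "DJ X Y p = nabla X (endo_app J Y) p - J p (nabla X Y p)"
  by (simp add: cov_deriv_endo_def endo_app_apply)

lemma DJ_vf: "X \<in> vector_fields A \<Longrightarrow> Y \<in> vector_fields A \<Longrightarrow> DJ X Y \<in> vector_fields A"
  unfolding cov_deriv_endo_def by (intro vf_diff nabla_vf J_vf)

lemma DJ_pair:
  assumes X: "X \<in> vector_fields A" and Y: "Y \<in> vector_fields A" and Z: "Z \<in> vector_fields A" and p: "p \<in> points A"
  shows "g p (DJ X Y p) (Z p) = g p (nabla X (endo_app J Y) p) (Z p) + g p (nabla X Y p) (J p (Z p))"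
  unfolding DJ_apply
  using g_diff(1)[OF vf_tangent[OF nabla_vf[OF X J_vf[OF Y]]] J_tangent[OF vf_tangent[OF nabla_vf[OF X Y]]] vf_tangent[OF Z], of p]
    J_skew[OF p vf_tangent[OF nabla_vf[OF X Y]] vf_tangent[OF Z]] by simp

text \<open>Differentiate the skewness relation \<open>g (Y, J Z) = - g (J Y, Z)\<close> along
  \<open>X\<close>.\<close>

lemma DJ_skew:
  assumes X: "X \<in> vector_fields A" and Y: "Y \<in> vector_fields A" and Z: "Z \<in> vector_fields A" and p: "p \<in> points A"
  shows "g p (DJ X Y p) (Z p) = - g p (Y p) (DJ X Z p)"
proof -
  note JY = J_vf[OF Y] and JZ = J_vf[OF Z]
  have "vf_deriv A X (\<lambda>q. g q (Y q) (endo_app J Z q)) p = - vf_deriv A X (\<lambda>q. g q (endo_app J Y q) (Z q)) p"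
    by (rule vf_deriv_uminus[OF X p bilinear_field_smooth[OF g JY Z]])
      (use J_skew vf_tangent[OF Y] vf_tangent[OF Z] in \<open>simp add: endo_app_apply\<close>)
  then have "g p (nabla X Y p) (endo_app J Z p) + g p (Y p) (nabla X (endo_app J Z) p)
      = - (g p (nabla X (endo_app J Y) p) (Z p) + g p (endo_app J Y p) (nabla X Z p))"
    by (simp add: nabla_metric[OF X Y JZ p] nabla_metric[OF X JY Z p])
  moreover have "g p (Y p) (DJ X Z p) = g p (Y p) (nabla X (endo_app J Z) p) - g p (Y p) (J p (nabla X Z p))"
    unfolding DJ_apply
    by (rule g_diff(2)[OF vf_tangent[OF nabla_vf[OF X JZ]] J_tangent[OF vf_tangent[OF nabla_vf[OF X Z]]] vf_tangent[OF Y]])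
  moreover have "g p (J p (Y p)) (nabla X Z p) = - g p (Y p) (J p (nabla X Z p))"
    by (rule J_skew[OF p vf_tangent[OF Y] vf_tangent[OF nabla_vf[OF X Z]]])
  ultimately show ?thesis using DJ_pair[OF X Y Z p] by (simp add: endo_app_apply)
qed

text \<open>Tensoriality in \<open>Y\<close> is a consequence of skewness: \<open>DJ_skew\<close>
  moves the derivative onto the test field and leaves only the value of \<open>Y\<close> at the
  point.\<close>

lemma DJ_pointwise:
  assumes X: "X \<in> vector_fields A" "X' \<in> vector_fields A" and Y: "Y \<in> vector_fields A" "Y' \<in> vector_fields A"
    and p: "p \<in> points A" and eq: "X p = X' p" "Y p = Y' p"
  shows "DJ X Y p = DJ X' Y' p"
proof -
  have "DJ X Y p = DJ X' Y p"
    unfolding DJ_apply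
    using nabla_pointwise[OF X Y(1) p eq(1)] nabla_pointwise[OF X J_vf[OF Y(1)] p eq(1)] by simp
  also have "\<dots> = DJ X' Y' p"
  proof (rule tangent_eq_fieldI[OF p vf_tangent[OF DJ_vf[OF X(2) Y(1)]] vf_tangent[OF DJ_vf[OF X(2) Y(2)]]])
    fix Z assume Z: "Z \<in> vector_fields A"
    show "g p (DJ X' Y p) (Z p) = g p (DJ X' Y' p) (Z p)"
      using DJ_skew[OF X(2) Y(1) Z p] DJ_skew[OF X(2) Y(2) Z p] eq(2) by simp
  qed
  finally show ?thesis .
qed

end

section \<open>The structure equations of an almost paracosymplectic manifold\<close>

text \<open>Skewness, \<open>phi_xi\<close>, \<open>eta_phi\<close> and \<open>g_xi\<close> are
  consequences of the axioms of the structure; they are derived when the locale is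
  instantiated.\<close>

locale paracosymplectic_mfd = skew_endo_mfd A g nabla \<phi>
  for A :: "('p, 'e::euclidean_space) atlas" and g :: "('p, 'e) form2" and nabla :: "('p, 'e) connection"
    and \<phi> :: "('p, 'e) endo" +
  fixes \<xi> :: "('p, 'e) vfield" and \<eta> :: "('p, 'e) form1" and \<alpha> :: "'p \<Rightarrow> real"
  assumes \<xi>: "\<xi> \<in> vector_fields A" and \<eta>: "one_form A \<eta>"
    and eta_xi: "\<And>p. p \<in> points A \<Longrightarrow> \<eta> p (\<xi> p) = 1"
    and phi2: "\<And>p u. p \<in> points A \<Longrightarrow> u \<in> tangent_space A p \<Longrightarrow> \<phi> p (\<phi> p u) = u - \<eta> p u *\<^sub>R \<xi> p"
    and phi_xi: "\<And>p. p \<in> points A \<Longrightarrow> \<phi> p (\<xi> p) = 0"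
    and eta_phi: "\<And>p u. p \<in> points A \<Longrightarrow> u \<in> tangent_space A p \<Longrightarrow> \<eta> p (\<phi> p u) = 0"
    and g_xi: "\<And>p u. p \<in> points A \<Longrightarrow> u \<in> tangent_space A p \<Longrightarrow> g p u (\<xi> p) = \<eta> p u"
    and d_eta: "\<And>X Y p. X \<in> vector_fields A \<Longrightarrow> Y \<in> vector_fields A \<Longrightarrow> p \<in> points A \<Longrightarrow> ext_deriv1 A \<eta> X Y p = 0"
    and d_Phi: "\<And>X Y Z p. X \<in> vector_fields A \<Longrightarrow> Y \<in> vector_fields A \<Longrightarrow> Z \<in> vector_fields A \<Longrightarrow> p \<in> points A \<Longrightarrow>
      ext_deriv2 A (fundamental_form \<phi> g) X Y Z p = 2 * \<alpha> p * wedge12 \<eta> (fundamental_form \<phi> g) X Y Z p"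
begin

abbreviation "S X \<equiv> nabla X \<xi>"

lemma S_vf: "X \<in> vector_fields A \<Longrightarrow> S X \<in> vector_fields A"
  by (rule nabla_vf[OF _ \<xi>])

lemma eta_vf_deriv:
  assumes X: "X \<in> vector_fields A" and Y: "Y \<in> vector_fields A" and p: "p \<in> points A"
  shows "vf_deriv A X (\<lambda>q. \<eta> q (Y q)) p = \<eta> p (nabla X Y p) + g p (Y p) (S X p)"
proof -
  have "vf_deriv A X (\<lambda>q. \<eta> q (Y q)) p = vf_deriv A X (\<lambda>q. g q (Y q) (\<xi> q)) p"
    by (rule vf_deriv_cong[OF p]) (simp add: g_xi vf_tangent[OF Y])
  then show ?thesis
    by (simp add: nabla_metric[OF X Y \<xi> p] g_xi[OF p vf_tangent[OF nabla_vf[OF X Y]]])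
qed

text \<open>With the bracket written as \<open>nabla X Y - nabla Y X\<close>, closedness of \<eta>
  reads \<open>g (Y, S X) = g (X, S Y)\<close>.\<close>

lemma S_sym:
  assumes X: "X \<in> vector_fields A" and Y: "Y \<in> vector_fields A" and p: "p \<in> points A"
  shows "g p (S X p) (Y p) = g p (S Y p) (X p)"
proof -
  note n = vf_tangent[OF nabla_vf[OF X Y], of p] vf_tangent[OF nabla_vf[OF Y X], of p]
  have "\<eta> p (nabla X Y p - nabla Y X p) = \<eta> p (nabla X Y p) - \<eta> p (nabla Y X p)"
    using one_formD(1)[OF \<eta> tangent_diff[OF n] n(2)] by simp
  then have "g p (Y p) (S X p) = g p (X p) (S Y p)"
    using d_eta[OF X Y p] by (simp add: ext_deriv1_def eta_vf_deriv[OF X Y p] eta_vf_deriv[OF Y X p] nabla_torsion[OF X Y])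
  then show ?thesis
    using g_sym[OF p vf_tangent[OF Y] vf_tangent[OF S_vf[OF X]]] g_sym[OF p vf_tangent[OF X] vf_tangent[OF S_vf[OF Y]]] by simp
qed

text \<open>The function \<open>g (\<xi>, \<xi>) = 1\<close> has zero derivative.\<close>

lemma eta_S:
  assumes X: "X \<in> vector_fields A" and p: "p \<in> points A"
  shows "\<eta> p (S X p) = 0"
proof -
  have "vf_deriv A X (\<lambda>q. g q (\<xi> q) (\<xi> q)) p = 0"
    by (rule vf_deriv_const[OF X p, where k = 1]) (simp add: g_xi vf_tangent[OF \<xi>] eta_xi)
  then have "g p (S X p) (\<xi> p) = 0"
    using nabla_metric[OF X \<xi> \<xi> p] g_sym[OF p vf_tangent[OF \<xi>] vf_tangent[OF S_vf[OF X]]] by simp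
  then show ?thesis using g_xi[OF p vf_tangent[OF S_vf[OF X]]] by simp
qed

text \<open>Self-adjointness gives
  \<open>g (S \<xi>, Y) = g (S Y, \<xi>) = \<eta> (S Y) = 0\<close>.\<close>

lemma S_xi: "p \<in> points A \<Longrightarrow> S \<xi> p = 0"
  by (rule tangent_eq_fieldI[OF _ vf_tangent[OF S_vf[OF \<xi>]] tangent_zero])
    (simp_all add: S_sym[OF \<xi>] g_xi vf_tangent S_vf eta_S bilinear_fieldD(3)[OF g tangent_zero tangent_zero, of _ _ 0, simplified])

lemma phi_S_tangent: "X \<in> vector_fields A \<Longrightarrow> \<phi> p (S X p) \<in> tangent_space A p"
  by (intro J_tangent vf_tangent S_vf)

lemma DJ_xi:
  assumes X: "X \<in> vector_fields A"
  shows "DJ X \<xi> p = - \<phi> p (S X p)"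
proof -
  have "endo_app \<phi> \<xi> p = 0" for p
    by (cases "p \<in> points A") (auto simp: endo_app_apply phi_xi tangent_outside J_tangent[OF vf_tangent[OF \<xi>]])
  then have "endo_app \<phi> \<xi> = 0" by (simp add: fun_eq_iff)
  then show ?thesis using nabla_zero[OF X] by (simp add: DJ_apply)
qed

text \<open>The entries with \<xi> in the last two slots: one from \<open>\<phi> \<xi> = 0\<close>,
  the other from it by skewness.\<close>

lemma DJ_pair_xi:
  assumes X: "X \<in> vector_fields A" and Y: "Y \<in> vector_fields A" and p: "p \<in> points A"
  shows "g p (DJ X \<xi> p) (Y p) = - g p (\<phi> p (S X p)) (Y p)"
    "g p (DJ X Y p) (\<xi> p) = g p (\<phi> p (S X p)) (Y p)"
proof -
  note t = phi_S_tangent[OF X, of p] vf_tangent[OF Y, of p]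
  show 1: "g p (DJ X \<xi> p) (Y p) = - g p (\<phi> p (S X p)) (Y p)"
    unfolding DJ_xi[OF X] using bilinear_fieldD(3)[OF g t(1,1,2), of "-1"] by simp
  show "g p (DJ X Y p) (\<xi> p) = g p (\<phi> p (S X p)) (Y p)"
    using DJ_skew[OF X Y \<xi> p] 1 g_sym[OF p vf_tangent[OF Y] vf_tangent[OF DJ_vf[OF X \<xi>]]] by simp
qed

text \<open>For a metric torsion-free connection the derivatives and brackets in the invariant
  formula for d\<Phi> combine to a cyclic sum; skewness brings every term
  \<open>\<phi> (nabla U W)\<close> to the same side, where it cancels against a bracket or
  completes a covariant derivative.\<close>

lemma DJ_cyclic:
  assumes X: "X \<in> vector_fields A" and Y: "Y \<in> vector_fields A" and Z: "Z \<in> vector_fields A" and p: "p \<in> points A"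
  shows "g p (DJ X Y p) (Z p) + g p (DJ Y Z p) (X p) + g p (DJ Z X p) (Y p)
    = 2 * \<alpha> p * wedge12 \<eta> (fundamental_form \<phi> g) X Y Z p"
proof -
  have m: "vf_deriv A U (\<lambda>q. g q (\<phi> q (V q)) (W q)) p =
      g p (nabla U (endo_app \<phi> V) p) (W p) - g p (\<phi> p (nabla U W p)) (V p)"
    if "U \<in> vector_fields A" "V \<in> vector_fields A" "W \<in> vector_fields A" for U V W
    using nabla_metric[OF that(1) J_vf[OF that(2)] that(3) p]
      J_skew[OF p vf_tangent[OF that(2)] vf_tangent[OF nabla_vf[OF that(1,3)]]]
      g_sym[OF p vf_tangent[OF that(2)] J_tangent[OF vf_tangent[OF nabla_vf[OF that(1,3)]]]]
    by (simp add: endo_app_apply)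
  have b: "g p (\<phi> p (lie_bracket A U V p)) (W p) = g p (\<phi> p (nabla U V p)) (W p) - g p (\<phi> p (nabla V U p)) (W p)"
    if "U \<in> vector_fields A" "V \<in> vector_fields A" "W \<in> vector_fields A" for U V W
  proof -
    note n = vf_tangent[OF nabla_vf[OF that(1,2)], of p] vf_tangent[OF nabla_vf[OF that(2,1)], of p]
    show ?thesis
      unfolding nabla_torsion[OF that(1,2)] J_diff[OF n]
      by (rule g_diff(1)[OF J_tangent[OF n(1)] J_tangent[OF n(2)] vf_tangent[OF that(3)]])
  qed
  have d: "g p (DJ U V p) (W p) = g p (nabla U (endo_app \<phi> V) p) (W p) - g p (\<phi> p (nabla U V p)) (W p)"
    if "U \<in> vector_fields A" "V \<in> vector_fields A" "W \<in> vector_fields A" for U V W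
    unfolding DJ_apply
    by (rule g_diff(1)[OF vf_tangent[OF nabla_vf[OF that(1) J_vf[OF that(2)]]]
          J_tangent[OF vf_tangent[OF nabla_vf[OF that(1,2)]]] vf_tangent[OF that(3)]])
  have "g p (DJ X Y p) (Z p) + g p (DJ Y Z p) (X p) + g p (DJ Z X p) (Y p) = ext_deriv2 A (fundamental_form \<phi> g) X Y Z p"
    unfolding ext_deriv2_def fundamental_form_def
      m[OF X Y Z] m[OF Y Z X] m[OF Z X Y] b[OF X Y Z] b[OF Y Z X] b[OF Z X Y] d[OF X Y Z] d[OF Y Z X] d[OF Z X Y]
    by simp
  then show ?thesis by (simp add: d_Phi[OF X Y Z p])
qed

section \<open>Vanishing of the derivative of \<phi> along \<xi>\<close>

text \<open>The value of \<open>\<nabla>\<^sub>\<xi> \<phi>\<close> forced by the equation for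
  d\<Phi>, kept apart so that its behaviour under \<phi> can be compared with that of
  \<open>DJ \<xi>\<close>.\<close>

definition xi_defect :: "('p, 'e) vfield \<Rightarrow> 'p \<Rightarrow> ('p, 'e) tangent" where
  "xi_defect Y p = (2 * \<alpha> p) *\<^sub>R \<phi> p (Y p) - \<phi> p (S Y p) - S (endo_app \<phi> Y) p"

text \<open>Insert \<xi> as first argument of the cyclic identity. The other two summands have \<xi>
  in one of the last two slots and are known; the wedge product reduces to \<Phi>(Y, Z).\<close>

lemma DJ_along_xi:
  assumes Y: "Y \<in> vector_fields A" and p: "p \<in> points A"
  shows "DJ \<xi> Y p = xi_defect Y p"
proof -
  note t = tangent_scaleR[OF J_tangent[OF vf_tangent[OF Y]], of "2 * \<alpha> p" p] phi_S_tangent[OF Y, of p]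
    vf_tangent[OF S_vf[OF J_vf[OF Y]], of p]
  have "xi_defect Y p \<in> tangent_space A p"
    unfolding xi_defect_def by (intro tangent_diff t)
  then show ?thesis
  proof (rule tangent_eq_fieldI[OF p vf_tangent[OF DJ_vf[OF \<xi> Y]]])
    fix Z assume Z: "Z \<in> vector_fields A"
    note z = vf_tangent[OF Z, of p] and y = vf_tangent[OF Y, of p]
    have "g p (\<phi> p (S Z p)) (Y p) = - g p (S (endo_app \<phi> Y) p) (Z p)"
      using J_skew[OF p vf_tangent[OF S_vf[OF Z]] y] S_sym[OF Z J_vf[OF Y] p] by (simp add: endo_app_apply)
    moreover have "wedge12 \<eta> (fundamental_form \<phi> g) \<xi> Y Z p = g p (\<phi> p (Y p)) (Z p)"
    proof -
      have "g p 0 (Y p) = 0" using bilinear_fieldD(3)[OF g y y y, of 0] by simp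
      then show ?thesis
        by (simp add: wedge12_def fundamental_form_def eta_xi[OF p] phi_xi[OF p] g_xi[OF p J_tangent[OF z]] eta_phi[OF p z])
    qed
    moreover have "g p (xi_defect Y p) (Z p) = 2 * \<alpha> p * g p (\<phi> p (Y p)) (Z p) - g p (\<phi> p (S Y p)) (Z p)
        - g p (S (endo_app \<phi> Y) p) (Z p)"
      unfolding xi_defect_def
      by (simp add: g_diff(1)[OF tangent_diff[OF t(1,2)] t(3) z] g_diff(1)[OF t(1,2) z]
          bilinear_fieldD(3)[OF g J_tangent[OF y] J_tangent[OF y] z])
    ultimately show "g p (DJ \<xi> Y p) (Z p) = g p (xi_defect Y p) (Z p)"
      using DJ_cyclic[OF \<xi> Y Z p] DJ_pair_xi(2)[OF Y Z p] DJ_pair_xi(1)[OF Z Y p] by simp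
  qed
qed

text \<open>An equality of fields, not only of values on the manifold, so that it can be rewritten
  under \<open>nabla\<close>; off the manifold both sides are zero.\<close>

lemma phi2_field:
  assumes Y: "Y \<in> vector_fields A"
  shows "endo_app \<phi> (endo_app \<phi> Y) = Y - fun_scale (\<lambda>p. \<eta> p (Y p)) \<xi>"
proof
  fix p show "endo_app \<phi> (endo_app \<phi> Y) p = (Y - fun_scale (\<lambda>p. \<eta> p (Y p)) \<xi>) p"
  proof (cases "p \<in> points A")
    case True
    then show ?thesis by (simp add: endo_app_apply phi2 vf_tangent[OF Y] fun_scale_def fun_eq_iff)
  next
    case False
    then show ?thesis using vf_outside[OF J_vf[OF J_vf[OF Y]]] vf_outside[OF Y] vf_outside[OF \<xi>] by (simp add: fun_scale_def)
  qed
qed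

text \<open>Differentiate \<open>\<phi>\<^sup>2 = Id - \<eta> \<otimes> \<xi>\<close> along \<xi>:
  as \<open>S \<xi> = 0\<close>, neither \<eta> nor \<xi> contributes a derivative.\<close>

lemma DJ_anticommute:
  assumes Y: "Y \<in> vector_fields A" and p: "p \<in> points A"
  shows "DJ \<xi> (endo_app \<phi> Y) p = - \<phi> p (DJ \<xi> Y p)"
proof -
  note f = one_formD(3)[OF \<eta> Y]
  note n = vf_tangent[OF nabla_vf[OF \<xi> J_vf[OF Y]], of p] vf_tangent[OF nabla_vf[OF \<xi> Y], of p]
  have "nabla \<xi> (endo_app \<phi> (endo_app \<phi> Y)) p =
      nabla \<xi> Y p - (vf_deriv A \<xi> (\<lambda>p. \<eta> p (Y p)) p *\<^sub>R \<xi> p + \<eta> p (Y p) *\<^sub>R S \<xi> p)"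
    unfolding phi2_field[OF Y] nabla_diff(2)[OF Y vf_fun_scale[OF f \<xi>] \<xi>] by (simp add: nabla_scale(2)[OF f \<xi> \<xi>])
  also have "\<dots> = nabla \<xi> Y p - \<eta> p (nabla \<xi> Y p) *\<^sub>R \<xi> p"
    using bilinear_fieldD(4)[OF g n(1) n(1) vf_tangent[OF Y], of 0]
    by (simp add: eta_vf_deriv[OF \<xi> Y p] S_xi[OF p])
  also have "\<dots> = \<phi> p (\<phi> p (nabla \<xi> Y p))" by (simp add: phi2[OF p n(2)])
  finally show ?thesis
    by (simp add: DJ_apply J_diff[OF n(1) J_tangent[OF n(2)]])
qed

text \<open>\<open>\<phi> \<phi> S = S\<close> because \<eta> vanishes on the values of
  \<open>S\<close>, and \<open>S \<phi> \<phi> = S\<close> because \<open>S \<xi> = 0\<close>; the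
  two terms of the defect containing \<open>S\<close> are thus interchanged.\<close>

lemma defect_commute:
  assumes Y: "Y \<in> vector_fields A" and p: "p \<in> points A"
  shows "xi_defect (endo_app \<phi> Y) p = \<phi> p (xi_defect Y p)"
proof -
  note t = tangent_scaleR[OF J_tangent[OF vf_tangent[OF Y]], of "2 * \<alpha> p" p] phi_S_tangent[OF Y, of p]
    vf_tangent[OF S_vf[OF J_vf[OF Y]], of p]
  note f = one_formD(3)[OF \<eta> Y]
  have "S (endo_app \<phi> (endo_app \<phi> Y)) p = S Y p"
    unfolding phi2_field[OF Y] nabla_diff(1)[OF Y vf_fun_scale[OF f \<xi>] \<xi>]
    by (simp add: nabla_scale(1)[OF f \<xi> \<xi>] S_xi[OF p])
  moreover have "\<phi> p (\<phi> p (S Y p)) = S Y p"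
    by (simp add: phi2[OF p vf_tangent[OF S_vf[OF Y]]] eta_S[OF Y p])
  ultimately show ?thesis
    by (simp add: xi_defect_def J_diff[OF tangent_diff[OF t(1,2)] t(3)] J_diff[OF t(1,2)]
        J_scale[OF J_tangent[OF vf_tangent[OF Y]]] endo_app_apply)
qed

text \<open>The defect both commutes and anticommutes with \<open>\<phi>\<close>, hence vanishes.\<close>

lemma DJ_along_xi_zero:
  assumes Y: "Y \<in> vector_fields A" and p: "p \<in> points A"
  shows "DJ \<xi> Y p = 0"
proof -
  define B where "B = DJ \<xi> Y p"
  have B: "B \<in> tangent_space A p" unfolding B_def by (rule vf_tangent[OF DJ_vf[OF \<xi> Y]])
  have "\<phi> p B = - \<phi> p B"
    using DJ_anticommute[OF Y p] DJ_along_xi[OF Y p] DJ_along_xi[OF J_vf[OF Y] p] defect_commute[OF Y p] by (simp add: B_def)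
  then have "\<phi> p B + \<phi> p B = \<phi> p B + - \<phi> p B" by (rule arg_cong)
  then have "2 *\<^sub>R \<phi> p B = 0" by (simp add: scaleR_2)
  then have "\<phi> p B = 0" by simp
  then have "\<phi> p (\<phi> p B) = 0" using J_scale[OF B, of 0] by simp
  \<comment> \<open>\<open>\<phi> B = 0\<close> still allows a multiple of \<xi>. Its coefficient is
    the product of \<open>\<phi> (S \<xi>)\<close> with \<open>Y\<close>, which is zero.\<close>
  moreover have "\<eta> p B = 0"
  proof -
    have "\<phi> p (S \<xi> p) = 0" using J_scale[OF B, of 0] by (simp add: S_xi[OF p])
    then have "g p B (\<xi> p) = 0"
      using DJ_pair_xi(2)[OF \<xi> Y p] bilinear_fieldD(3)[OF g B B vf_tangent[OF Y], of 0] by (simp add: B_def)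
    then show ?thesis using g_xi[OF p B] by simp
  qed
  ultimately show ?thesis using phi2[OF p B] by (simp add: B_def)
qed

text \<open>For a torsion-free connection the Lie derivative of \<phi> is
  \<open>\<nabla>\<^sub>\<xi> \<phi> + \<phi> S - S \<phi>\<close>. The first term is zero, and the
  vanishing defect replaces \<open>S \<phi>\<close> by \<open>2 \<alpha> \<phi> - \<phi> S\<close>;
  the resulting factor 2 cancels the 1/2 in \<open>h_op\<close>.\<close>

lemma h_eq:
  assumes X: "X \<in> vector_fields A" and p: "p \<in> points A"
  shows "h_op A \<phi> \<xi> X p = \<phi> p (S X p) - \<alpha> p *\<^sub>R \<phi> p (X p)"
proof -
  note n = vf_tangent[OF nabla_vf[OF \<xi> X], of p] vf_tangent[OF S_vf[OF X], of p]
  have "lie_deriv_endo A \<xi> \<phi> X p = DJ \<xi> X p + \<phi> p (S X p) - S (endo_app \<phi> X) p"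
    by (simp add: lie_deriv_endo_def endo_app_apply nabla_torsion[OF \<xi> J_vf[OF X]]
        nabla_torsion[OF \<xi> X] J_diff[OF n] DJ_apply fun_eq_iff)
  moreover have "xi_defect X p = 0" using DJ_along_xi[OF X p] DJ_along_xi_zero[OF X p] by simp
  ultimately have "lie_deriv_endo A \<xi> \<phi> X p = 2 *\<^sub>R (\<phi> p (S X p) - \<alpha> p *\<^sub>R \<phi> p (X p))"
    by (simp add: xi_defect_def DJ_along_xi_zero[OF X p] algebra_simps scaleR_2)
  then show ?thesis by (simp add: h_op_def scaleR_fun_def[of "1/2" "lie_deriv_endo A \<xi> \<phi> X"])
qed

section \<open>Splitting along \<xi> and the kernel of \<eta>\<close>

definition tangential :: "('p, 'e) vfield \<Rightarrow> ('p, 'e) vfield" where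
  "tangential X = X - fun_scale (\<lambda>p. \<eta> p (X p)) \<xi>"

lemma tangential_vf: "X \<in> vector_fields A \<Longrightarrow> tangential X \<in> vector_fields A"
  unfolding tangential_def by (intro vf_diff vf_fun_scale one_formD(3)[OF \<eta>] \<xi>)

lemma tangential_apply: "tangential X p = X p - \<eta> p (X p) *\<^sub>R \<xi> p"
  by (simp add: tangential_def fun_scale_def)

lemma eta_tangential:
  assumes X: "X \<in> vector_fields A" and p: "p \<in> points A" shows "\<eta> p (tangential X p) = 0"
proof -
  have "\<eta> p (X p) = \<eta> p (tangential X p + \<eta> p (X p) *\<^sub>R \<xi> p)" by (simp add: tangential_apply)
  also have "\<dots> = \<eta> p (tangential X p) + \<eta> p (X p)"
    by (simp add: one_formD(1)[OF \<eta> vf_tangent[OF tangential_vf[OF X]] tangent_scaleR[OF vf_tangent[OF \<xi>]]]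
        one_formD(2)[OF \<eta> vf_tangent[OF \<xi>]] eta_xi[OF p])
  finally show ?thesis by simp
qed

text \<open>All three arguments are split. The \<xi>-part of \<open>X\<close> contributes nothing by
  \<open>DJ_along_xi_zero\<close>, that of \<open>Z\<close> is read off directly, and that of
  \<open>Y\<close> after exchanging the last two arguments by skewness.\<close>

lemma DJ_decompose:
  assumes X: "X \<in> vector_fields A" and Y: "Y \<in> vector_fields A" and Z: "Z \<in> vector_fields A" and p: "p \<in> points A"
  shows "g p (DJ X Y p) (Z p) = g p (DJ (tangential X) (tangential Y) p) (tangential Z p)
    + \<eta> p (Z p) * g p (\<phi> p (S X p)) (Y p) - \<eta> p (Y p) * g p (\<phi> p (S X p)) (Z p)"
proof -
  note X' = tangential_vf[OF X] and Y' = tangential_vf[OF Y] and Z' = tangential_vf[OF Z]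
  note fX = one_formD(3)[OF \<eta> X]
  have 1: "DJ X V p = DJ (tangential X) V p" if V: "V \<in> vector_fields A" for V
  proof -
    note xv = vf_tangent[OF nabla_vf[OF \<xi> V], of p]
    have n: "nabla (tangential X) W p = nabla X W p - \<eta> p (X p) *\<^sub>R nabla \<xi> W p" if W: "W \<in> vector_fields A" for W
      unfolding tangential_def nabla_diff(1)[OF X vf_fun_scale[OF fX \<xi>] W] by (simp add: nabla_scale(1)[OF fX \<xi> W])
    have "DJ (tangential X) V p = DJ X V p - \<eta> p (X p) *\<^sub>R DJ \<xi> V p"
      unfolding DJ_apply n[OF V] n[OF J_vf[OF V]] J_diff[OF vf_tangent[OF nabla_vf[OF X V]] tangent_scaleR[OF xv]] J_scale[OF xv]
      by (simp add: algebra_simps)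
    then show ?thesis by (simp add: DJ_along_xi_zero[OF V p])
  qed
  have dec: "g p u (V p) = g p u (tangential V p) + \<eta> p (V p) * g p u (\<xi> p)"
    if V: "V \<in> vector_fields A" and u: "u \<in> tangent_space A p" for V u
    unfolding tangential_apply
    using g_diff(2)[OF vf_tangent[OF V] tangent_scaleR[OF vf_tangent[OF \<xi>]] u, of "\<eta> p (V p)"]
      bilinear_fieldD(4)[OF g vf_tangent[OF \<xi>] vf_tangent[OF \<xi>] u, of "\<eta> p (V p)"] by simp
  have 2: "g p (\<phi> p (S X p)) (V p) = g p (\<phi> p (S X p)) (tangential V p)" if V: "V \<in> vector_fields A" for V
    using dec[OF V phi_S_tangent[OF X]] g_xi[OF p phi_S_tangent[OF X]] eta_phi[OF p vf_tangent[OF S_vf[OF X]]] by simp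
  have "g p (DJ X Y p) (Z p) = g p (DJ X Y p) (tangential Z p) + \<eta> p (Z p) * g p (\<phi> p (S X p)) (Y p)"
    using dec[OF Z vf_tangent[OF DJ_vf[OF X Y]]] DJ_pair_xi(2)[OF X Y p] by simp
  moreover have "g p (DJ X Y p) (tangential Z p) = g p (DJ X (tangential Y) p) (tangential Z p)
      - \<eta> p (Y p) * g p (\<phi> p (S X p)) (tangential Z p)"
  proof -
    have s: "g p (DJ X V p) (tangential Z p) = - g p (DJ X (tangential Z) p) (V p)" if "V \<in> vector_fields A" for V
      using DJ_skew[OF X that Z' p] g_sym[OF p vf_tangent[OF that] vf_tangent[OF DJ_vf[OF X Z']]] by simp
    show ?thesis
      using s[OF Y] s[OF Y'] dec[OF Y vf_tangent[OF DJ_vf[OF X Z']]] DJ_pair_xi(2)[OF X Z' p] by simp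
  qed
  ultimately show ?thesis using 1[OF Y'] 2[OF Z] by simp
qed

text \<open>The prescribed value has exactly the two \<xi>-terms of \<open>DJ_decompose\<close>, so
  equality means that the remaining term vanishes.\<close>

lemma structure_equation_iff:
  "(\<forall>X\<in>vector_fields A. \<forall>Y\<in>vector_fields A. \<forall>p\<in>points A.
      DJ X Y p = (\<alpha> p * g p (\<phi> p (X p)) (Y p)) *\<^sub>R \<xi> p + g p (h_op A \<phi> \<xi> X p) (Y p) *\<^sub>R \<xi> p
        - (\<alpha> p * \<eta> p (Y p)) *\<^sub>R \<phi> p (X p) - \<eta> p (Y p) *\<^sub>R h_op A \<phi> \<xi> X p) \<longleftrightarrow>
   (\<forall>X\<in>vector_fields A. \<forall>Y\<in>vector_fields A. \<forall>Z\<in>vector_fields A. \<forall>p\<in>points A.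
      g p (DJ (tangential X) (tangential Y) p) (tangential Z p) = 0)"
proof -
  define R where "R X Y p = (\<alpha> p * g p (\<phi> p (X p)) (Y p)) *\<^sub>R \<xi> p + g p (h_op A \<phi> \<xi> X p) (Y p) *\<^sub>R \<xi> p
        - (\<alpha> p * \<eta> p (Y p)) *\<^sub>R \<phi> p (X p) - \<eta> p (Y p) *\<^sub>R h_op A \<phi> \<xi> X p" for X Y p
  \<comment> \<open>By \<open>h_eq\<close> the two terms with \<alpha> cancel against the
    \<alpha>-part of \<open>h\<close>.\<close>
  have R_eq: "R X Y p = g p (\<phi> p (S X p)) (Y p) *\<^sub>R \<xi> p - \<eta> p (Y p) *\<^sub>R \<phi> p (S X p)"
    if X: "X \<in> vector_fields A" and Y: "Y \<in> vector_fields A" and p: "p \<in> points A" for X Y p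
  proof -
    note t = phi_S_tangent[OF X, of p] J_tangent[OF vf_tangent[OF X, of p]] vf_tangent[OF Y, of p]
    show ?thesis
      unfolding R_def h_eq[OF X p] g_diff(1)[OF t(1) tangent_scaleR[OF t(2)] t(3)] bilinear_fieldD(3)[OF g t(2,2,3)]
      by (simp add: algebra_simps)
  qed
  have R_t: "R X Y p \<in> tangent_space A p"
    if X: "X \<in> vector_fields A" and Y: "Y \<in> vector_fields A" and p: "p \<in> points A" for X Y p
    unfolding R_eq[OF that] by (intro tangent_diff tangent_scaleR vf_tangent[OF \<xi>] phi_S_tangent[OF X])
  have pair: "g p (R X Y p) (Z p) = \<eta> p (Z p) * g p (\<phi> p (S X p)) (Y p) - \<eta> p (Y p) * g p (\<phi> p (S X p)) (Z p)"
    if X: "X \<in> vector_fields A" and Y: "Y \<in> vector_fields A" and Z: "Z \<in> vector_fields A" and p: "p \<in> points A" for X Y Z p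
  proof -
    note t = phi_S_tangent[OF X, of p] vf_tangent[OF \<xi>, of p] vf_tangent[OF Z, of p]
    have "g p (\<xi> p) (Z p) = \<eta> p (Z p)" using g_sym[OF p t(2,3)] g_xi[OF p t(3)] by simp
    then show ?thesis
      unfolding R_eq[OF X Y p] g_diff(1)[OF tangent_scaleR[OF t(2)] tangent_scaleR[OF t(1)] t(3)]
        bilinear_fieldD(3)[OF g t(2,2,3)] bilinear_fieldD(3)[OF g t(1,1,3)] by simp
  qed
  have "DJ X Y p = R X Y p \<longleftrightarrow> (\<forall>Z\<in>vector_fields A. g p (DJ (tangential X) (tangential Y) p) (tangential Z p) = 0)"
    if X: "X \<in> vector_fields A" and Y: "Y \<in> vector_fields A" and p: "p \<in> points A" for X Y p
  proof
    assume "DJ X Y p = R X Y p"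
    then show "\<forall>Z\<in>vector_fields A. g p (DJ (tangential X) (tangential Y) p) (tangential Z p) = 0"
      using DJ_decompose[OF X Y _ p] pair[OF X Y _ p] by simp
  next
    assume "\<forall>Z\<in>vector_fields A. g p (DJ (tangential X) (tangential Y) p) (tangential Z p) = 0"
    then show "DJ X Y p = R X Y p"
      using DJ_decompose[OF X Y _ p] pair[OF X Y _ p]
      by (intro tangent_eq_fieldI[OF p vf_tangent[OF DJ_vf[OF X Y]] R_t[OF X Y p]]) simp
  qed
  then show ?thesis unfolding R_def by blast
qed

end

section \<open>Integral manifolds\<close>

text \<open>The inclusion of \<open>L\<close> into \<open>M\<close>, read in a chart
  \<open>b\<close> of \<open>L\<close> and a chart \<open>c\<close> of \<open>M\<close>.\<close>

definition irep :: "('p, 'l) chart \<Rightarrow> ('p, 'm) chart \<Rightarrow> 'l \<Rightarrow> 'm" where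
  "irep b c x = coord c (coord_inv b x)"

abbreviation idom :: "('p, 'l) chart \<Rightarrow> ('p, 'm) chart \<Rightarrow> 'l set" where
  "idom b c \<equiv> coord b ` (chart_dom b \<inter> chart_dom c)"

locale smooth_incl = M: hausdorff_mfd M + L: smooth_mfd L
  for M :: "('p, 'm::euclidean_space) atlas" and L :: "('p, 'l::euclidean_space) atlas" +
  assumes incl_smooth: "smooth_map L M (\<lambda>p. p)"
begin

abbreviation "inc \<equiv> incl_map L M"

lemma points_subset: "points L \<subseteq> points M"
  using incl_smooth by (auto simp: smooth_map_def)

lemma open_idom: "b \<in> L \<Longrightarrow> c \<in> M \<Longrightarrow> open (idom b c)"
  and smooth_irep: "b \<in> L \<Longrightarrow> c \<in> M \<Longrightarrow> smooth_on (irep b c) (idom b c)"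
proof -
  assume b: "b \<in> L" and c: "c \<in> M"
  have "open (coord b ` (chart_dom b \<inter> (\<lambda>p. p) -` chart_dom c)) \<and>
      smooth_on (coord c \<circ> (\<lambda>p. p) \<circ> coord_inv b) (coord b ` (chart_dom b \<inter> (\<lambda>p. p) -` chart_dom c))"
    using incl_smooth b c unfolding smooth_map_def by blast
  moreover have "coord c \<circ> (\<lambda>p. p) \<circ> coord_inv b = irep b c" by (simp add: fun_eq_iff irep_def)
  ultimately show "open (idom b c)" "smooth_on (irep b c) (idom b c)" by simp_all
qed

lemma idomD:
  assumes "b \<in> L" "c \<in> M" "x \<in> idom b c"
  shows "x \<in> chart_img b" "irep b c x \<in> chart_img c" "coord_inv c (irep b c x) = coord_inv b x"
    "b \<in> charts_at L (coord_inv b x)" "c \<in> charts_at M (coord_inv b x)" "coord b (coord_inv b x) = x"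
proof -
  obtain q where q: "x = coord b q" "q \<in> chart_dom b" "q \<in> chart_dom c" using assms(3) by blast
  then have "coord_inv b x = q" using L.coord_inv_coord[OF assms(1)] by simp
  then show "x \<in> chart_img b" "irep b c x \<in> chart_img c" "coord_inv c (irep b c x) = coord_inv b x"
    "b \<in> charts_at L (coord_inv b x)" "c \<in> charts_at M (coord_inv b x)" "coord b (coord_inv b x) = x"
    using q M.coord_inv_coord[OF assms(2)] assms(1,2) by (simp_all add: irep_def charts_at_def)
qed

lemma idom_memI: "b \<in> charts_at L p \<Longrightarrow> c \<in> charts_at M p \<Longrightarrow> coord b p \<in> idom b c"
  by (auto simp: charts_at_def)

lemma irep_coord: "b \<in> charts_at L p \<Longrightarrow> irep b c (coord b p) = coord c p"
  by (simp add: irep_def L.coord_inv_coord charts_at_def)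

lemma irep_deriv:
  assumes "b \<in> charts_at L p" "c \<in> charts_at M p"
  shows "(irep b c has_derivative fderiv (irep b c) (coord b p)) (at (coord b p))"
  by (rule smooth_on_has_derivative[OF smooth_irep open_idom idom_memI[OF assms]])
    (use assms in \<open>simp_all add: charts_at_def\<close>)

lemma inc_chart:
  assumes b: "b \<in> charts_at L p" and c: "c \<in> charts_at M p" and v: "v \<in> tangent_space L p"
  shows "inc p v c = fderiv (irep b c) (coord b p) (v b)"
proof -
  define b0 where "b0 = some_chart L p"
  have b0: "b0 \<in> charts_at L p" unfolding b0_def by (rule some_chart_at[OF charts_at_points[OF b]])
  note bL = charts_atD(1)[OF b] and b0L = charts_atD(1)[OF b0]
  have "(irep b c has_derivative fderiv (irep b c) (coord b p)) (at (transition b0 b (coord b0 p)))"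
    using irep_deriv[OF b c] L.transition_coord[OF b0] by simp
  from has_derivative_compose[OF L.transition_deriv[OF b0 b] this]
  have 1: "((\<lambda>x. irep b c (transition b0 b x)) has_derivative
    (\<lambda>u. fderiv (irep b c) (coord b p) (fderiv (transition b0 b) (coord b0 p) u))) (at (coord b0 p))" .
  have "((coord c \<circ> (\<lambda>p. p) \<circ> coord_inv b0) has_derivative
    (\<lambda>u. fderiv (irep b c) (coord b p) (fderiv (transition b0 b) (coord b0 p) u))) (at (coord b0 p))"
    by (rule has_derivative_transform_within_open[OF 1 L.open_overlap[OF b0L bL] L.overlap_memI[OF b0 b]])
      (use L.overlapD(4)[OF b0L _ bL] in \<open>simp add: irep_def\<close>)
  from fderiv_eq[OF this] show ?thesis
    unfolding tangent_map_def b0_def[symmetric] Let_def using c L.tangent_transition[OF v b0 b] by simp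
qed

lemma inc_tangent:
  assumes p: "p \<in> points L" and v: "v \<in> tangent_space L p"
  shows "inc p v \<in> tangent_space M p"
proof (rule M.tangentI)
  show "inc p v c = 0" if "c \<notin> charts_at M p" for c using that by (simp add: tangent_map_def)
  fix c d assume c: "c \<in> charts_at M p" and d: "d \<in> charts_at M p"
  obtain b where b: "b \<in> charts_at L p" using p by (rule chart_atE)
  note bL = charts_atD(1)[OF b] and cM = charts_atD(1)[OF c] and dM = charts_atD(1)[OF d]
  have "(transition c d has_derivative fderiv (transition c d) (coord c p)) (at (irep b c (coord b p)))"
    unfolding irep_coord[OF b] by (rule M.transition_deriv[OF c d])
  from has_derivative_compose[OF irep_deriv[OF b c] this]
  have "(irep b d has_derivative
      (\<lambda>u. fderiv (transition c d) (coord c p) (fderiv (irep b c) (coord b p) u))) (at (coord b p))"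
    by (rule has_derivative_transform_within_open[OF _ open_idom[OF bL cM] idom_memI[OF b c]])
      (use idomD(3)[OF bL cM] in \<open>simp add: transition_def irep_def\<close>)
  from fderiv_eq[OF this] show "inc p v d = fderiv (transition c d) (coord c p) (inc p v c)"
    using inc_chart[OF b c v] inc_chart[OF b d v] by simp
qed

lemma continuous_incl: "continuous_map (manifold_topology L) (manifold_topology M) (\<lambda>p. p)"
  unfolding continuous_map_def L.topspace_manifold M.topspace_manifold
proof (intro conjI allI impI)
  show "(\<lambda>p. p) \<in> points L \<rightarrow> points M" using points_subset by auto
  fix W assume W: "openin (manifold_topology M) W"
  show "openin (manifold_topology L) {p \<in> points L. p \<in> W}"
    unfolding L.openin_manifold
  proof (intro conjI ballI)
    fix b assume b: "b \<in> L"
    show "open (coord b ` ({p \<in> points L. p \<in> W} \<inter> chart_dom b))"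
    proof (subst open_subopen, intro ballI)
      fix x assume "x \<in> coord b ` ({p \<in> points L. p \<in> W} \<inter> chart_dom b)"
      then obtain q where q: "x = coord b q" "q \<in> points L" "q \<in> W" "q \<in> chart_dom b" by blast
      obtain c where c: "c \<in> charts_at M q" using q(2) points_subset by (meson chart_atE subsetD)
      note cM = charts_atD(1)[OF c]
      have bq: "b \<in> charts_at L q" using q(4) b by (simp add: charts_at_def)
      have oW: "open (coord c ` (W \<inter> chart_dom c))" using W cM M.openin_manifold by blast
      define T where "T = idom b c \<inter> irep b c -` (coord c ` (W \<inter> chart_dom c))"
      have "open T" unfolding T_def
        by (rule continuous_open_preimage[OF smooth_on_continuous[OF smooth_irep[OF b cM]] open_idom[OF b cM] oW])
      moreover have "x \<in> T"
        using q charts_atD(2)[OF c] irep_coord[OF bq, of c] by (auto simp: T_def)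
      moreover have "T \<subseteq> coord b ` ({p \<in> points L. p \<in> W} \<inter> chart_dom b)"
      proof
        fix y assume "y \<in> T"
        then have y: "y \<in> idom b c" "irep b c y \<in> coord c ` (W \<inter> chart_dom c)" by (auto simp: T_def)
        note d = idomD[OF b cM y(1)]
        obtain r where r: "irep b c y = coord c r" "r \<in> W" "r \<in> chart_dom c" using y(2) by blast
        then have "coord_inv b y \<in> W" using d(3) M.coord_inv_coord[OF cM r(3)] by simp
        then have "coord_inv b y \<in> {p \<in> points L. p \<in> W} \<inter> chart_dom b"
          using charts_at_points[OF d(4)] charts_atD(2)[OF d(4)] by blast
        from imageI[OF this, of "coord b"] show "y \<in> coord b ` ({p \<in> points L. p \<in> W} \<inter> chart_dom b)"
          by (simp only: d(6))
      qed
      ultimately show "\<exists>T. open T \<and> x \<in> T \<and> T \<subseteq> coord b ` ({p \<in> points L. p \<in> W} \<inter> chart_dom b)" by blast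
    qed
  qed blast
qed

text \<open>Reduces the immersion condition at a point to a single pair of charts, the form in which
  it is checked for constructed atlases.\<close>

lemma incl_inj_img:
  assumes b: "b \<in> charts_at L p" and c: "c \<in> charts_at M p" and inj: "inj (fderiv (irep b c) (coord b p))"
    and range: "range (fderiv (irep b c) (coord b p)) = {u. frep M c \<eta> (coord c p) u = 0}"
  shows "inj_on (inc p) (tangent_space L p)" "inc p ` tangent_space L p = ker_form M \<eta> p"
proof -
  note p = charts_at_points[OF b]
  note t = inc_tangent[OF p]
  show "inj_on (inc p) (tangent_space L p)"
  proof (rule inj_onI)
    fix u v assume u: "u \<in> tangent_space L p" and v: "v \<in> tangent_space L p" and "inc p u = inc p v"
    then have "u b = v b" using inc_chart[OF b c u] inc_chart[OF b c v] inj by (metis injD)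
    then show "u = v" by (rule L.tangent_eqI[OF u v b])
  qed
  have "inc p v \<in> ker_form M \<eta> p" if v: "v \<in> tangent_space L p" for v
    using t[OF v] M.frep_coord[OF c t[OF v], of \<eta>] inc_chart[OF b c v]
      rangeI[of "fderiv (irep b c) (coord b p)" "v b", unfolded range] by (simp add: ker_form_def)
  moreover have "w \<in> inc p ` tangent_space L p" if w: "w \<in> ker_form M \<eta> p" for w
  proof -
    have wt: "w \<in> tangent_space M p" and "\<eta> p w = 0" using w by (simp_all add: ker_form_def)
    then have "w c \<in> {u. frep M c \<eta> (coord c p) u = 0}" using M.frep_coord[OF c wt, of \<eta>] by simp
    then obtain u where u: "w c = fderiv (irep b c) (coord b p) u" using range by (metis imageE)
    note tu = L.tvec_in[OF b, of u]
    have "inc p (tvec L p b u) = w"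
      by (rule M.tangent_eqI[OF t[OF tu] wt c]) (simp add: inc_chart[OF b c tu] L.tvec_at[OF b] u)
    then show ?thesis using tu by blast
  qed
  ultimately show "inc p ` tangent_space L p = ker_form M \<eta> p" by blast
qed

end

locale integral_mfd = smooth_incl M L
  for M :: "('p, 'm::euclidean_space) atlas" and L :: "('p, 'l::euclidean_space) atlas" +
  fixes \<eta> :: "('p, 'm) form1"
  assumes \<eta>_form: "one_form M \<eta>"
    and incl_inj: "\<And>p. p \<in> points L \<Longrightarrow> inj_on (incl_map L M p) (tangent_space L p)"
    and incl_img: "\<And>p. p \<in> points L \<Longrightarrow> incl_map L M p ` tangent_space L p = ker_form M \<eta> p"
begin

lemma inc_in:
  assumes "p \<in> points L" "v \<in> tangent_space L p"
  shows "inc p v \<in> tangent_space M p" "\<eta> p (inc p v) = 0"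
  using incl_img[OF assms(1)] assms(2) unfolding ker_form_def by blast+

lemma inc_eqI:
  assumes p: "p \<in> points L" and u: "u \<in> tangent_space L p" and v: "v \<in> tangent_space L p" and eq: "inc p u = inc p v"
  shows "u = v"
  using incl_inj[OF p] u v eq by (auto dest: inj_onD)

lemma inc_linear:
  assumes p: "p \<in> points L" and u: "u \<in> tangent_space L p" and v: "v \<in> tangent_space L p"
  shows "inc p (u + v) = inc p u + inc p v" "inc p (r *\<^sub>R u) = r *\<^sub>R inc p u"
proof -
  obtain b where b: "b \<in> charts_at L p" using p by (rule chart_atE)
  obtain c where c: "c \<in> charts_at M p" using p points_subset by (meson chart_atE subsetD)
  note lin = has_derivative_linear[OF irep_deriv[OF b c]]
  show "inc p (u + v) = inc p u + inc p v"
    by (rule M.tangent_eqI[OF inc_in(1)[OF p L.tangent_add[OF u v]] M.tangent_add[OF inc_in(1)[OF p u] inc_in(1)[OF p v]] c])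
      (simp add: inc_chart[OF b c] u v L.tangent_add linear_add[OF lin])
  show "inc p (r *\<^sub>R u) = r *\<^sub>R inc p u"
    by (rule M.tangent_eqI[OF inc_in(1)[OF p L.tangent_scaleR[OF u]] M.tangent_scaleR[OF inc_in(1)[OF p u]] c])
      (simp add: inc_chart[OF b c L.tangent_scaleR[OF u]] inc_chart[OF b c u] scaleR_fun_apply linear_cmul[OF lin])
qed

lemma inj_irep:
  assumes b: "b \<in> charts_at L p" and c: "c \<in> charts_at M p"
  shows "inj (fderiv (irep b c) (coord b p))"
proof (rule injI)
  fix u v assume eq: "fderiv (irep b c) (coord b p) u = fderiv (irep b c) (coord b p) v"
  note p = charts_at_points[OF b]
  note t = L.tvec_in[OF b]
  have "inc p (tvec L p b u) = inc p (tvec L p b v)"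
    by (rule M.tangent_eqI[OF inc_in(1)[OF p t] inc_in(1)[OF p t] c])
      (simp add: inc_chart[OF b c t] L.tvec_at[OF b] eq)
  then have "tvec L p b u = tvec L p b v" by (rule inc_eqI[OF p t t])
  then show "u = v" using L.tvec_at[OF b] by metis
qed

lemma irep_at:
  assumes b: "b \<in> L" and c: "c \<in> M" and x: "x \<in> idom b c"
  shows "inj (fderiv (irep b c) x)" "linear (fderiv (irep b c) x)"
    "frep M c \<eta> (irep b c x) (fderiv (irep b c) x u) = 0"
proof -
  note d = idomD[OF b c x]
  show "inj (fderiv (irep b c) x)" using inj_irep[OF d(4,5)] d(6) by simp
  show "linear (fderiv (irep b c) x)" by (rule smooth_on_linear_fderiv[OF smooth_irep[OF b c] open_idom[OF b c] x])
  note p = charts_at_points[OF d(4)]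
  note t = L.tvec_in[OF d(4), of u]
  have "inc (coord_inv b x) (tvec L (coord_inv b x) b u) c = fderiv (irep b c) x u"
    using inc_chart[OF d(4,5) t] L.tvec_at[OF d(4)] d(6) by simp
  moreover have "coord c (coord_inv b x) = irep b c x" by (simp add: irep_def)
  ultimately show "frep M c \<eta> (irep b c x) (fderiv (irep b c) x u) = 0"
    using M.frep_coord[OF d(5) inc_in(1)[OF p t], of \<eta>] inc_in(2)[OF p t] by simp
qed

text \<open>Converse of \<open>incl_inj_img\<close>; it transports the condition from an integral
  manifold to a union of atlases that contains its charts.\<close>

lemma range_irep:
  assumes b: "b \<in> charts_at L p" and c: "c \<in> charts_at M p"
  shows "range (fderiv (irep b c) (coord b p)) = {u. frep M c \<eta> (coord c p) u = 0}"
proof -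
  note p = charts_at_points[OF b]
  note bL = charts_atD(1)[OF b] and cM = charts_atD(1)[OF c]
  have "frep M c \<eta> (coord c p) (fderiv (irep b c) (coord b p) u) = 0" for u
    using irep_at(3)[OF bL cM idom_memI[OF b c]] irep_coord[OF b] by metis
  moreover have "u \<in> range (fderiv (irep b c) (coord b p))" if "frep M c \<eta> (coord c p) u = 0" for u
  proof -
    note t = M.tvec_in[OF c, of u]
    have "tvec M p c u \<in> ker_form M \<eta> p"
      using that t M.frep_coord[OF c t, of \<eta>] by (simp add: ker_form_def M.tvec_at[OF c])
    then obtain v where v: "v \<in> tangent_space L p" "tvec M p c u = inc p v" using incl_img[OF p] by blast
    then have "u = fderiv (irep b c) (coord b p) (v b)" using inc_chart[OF b c v(1)] M.tvec_at[OF c, of u] by simp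
    then show ?thesis by blast
  qed
  ultimately show ?thesis by blast
qed

section \<open>Fields on an integral manifold and fields on the ambient manifold\<close>

text \<open>The components of \<open>V\<close> solve the linear system given by the derivative of
  the inclusion. That system is injective but need not be square, which is why
  \<open>smooth_on_linear_solve\<close> allows different dimensions.\<close>

lemma vf_liftI:
  assumes V: "\<And>p. V p \<in> tangent_space L p"
    and sm: "\<And>b c. b \<in> L \<Longrightarrow> c \<in> M \<Longrightarrow> smooth_on (\<lambda>x. inc (coord_inv b x) (V (coord_inv b x)) c) (idom b c)"
  shows "V \<in> vector_fields L"
proof (rule L.vfI[OF V])
  fix b assume b: "b \<in> L"
  show "smooth_on (vrep b V) (chart_img b)"
  proof (rule smooth_on_local)
    fix x assume x: "x \<in> chart_img b"
    note bx = L.coord_inv_charts_at[OF b x]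
    obtain c where c: "c \<in> charts_at M (coord_inv b x)"
      using charts_at_points[OF bx] points_subset by (meson chart_atE subsetD)
    note cM = charts_atD(1)[OF c]
    have "smooth_on (vrep b V) (idom b c)"
    proof (rule smooth_on_linear_solve[OF open_idom[OF b cM] irep_at(2)[OF b cM] irep_at(1)[OF b cM]
          smooth_on_fderiv[OF smooth_irep[OF b cM]] sm[OF b cM]])
      fix y assume y: "y \<in> idom b c"
      note d = idomD[OF b cM y]
      show "fderiv (irep b c) y (vrep b V y) = inc (coord_inv b y) (V (coord_inv b y)) c"
        using inc_chart[OF d(4,5) V] d(6) by (simp add: vrep_def)
    qed
    moreover have "x \<in> idom b c" using idom_memI[OF bx c] L.coord_coord_inv[OF x] by simp
    ultimately show "\<exists>T. open T \<and> x \<in> T \<and> smooth_on (vrep b V) T" using open_idom[OF b cM] by blast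
  qed
qed

lemma smooth_inc_vf:
  assumes V: "V \<in> vector_fields L" and b: "b \<in> L" and c: "c \<in> M"
  shows "smooth_on (\<lambda>x. inc (coord_inv b x) (V (coord_inv b x)) c) (idom b c)"
proof (rule smooth_on_cong[OF open_idom[OF b c]])
  have "idom b c \<subseteq> chart_img b" by blast
  then show "smooth_on (\<lambda>x. fderiv (irep b c) x (vrep b V x)) (idom b c)"
    by (intro smooth_on_linear_family[OF open_idom[OF b c] irep_at(2)[OF b c] smooth_on_fderiv[OF smooth_irep[OF b c]]]
        smooth_on_subset[OF L.vf_smooth[OF V b] open_idom[OF b c]])
  fix y assume y: "y \<in> idom b c"
  note d = idomD[OF b c y]
  show "fderiv (irep b c) y (vrep b V y) = inc (coord_inv b y) (V (coord_inv b y)) c"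
    using inc_chart[OF d(4,5) L.vf_tangent[OF V]] d(6) by (simp add: vrep_def)
qed

definition lift :: "'p \<Rightarrow> ('p, 'm) tangent \<Rightarrow> ('p, 'l) tangent" where
  "lift p w = (if p \<in> points L then inv_into (tangent_space L p) (inc p) w else 0)"

lemma lift:
  assumes "p \<in> points L" "w \<in> tangent_space M p" "\<eta> p w = 0"
  shows "lift p w \<in> tangent_space L p" "inc p (lift p w) = w"
proof -
  have "w \<in> inc p ` tangent_space L p" using incl_img[OF assms(1)] assms by (simp add: ker_form_def)
  then show "lift p w \<in> tangent_space L p" "inc p (lift p w) = w"
    using assms(1) by (simp_all add: lift_def inv_into_into f_inv_into_f)
qed

text \<open>Restriction to \<open>L\<close>; meaningful only for fields annihilated by
  \<eta>.\<close>

definition res :: "('p, 'm) vfield \<Rightarrow> ('p, 'l) vfield" where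
  "res X = (\<lambda>p. lift p (X p))"

lemma res_tangent:
  assumes "X \<in> vector_fields M" "\<And>p. p \<in> points M \<Longrightarrow> \<eta> p (X p) = 0"
  shows "res X p \<in> tangent_space L p" "p \<in> points L \<Longrightarrow> inc p (res X p) = X p"
proof -
  show "inc p (res X p) = X p" if "p \<in> points L"
    using lift(2)[OF that M.vf_tangent[OF assms(1)]] assms(2) that points_subset by (auto simp: res_def)
  show "res X p \<in> tangent_space L p"
  proof (cases "p \<in> points L")
    case True
    then show ?thesis using lift(1)[OF True M.vf_tangent[OF assms(1)]] assms(2) points_subset by (auto simp: res_def)
  qed (simp add: res_def lift_def L.tangent_zero)
qed

lemma res_vf:
  assumes X: "X \<in> vector_fields M" and "\<And>p. p \<in> points M \<Longrightarrow> \<eta> p (X p) = 0"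
  shows "res X \<in> vector_fields L"
proof (rule vf_liftI)
  show "res X p \<in> tangent_space L p" for p by (rule res_tangent[OF assms])
  fix b c assume b: "b \<in> L" and c: "c \<in> M"
  show "smooth_on (\<lambda>x. inc (coord_inv b x) (res X (coord_inv b x)) c) (idom b c)"
  proof (rule smooth_on_cong[OF open_idom[OF b c]])
    show "smooth_on (\<lambda>x. vrep c X (irep b c x)) (idom b c)"
      by (rule smooth_on_compose[OF open_idom[OF b c] M.open_chart_img[OF c] _ smooth_irep[OF b c] M.vf_smooth[OF X c]])
        (use idomD(2)[OF b c] in blast)
    fix y assume y: "y \<in> idom b c"
    note d = idomD[OF b c y]
    show "vrep c X (irep b c y) = inc (coord_inv b y) (res X (coord_inv b y)) c"
      using res_tangent(2)[OF assms charts_at_points[OF d(4)]] d(3) by (simp add: vrep_def)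
  qed
qed

text \<open>The representatives of the two pairs of fields are related by \<open>irep b c\<close>,
  so \<open>bracket_related\<close> applies.\<close>

lemma inc_bracket:
  assumes X: "X \<in> vector_fields M" and Y: "Y \<in> vector_fields M"
    and V: "V \<in> vector_fields L" and W: "W \<in> vector_fields L"
    and VX: "\<And>p. p \<in> points L \<Longrightarrow> inc p (V p) = X p" and WY: "\<And>p. p \<in> points L \<Longrightarrow> inc p (W p) = Y p"
    and p: "p \<in> points L"
  shows "inc p (lie_bracket L V W p) = lie_bracket M X Y p"
proof -
  obtain b where b: "b \<in> charts_at L p" using p by (rule chart_atE)
  obtain c where c: "c \<in> charts_at M p" using p points_subset by (meson chart_atE subsetD)
  note bL = charts_atD(1)[OF b] and cM = charts_atD(1)[OF c]
  note S = open_idom[OF bL cM]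
  have sub: "idom b c \<subseteq> chart_img b" by blast
  have rel: "fderiv (irep b c) x (vrep b P x) = vrep c Q (irep b c x)"
    if "P \<in> vector_fields L" "\<And>p. p \<in> points L \<Longrightarrow> inc p (P p) = Q p" "x \<in> idom b c" for P Q x
  proof -
    note d = idomD[OF bL cM that(3)]
    show ?thesis
      using inc_chart[OF d(4,5) L.vf_tangent[OF that(1)]] that(2)[OF charts_at_points[OF d(4)]] d(3,6)
      by (simp add: vrep_def)
  qed
  have "fderiv (irep b c) (coord b p)
      (fderiv (vrep b W) (coord b p) (vrep b V (coord b p)) - fderiv (vrep b V) (coord b p) (vrep b W (coord b p)))
    = fderiv (vrep c Y) (irep b c (coord b p)) (vrep c X (irep b c (coord b p)))
      - fderiv (vrep c X) (irep b c (coord b p)) (vrep c Y (irep b c (coord b p)))"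
    by (rule bracket_related[OF S M.open_chart_img[OF cM] idomD(2)[OF bL cM] smooth_irep[OF bL cM]
        smooth_on_subset[OF L.vf_smooth[OF V bL] S sub] smooth_on_subset[OF L.vf_smooth[OF W bL] S sub]
        M.vf_smooth[OF X cM] M.vf_smooth[OF Y cM] rel[OF V VX] rel[OF W WY] idom_memI[OF b c]])
  then have "inc p (lie_bracket L V W p) c = lie_bracket M X Y p c"
    by (simp add: inc_chart[OF b c L.vf_tangent[OF L.vf_lie_bracket[OF V W]]] L.lie_bracket_chart[OF b]
        M.lie_bracket_chart[OF c] irep_coord[OF b] L.vrep_coord[OF b] M.vrep_coord[OF c])
  then show ?thesis
    by (rule M.tangent_eqI[OF inc_in(1)[OF p L.vf_tangent[OF L.vf_lie_bracket[OF V W]]]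
          M.vf_tangent[OF M.vf_lie_bracket[OF X Y]] c])
qed

lemma vf_deriv_inc:
  assumes X: "X \<in> vector_fields M" and V: "V \<in> vector_fields L" and VX: "inc p (V p) = X p"
    and F: "smooth_fun M F" and p: "p \<in> points L"
  shows "vf_deriv L V F p = vf_deriv M X F p"
proof -
  obtain b where b: "b \<in> charts_at L p" using p by (rule chart_atE)
  obtain c where c: "c \<in> charts_at M p" using p points_subset by (meson chart_atE subsetD)
  note bL = charts_atD(1)[OF b] and cM = charts_atD(1)[OF c]
  note D = M.smooth_fun_chart[OF F c]
  have "((F \<circ> coord_inv c) has_derivative fderiv (F \<circ> coord_inv c) (coord c p)) (at (irep b c (coord b p)))"
    using D by (simp add: irep_coord[OF b])
  from has_derivative_compose[OF irep_deriv[OF b c] this]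
  have "((F \<circ> coord_inv b) has_derivative
      (\<lambda>u. fderiv (F \<circ> coord_inv c) (coord c p) (fderiv (irep b c) (coord b p) u))) (at (coord b p))"
    by (rule has_derivative_transform_within_open[OF _ open_idom[OF bL cM] idom_memI[OF b c]])
      (use idomD(3)[OF bL cM] in simp)
  from L.vf_deriv_chart[OF b V this] show ?thesis
    using M.vf_deriv_chart[OF c X D] inc_chart[OF b c L.vf_tangent[OF V]] VX by simp
qed

end

section \<open>The induced structure on an integral manifold\<close>

text \<open>Off \<open>L\<close> the inclusion map is a junk value, so the leaf metric is replaced by \<open>0\<close> there;
  the Levi-Civita connection only depends on the metric on \<open>L\<close>.\<close>

lemma is_levi_civita_cong:
  assumes "smooth_atlas A" "\<And>p. p \<in> points A \<Longrightarrow> g p = g' p"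
  shows "is_levi_civita A g = is_levi_civita A g'"
proof -
  interpret smooth_mfd A by (unfold_locales) (rule assms(1))
  have "vf_deriv A X (\<lambda>q. g q (Y q) (Z q)) p = vf_deriv A X (\<lambda>q. g' q (Y q) (Z q)) p" if "p \<in> points A" for X Y Z p
    unfolding vf_deriv_def by (rule dir_deriv_cong[OF that]) (simp add: assms(2))
  then show ?thesis unfolding is_levi_civita_def fun_eq_iff using assms(2) by simp
qed

locale integral_paracosymplectic = paracosymplectic_mfd M g nabla \<phi> \<xi> \<eta> \<alpha> + I: integral_mfd M L \<eta>
  for M :: "('p, 'm::euclidean_space) atlas" and g :: "('p, 'm) form2" and nabla :: "('p, 'm) connection"
    and \<phi> :: "('p, 'm) endo" and \<xi> :: "('p, 'm) vfield" and \<eta> :: "('p, 'm) form1" and \<alpha> :: "'p \<Rightarrow> real"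
    and L :: "('p, 'l::euclidean_space) atlas" +
  assumes L_hausdorff: "Hausdorff_space (manifold_topology L)"
begin

abbreviation "inc \<equiv> incl_map L M"

definition gL :: "('p, 'l) form2" where
  "gL p = (if p \<in> points L then leaf_metric M g L p else (\<lambda>u v. 0))"

abbreviation "JL \<equiv> leaf_endo M \<phi> L"

lemma gL: "p \<in> points L \<Longrightarrow> gL p u v = g p (inc p u) (inc p v)"
  by (simp add: gL_def leaf_metric_def)

lemma JL:
  assumes p: "p \<in> points L" and u: "u \<in> tangent_space L p"
  shows "JL p u \<in> tangent_space L p" "inc p (JL p u) = \<phi> p (inc p u)"
proof -
  have "p \<in> points M" using p I.points_subset by blast
  note l = I.lift[OF p J_tangent[OF I.inc_in(1)[OF p u]] eta_phi[OF this I.inc_in(1)[OF p u]]]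
  show "JL p u \<in> tangent_space L p" "inc p (JL p u) = \<phi> p (inc p u)"
    using l p by (simp_all add: leaf_endo_def I.lift_def)
qed

sublocale Lm: hausdorff_mfd L
  by unfold_locales (rule L_hausdorff)

lemma bilinear_gL: "bilinear_field L gL"
  unfolding bilinear_field_def
proof (intro conjI allI ballI)
  fix p u assume u: "u \<in> tangent_space L p"
  show "linear_on_subspace (tangent_space L p) (gL p u)"
  proof (cases "p \<in> points L")
    case True
    note i = I.inc_in(1)[OF True]
    show ?thesis
      unfolding linear_on_subspace_def
      using True u by (auto simp: gL I.inc_linear[OF True] bilinear_fieldD[OF g i i i])
  qed (simp add: gL_def linear_on_subspace_def)
  show "linear_on_subspace (tangent_space L p) (\<lambda>v. gL p v u)"
  proof (cases "p \<in> points L")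
    case True
    note i = I.inc_in(1)[OF True]
    show ?thesis
      unfolding linear_on_subspace_def
      using True u by (auto simp: gL I.inc_linear[OF True] bilinear_fieldD[OF g i i i])
  qed (simp add: gL_def linear_on_subspace_def)
next
  fix V W assume V: "V \<in> vector_fields L" and W: "W \<in> vector_fields L"
  show "smooth_fun L (\<lambda>p. gL p (V p) (W p))" unfolding smooth_fun_def
  proof
    fix b assume b: "b \<in> L"
    show "smooth_on ((\<lambda>p. gL p (V p) (W p)) \<circ> coord_inv b) (chart_img b)"
    proof (rule smooth_on_local)
      fix x assume x: "x \<in> chart_img b"
      note bx = I.L.coord_inv_charts_at[OF b x]
      obtain c where c: "c \<in> charts_at M (coord_inv b x)"
        using charts_at_points[OF bx] I.points_subset by (meson chart_atE subsetD)
      note cM = charts_atD(1)[OF c]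
      note S = I.open_idom[OF b cM]
      have "smooth_on ((\<lambda>p. gL p (V p) (W p)) \<circ> coord_inv b) (idom b c)"
      proof (rule smooth_on_cong[OF S])
        show "smooth_on (\<lambda>y. brep M c g (irep b c y) (inc (coord_inv b y) (V (coord_inv b y)) c)
            (inc (coord_inv b y) (W (coord_inv b y)) c)) (idom b c)"
          by (rule smooth_brep_comp[OF g cM S I.smooth_irep[OF b cM] I.idomD(2)[OF b cM]
                I.smooth_inc_vf[OF V b cM] I.smooth_inc_vf[OF W b cM]])
        fix y assume y: "y \<in> idom b c"
        note d = I.idomD[OF b cM y]
        note p = charts_at_points[OF d(4)]
        show "brep M c g (irep b c y) (inc (coord_inv b y) (V (coord_inv b y)) c)
            (inc (coord_inv b y) (W (coord_inv b y)) c) = ((\<lambda>p. gL p (V p) (W p)) \<circ> coord_inv b) y"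
          using brep_coord[OF d(5) I.inc_in(1)[OF p I.L.vf_tangent[OF V]] I.inc_in(1)[OF p I.L.vf_tangent[OF W]], of g]
          by (simp add: gL[OF p] irep_def)
      qed
      moreover have "x \<in> idom b c" using I.idom_memI[OF bx c] I.L.coord_coord_inv[OF x] by simp
      ultimately show "\<exists>T. open T \<and> x \<in> T \<and> smooth_on ((\<lambda>p. gL p (V p) (W p)) \<circ> coord_inv b) T" using S by blast
    qed
  qed
qed

text \<open>A vector tangent to \<open>L\<close> is orthogonal to \<xi>. If it is orthogonal to the
  kernel of \<eta> too, it is orthogonal to the whole tangent space of \<open>M\<close>.\<close>

lemma gL_nondeg:
  assumes p: "p \<in> points L" and u: "u \<in> tangent_space L p"
    and 0: "\<And>v. v \<in> tangent_space L p \<Longrightarrow> gL p u v = 0"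
  shows "u = 0"
proof -
  have pM: "p \<in> points M" using p I.points_subset by blast
  note i = I.inc_in[OF p u]
  have "inc p u = 0"
  proof (rule g_nondeg[OF pM i(1)])
    fix v assume v: "v \<in> tangent_space M p"
    note x = vf_tangent[OF \<xi>, of p]
    define w where "w = v - \<eta> p v *\<^sub>R \<xi> p"
    have w: "w \<in> tangent_space M p" unfolding w_def by (intro tangent_diff v tangent_scaleR x)
    have vw: "v = w + \<eta> p v *\<^sub>R \<xi> p" by (simp add: w_def)
    have "\<eta> p v = \<eta> p w + \<eta> p v"
      using one_formD(1)[OF \<eta> w tangent_scaleR[OF x, of "\<eta> p v"]] one_formD(2)[OF \<eta> x, of "\<eta> p v"] eta_xi[OF pM] vw by simp
    then have "\<eta> p w = 0" by simp
    from I.lift[OF p w this] 0[of "I.lift p w"] have "g p (inc p u) w = 0" by (simp add: gL[OF p])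
    moreover have "g p (inc p u) (\<xi> p) = 0" using g_xi[OF pM i(1)] i(2) by simp
    ultimately show "g p (inc p u) v = 0"
      using bilinear_fieldD(2)[OF g w tangent_scaleR[OF x] i(1), of "\<eta> p v"] bilinear_fieldD(4)[OF g x x i(1), of "\<eta> p v"]
      by (subst vw) simp
  qed
  moreover have "inc p 0 = 0" using I.inc_linear(2)[OF p u u, of 0] by simp
  ultimately show "u = 0" by (intro I.inc_eqI[OF p u I.L.tangent_zero]) simp
qed

sublocale Lm: metric_mfd L gL
proof
  show "bilinear_field L gL" by (rule bilinear_gL)
  fix p u v assume p: "p \<in> points L" and u: "u \<in> tangent_space L p" and v: "v \<in> tangent_space L p"
  have "p \<in> points M" using p I.points_subset by blast
  from g_sym[OF this I.inc_in(1)[OF p u] I.inc_in(1)[OF p v]] show "gL p u v = gL p v u" by (simp add: gL[OF p])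
qed (rule gL_nondeg)

lemma endo_JL: "endo_field L JL"
  unfolding endo_field_def
proof (intro conjI allI ballI)
  fix p
  show "linear_on_subspace (tangent_space L p) (JL p)"
  proof (cases "p \<in> points L")
    case True
    note i = I.inc_in(1)[OF True] and t = I.L.tangent_add I.L.tangent_scaleR JL[OF True]
    show ?thesis unfolding linear_on_subspace_def
    proof (intro conjI ballI allI)
      fix u v assume u: "u \<in> tangent_space L p" and v: "v \<in> tangent_space L p"
      show "JL p (u + v) = JL p u + JL p v"
        by (rule I.inc_eqI[OF True]) (simp_all add: t u v I.inc_linear[OF True] J_add i)
    next
      fix r v assume v: "v \<in> tangent_space L p"
      show "JL p (r *\<^sub>R v) = r *\<^sub>R JL p v"
        by (rule I.inc_eqI[OF True t(3)[OF t(2)[OF v]] t(2)[OF t(3)[OF v]]])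
          (simp add: t(4)[OF t(2)[OF v]] t(4)[OF v] I.inc_linear(2)[OF True v v] J_scale[OF i[OF v]]
            I.inc_linear(2)[OF True t(3)[OF v] t(3)[OF v]])
    qed
  next
    case False
    then show ?thesis by (simp add: linear_on_subspace_def leaf_endo_def)
  qed
  show "JL p ` tangent_space L p \<subseteq> tangent_space L p"
  proof (cases "p \<in> points L")
    case True
    then show ?thesis using JL(1) by blast
  next
    case False
    then show ?thesis using I.L.tangent_zero by (simp add: leaf_endo_def image_subset_iff)
  qed
next
  fix V assume V: "V \<in> vector_fields L"
  show "endo_app JL V \<in> vector_fields L"
  proof (rule I.vf_liftI)
    show "endo_app JL V p \<in> tangent_space L p" for p
    proof (cases "p \<in> points L")
      case True
      then show ?thesis by (simp add: endo_app_apply JL(1)[OF _ I.L.vf_tangent[OF V]])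
    next
      case False
      then have "endo_app JL V p = 0" unfolding endo_app_apply leaf_endo_def by (simp add: fun_eq_iff)
      then show ?thesis using I.L.tangent_zero by metis
    qed
    fix b c assume b: "b \<in> L" and c: "c \<in> M"
    note S = I.open_idom[OF b c]
    show "smooth_on (\<lambda>x. inc (coord_inv b x) (endo_app JL V (coord_inv b x)) c) (idom b c)"
    proof (rule smooth_on_cong[OF S])
      show "smooth_on (\<lambda>y. erep M c \<phi> (irep b c y) (inc (coord_inv b y) (V (coord_inv b y)) c)) (idom b c)"
      proof (rule smooth_on_linear_family[where L = "\<lambda>y. erep M c \<phi> (irep b c y)", OF S
            linear_erep[OF J c I.idomD(2)[OF b c]] _ I.smooth_inc_vf[OF V b c]])
        show "smooth_on (\<lambda>y. erep M c \<phi> (irep b c y) u) (idom b c)" for u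
          by (rule smooth_on_compose[OF S open_chart_img[OF c] _ I.smooth_irep[OF b c] smooth_erep[OF J c]])
            (use I.idomD(2)[OF b c] in blast)
      qed
      fix y assume y: "y \<in> idom b c"
      note d = I.idomD[OF b c y]
      note p = charts_at_points[OF d(4)]
      show "erep M c \<phi> (irep b c y) (inc (coord_inv b y) (V (coord_inv b y)) c)
          = inc (coord_inv b y) (endo_app JL V (coord_inv b y)) c"
        using erep_coord[OF d(5) I.inc_in(1)[OF p I.L.vf_tangent[OF V]], of \<phi>]
        by (simp add: endo_app_apply JL(2)[OF p I.L.vf_tangent[OF V]] irep_def)
    qed
  qed
qed

sublocale Lm: skew_endo_mfd L gL "levi_civita L gL" JL
proof
  show "is_levi_civita L gL (levi_civita L gL)" by (rule Lm.levi_civita)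
  show "endo_field L JL" by (rule endo_JL)
  fix p u v assume p: "p \<in> points L" and u: "u \<in> tangent_space L p" and v: "v \<in> tangent_space L p"
  have "p \<in> points M" using p I.points_subset by blast
  from J_skew[OF this I.inc_in(1)[OF p u] I.inc_in(1)[OF p v]]
  show "gL p (JL p u) v = - gL p u (JL p v)" by (simp add: gL[OF p] JL(2)[OF p] u v)
qed

lemma levi_civita_gL: "levi_civita L (leaf_metric M g L) = levi_civita L gL"
proof -
  have "is_levi_civita L (leaf_metric M g L) = is_levi_civita L gL"
    by (rule is_levi_civita_cong[OF I.L.atlas]) (simp add: gL_def)
  then show ?thesis by (simp add: levi_civita_def)
qed

lemma res_tangential:
  assumes "X \<in> vector_fields M"
  shows "I.res (tangential X) \<in> vector_fields L" "p \<in> points L \<Longrightarrow> inc p (I.res (tangential X) p) = tangential X p"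
  by (rule I.res_vf[OF tangential_vf eta_tangential] I.res_tangent(2)[OF tangential_vf eta_tangential]; use assms in blast)+

section \<open>Comparison of the covariant derivatives on a leaf and on the manifold\<close>

text \<open>For related fields each term of the Koszul formula has the same value on
  \<open>L\<close> and on \<open>M\<close>, so the tangential parts of both connections
  agree.\<close>

lemma nabla_restrict:
  assumes X: "X \<in> vector_fields M" and Y: "Y \<in> vector_fields M" and Z: "Z \<in> vector_fields M"
    and V: "V \<in> vector_fields L" and W: "W \<in> vector_fields L" and U: "U \<in> vector_fields L"
    and VX: "\<And>p. p \<in> points L \<Longrightarrow> inc p (V p) = X p" and WY: "\<And>p. p \<in> points L \<Longrightarrow> inc p (W p) = Y p"
    and UZ: "\<And>p. p \<in> points L \<Longrightarrow> inc p (U p) = Z p" and p: "p \<in> points L"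
  shows "gL p (levi_civita L gL V W p) (U p) = g p (nabla X Y p) (Z p)"
proof -
  have pM: "p \<in> points M" using p I.points_subset by blast
  have d: "vf_deriv L V1 (\<lambda>q. gL q (V2 q) (V3 q)) p = vf_deriv M X1 (\<lambda>q. g q (X2 q) (X3 q)) p"
    if "X1 \<in> vector_fields M" "X2 \<in> vector_fields M" "X3 \<in> vector_fields M" "V1 \<in> vector_fields L"
      "\<And>p. p \<in> points L \<Longrightarrow> inc p (V1 p) = X1 p" "\<And>p. p \<in> points L \<Longrightarrow> inc p (V2 p) = X2 p"
      "\<And>p. p \<in> points L \<Longrightarrow> inc p (V3 p) = X3 p" for X1 X2 X3 V1 V2 V3
  proof -
    have "vf_deriv L V1 (\<lambda>q. gL q (V2 q) (V3 q)) p = vf_deriv L V1 (\<lambda>q. g q (X2 q) (X3 q)) p"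
      by (rule Lm.vf_deriv_cong[OF p]) (simp add: gL that)
    also have "\<dots> = vf_deriv M X1 (\<lambda>q. g q (X2 q) (X3 q)) p"
      by (rule I.vf_deriv_inc[OF that(1,4) that(5)[OF p] bilinear_field_smooth[OF g that(2,3)] p])
    finally show ?thesis .
  qed
  have "koszul L gL V W U p = koszul M g X Y Z p"
    unfolding koszul_def
    using d[OF X Y Z V VX WY UZ] d[OF Y X Z W WY VX UZ] d[OF Z X Y U UZ VX WY]
    by (simp add: gL[OF p] VX[OF p] WY[OF p] UZ[OF p] I.inc_bracket[OF X Y V W VX WY p]
        I.inc_bracket[OF X Z V U VX UZ p] I.inc_bracket[OF Y Z W U WY UZ p])
  then show ?thesis using Lm.nabla_koszul[OF V W U p] nabla_koszul[OF X Y Z pM] by simp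
qed

text \<open>\<open>DJ_pair\<close> moves the outer endomorphism onto the test field, so only
  products of connections with tangent fields remain, and these are covered by
  \<open>nabla_restrict\<close>.\<close>

lemma DJ_restrict:
  assumes X: "X \<in> vector_fields M" and Y: "Y \<in> vector_fields M" and Z: "Z \<in> vector_fields M"
    and V: "V \<in> vector_fields L" and W: "W \<in> vector_fields L" and U: "U \<in> vector_fields L"
    and VX: "\<And>p. p \<in> points L \<Longrightarrow> inc p (V p) = X p" and WY: "\<And>p. p \<in> points L \<Longrightarrow> inc p (W p) = Y p"
    and UZ: "\<And>p. p \<in> points L \<Longrightarrow> inc p (U p) = Z p" and p: "p \<in> points L"
  shows "gL p (Lm.DJ V W p) (U p) = g p (DJ X Y p) (Z p)"
proof -
  have pM: "p \<in> points M" using p I.points_subset by blast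
  have JR: "inc p (endo_app JL W' p) = endo_app \<phi> Y' p"
    if "p \<in> points L" "W' \<in> vector_fields L" "inc p (W' p) = Y' p" for p W' Y'
    using JL(2)[OF that(1) I.L.vf_tangent[OF that(2)]] that(3) by (simp add: endo_app_apply)
  have "gL p (levi_civita L gL V (endo_app JL W) p) (U p) = g p (nabla X (endo_app \<phi> Y) p) (Z p)"
    by (rule nabla_restrict[OF X J_vf[OF Y] Z V Lm.J_vf[OF W] U VX _ UZ p]) (simp_all add: JR W WY)
  moreover have "gL p (levi_civita L gL V W p) (endo_app JL U p) = g p (nabla X Y p) (endo_app \<phi> Z p)"
    by (rule nabla_restrict[OF X Y J_vf[OF Z] V W Lm.J_vf[OF U] VX WY _ p]) (simp_all add: JR U UZ)
  ultimately show ?thesis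
    using Lm.DJ_pair[OF V W U p] DJ_pair[OF X Y Z pM] by (simp add: endo_app_apply)
qed

lemma para_kaehler_iff:
  "para_kaehler L JL (leaf_metric M g L) \<longleftrightarrow>
    (\<forall>X\<in>vector_fields M. \<forall>Y\<in>vector_fields M. \<forall>Z\<in>vector_fields M. \<forall>p\<in>points L.
      g p (DJ (tangential X) (tangential Y) p) (tangential Z p) = 0)"
proof
  assume pk: "para_kaehler L JL (leaf_metric M g L)"
  show "\<forall>X\<in>vector_fields M. \<forall>Y\<in>vector_fields M. \<forall>Z\<in>vector_fields M. \<forall>p\<in>points L.
      g p (DJ (tangential X) (tangential Y) p) (tangential Z p) = 0"
  proof (intro ballI)
    fix X Y Z p assume X: "X \<in> vector_fields M" and Y: "Y \<in> vector_fields M" and Z: "Z \<in> vector_fields M"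
      and p: "p \<in> points L"
    note r = res_tangential[OF X] res_tangential[OF Y] res_tangential[OF Z]
    have "Lm.DJ (I.res (tangential X)) (I.res (tangential Y)) p = 0"
      using pk r(1,3) p unfolding para_kaehler_def levi_civita_gL by blast
    moreover have "gL p 0 (I.res (tangential Z) p) = 0"
      using Lm.bilinear_fieldD(3)[OF bilinear_gL I.L.tangent_zero I.L.tangent_zero I.L.vf_tangent[OF r(5)], of p 0] by simp
    ultimately show "g p (DJ (tangential X) (tangential Y) p) (tangential Z p) = 0"
      using DJ_restrict[OF tangential_vf[OF X] tangential_vf[OF Y] tangential_vf[OF Z] r(1,3,5) r(2,4,6) p] by simp
  qed
next
  assume zero: "\<forall>X\<in>vector_fields M. \<forall>Y\<in>vector_fields M. \<forall>Z\<in>vector_fields M. \<forall>p\<in>points L.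
      g p (DJ (tangential X) (tangential Y) p) (tangential Z p) = 0"
  have "Lm.DJ V W p = 0" if V: "V \<in> vector_fields L" and W: "W \<in> vector_fields L" and p: "p \<in> points L" for V W p
  proof -
    \<comment> \<open>Only the value at \<open>p\<close> is matched; tensoriality of
      \<open>Lm.DJ\<close> makes that enough.\<close>
    have ext: "\<exists>X\<in>vector_fields M. I.res (tangential X) p = V p" if V: "V \<in> vector_fields L" for V
    proof -
      note i = I.inc_in[OF p I.L.vf_tangent[OF V]]
      obtain X where X: "X \<in> vector_fields M" "X p = inc p (V p)" using i(1) by (rule extend_tangent) (rule that)
      have "inc p (I.res (tangential X) p) = inc p (V p)"
        using res_tangential(2)[OF X(1) p] i(2) X(2) by (simp add: tangential_apply)
      then have "I.res (tangential X) p = V p"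
        by (rule I.inc_eqI[OF p I.L.vf_tangent[OF res_tangential(1)[OF X(1)]] I.L.vf_tangent[OF V]])
      then show ?thesis using X(1) by blast
    qed
    obtain X where X: "X \<in> vector_fields M" "I.res (tangential X) p = V p" using ext[OF V] by blast
    obtain Y where Y: "Y \<in> vector_fields M" "I.res (tangential Y) p = W p" using ext[OF W] by blast
    note r = res_tangential[OF X(1)] res_tangential[OF Y(1)]
    have eq: "Lm.DJ V W p = Lm.DJ (I.res (tangential X)) (I.res (tangential Y)) p"
      by (rule Lm.DJ_pointwise[OF V r(1) W r(3) p]) (simp_all add: X Y)
    show ?thesis
    proof (rule Lm.tangent_eq_fieldI[OF p I.L.vf_tangent[OF Lm.DJ_vf[OF V W]] I.L.tangent_zero])
      fix U assume U: "U \<in> vector_fields L"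
      obtain Z where Z: "Z \<in> vector_fields M" "I.res (tangential Z) p = U p" using ext[OF U] by blast
      note rZ = res_tangential[OF Z(1)]
      have "gL p (Lm.DJ V W p) (U p) = 0"
        using DJ_restrict[OF tangential_vf[OF X(1)] tangential_vf[OF Y(1)] tangential_vf[OF Z(1)] r(1,3) rZ(1) r(2,4) rZ(2) p]
          zero X(1) Y(1) Z p eq by simp
      moreover have "gL p 0 (U p) = 0"
        using Lm.bilinear_fieldD(3)[OF bilinear_gL I.L.tangent_zero I.L.tangent_zero I.L.vf_tangent[OF U], of p 0] by simp
      ultimately show "gL p (Lm.DJ V W p) (U p) = gL p 0 (U p)" by simp
    qed
  qed
  then show "para_kaehler L JL (leaf_metric M g L)" unfolding para_kaehler_def levi_civita_gL by blast
qed

end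

section \<open>Leaves of a closed one-form\<close>

text \<open>Identifies the model space of the leaves with the kernel of \<mu>. As \<mu> is the inner
  product with a nonzero vector, its kernel has the required dimension.\<close>

lemma hyperplane_parametrization:
  fixes \<mu> :: "'m::euclidean_space \<Rightarrow> real"
  assumes lin: "linear \<mu>" and nz: "\<mu> e \<noteq> 0" and dim: "DIM('m) = DIM('l::euclidean_space) + 1"
  obtains \<kappa> :: "'l::euclidean_space \<Rightarrow> 'm" and P where "linear \<kappa>" "linear P" "\<And>u. \<mu> (\<kappa> u) = 0" "\<And>u. P (\<kappa> u) = u"
    "\<And>z. \<mu> z = 0 \<Longrightarrow> \<kappa> (P z) = z"
proof -
  define a where "a = (\<Sum>b\<in>Basis. \<mu> b *\<^sub>R b)"
  have \<mu>: "\<mu> z = a \<bullet> z" for z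
    by (subst linear_euclid_expand[OF lin]) (simp add: a_def inner_sum_left inner_commute[of z] mult.commute)
  have "a \<noteq> 0" using nz by (auto simp: \<mu>)
  then have "dim {z. \<mu> z = 0} = DIM('l)" using dim_hyperplane[of a] dim by (simp add: \<mu>)
  moreover have "subspace {z. \<mu> z = 0}" unfolding \<mu> by (rule subspace_hyperplane)
  ultimately obtain \<kappa> :: "'l \<Rightarrow> 'm" where \<kappa>: "linear \<kappa>" "\<kappa> ` UNIV = {z. \<mu> z = 0}" "inj_on \<kappa> UNIV"
    using subspace_isomorphism[of "UNIV :: 'l set" "{z. \<mu> z = 0}"] by (metis dim_UNIV subspace_UNIV)
  obtain P where P: "linear P" "P \<circ> \<kappa> = id" using linear_injective_left_inverse[OF \<kappa>(1,3)] by blast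
  have Pk: "P (\<kappa> u) = u" for u using P(2) by (simp add: fun_eq_iff)
  show thesis
  proof (rule that[OF \<kappa>(1) P(1) _ Pk])
    show "\<mu> (\<kappa> u) = 0" for u using \<kappa>(2) by blast
    show "\<kappa> (P z) = z" if "\<mu> z = 0" for z
    proof -
      obtain u where "z = \<kappa> u" using \<kappa>(2) \<open>\<mu> z = 0\<close> by blast
      then show ?thesis using Pk by simp
    qed
  qed
qed

text \<open>If \<open>df = \<omega>\<close>, then \<open>x - x0\<close> corrected along a vector transverse to the kernel of \<open>\<omega>\<close> at
  \<open>x0\<close> turns \<open>f\<close> into a linear function.\<close>

lemma straighten_closed_form:
  fixes \<omega> :: "'a::euclidean_space \<Rightarrow> 'a \<Rightarrow> real"
  assumes r: "0 < r" and sm: "\<And>u. smooth_on (\<lambda>x. \<omega> x u) (ball x0 r)"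
    and lin: "\<And>x. x \<in> ball x0 r \<Longrightarrow> linear (\<omega> x)"
    and closed: "\<And>x u v. x \<in> ball x0 r \<Longrightarrow> fderiv (\<lambda>x. \<omega> x u) x v = fderiv (\<lambda>x. \<omega> x v) x u"
    and nz: "\<omega> x0 e0 \<noteq> 0"
  obtains B V \<Psi> G \<mu> where "open B" "x0 \<in> B" "B \<subseteq> ball x0 r" "open V" "\<Psi> ` B = V" "G ` V = B"
    "\<And>x. x \<in> B \<Longrightarrow> G (\<Psi> x) = x" "\<And>y. y \<in> V \<Longrightarrow> \<Psi> (G y) = y" "smooth_on \<Psi> B" "smooth_on G V"
    "\<And>x. x \<in> B \<Longrightarrow> inj (fderiv \<Psi> x)" "\<Psi> x0 = 0" "linear \<mu>" "\<mu> e0 \<noteq> 0"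
    "\<And>x u. x \<in> B \<Longrightarrow> \<mu> (fderiv \<Psi> x u) = \<omega> x u"
proof -
  obtain f where f: "\<And>x. x \<in> ball x0 r \<Longrightarrow> (f has_derivative \<omega> x) (at x)"
    using closed_one_form_primitive[OF sm lin closed] by metis
  have smf: "smooth_on f (ball x0 r)" unfolding smooth_on_def
  proof
    fix k show "Ck_on k f (ball x0 r)"
    proof (cases k)
      case 0
      then show ?thesis using f by (auto intro!: continuous_at_imp_continuous_on has_derivative_continuous)
    next
      case (Suc l)
      show ?thesis unfolding Suc
        by (rule Ck_on_Suc_intro[OF open_ball f]) (use sm in \<open>auto simp: smooth_on_def\<close>)
    qed
  qed
  define \<mu> where "\<mu> = \<omega> x0"
  have x0: "x0 \<in> ball x0 r" using r by simp
  have lam: "linear \<mu>" unfolding \<mu>_def by (rule lin[OF x0])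
  \<comment> \<open>Scaled to \<open>\<mu> e = 1\<close>, which makes
    \<open>\<mu> (\<Psi> x) = f x - f x0\<close>.\<close>
  define e where "e = (1 / \<mu> e0) *\<^sub>R e0"
  have e: "\<mu> e = 1" using nz linear_cmul[OF lam] by (simp add: e_def \<mu>_def)
  define \<Psi> where "\<Psi> x = (x - x0) + (f x - f x0 - \<mu> (x - x0)) *\<^sub>R e" for x
  have bl: "bounded_linear \<mu>" using lam linear_conv_bounded_linear by blast
  have dPsi: "(\<Psi> has_derivative (\<lambda>v. v + (\<omega> x v - \<mu> v) *\<^sub>R e)) (at x)" if "x \<in> ball x0 r" for x
  proof -
    have "((\<lambda>x. x - x0) has_derivative (\<lambda>v. v)) (at x)" by (auto intro!: derivative_eq_intros)
    note d = this bounded_linear.has_derivative[OF bl this]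
    have "(\<Psi> has_derivative (\<lambda>v. v + (\<omega> x v - 0 - \<mu> v) *\<^sub>R e)) (at x)" unfolding \<Psi>_def
      by (intro has_derivative_add d has_derivative_scaleR_left has_derivative_diff f[OF that] has_derivative_const)
    then show ?thesis by simp
  qed
  have smPsi: "smooth_on \<Psi> (ball x0 r)" unfolding \<Psi>_def
    by (intro smooth_on_add smooth_on_diff smooth_on_scaleR smooth_on_const smooth_on_id smf open_ball
        smooth_on_linear_comp[OF bl])
  \<comment> \<open>The correction along \<open>e\<close> has zero derivative at \<open>x0\<close>,
    because \<mu> is the value of \<omega> there.\<close>
  have "fderiv \<Psi> x0 = (\<lambda>v. v)" using fderiv_eq[OF dPsi[OF x0]] by (simp add: \<mu>_def)
  then have "inj (fderiv \<Psi> x0)" by (simp add: inj_def)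
  obtain B V G where *: "open B" "x0 \<in> B" "B \<subseteq> ball x0 r" "open V" "\<Psi> ` B = V" "G ` V = B"
    "\<And>x. x \<in> B \<Longrightarrow> G (\<Psi> x) = x" "\<And>y. y \<in> V \<Longrightarrow> \<Psi> (G y) = y" "smooth_on G V"
    "\<And>x. x \<in> B \<Longrightarrow> inj (fderiv \<Psi> x)"
    by (rule smooth_local_inverse[OF smPsi open_ball x0 \<open>inj (fderiv \<Psi> x0)\<close>]) (rule that)
  show thesis
  proof (rule that[OF *(1-8) smooth_on_subset[OF smPsi *(1,3)] *(9,10) _ lam])
    show "\<Psi> x0 = 0" using linear_0[OF lam] by (simp add: \<Psi>_def)
    show "\<mu> e0 \<noteq> 0" using nz by (simp add: \<mu>_def)
    show "\<mu> (fderiv \<Psi> x u) = \<omega> x u" if "x \<in> B" for x u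
    proof -
      have "x \<in> ball x0 r" using that *(3) by blast
      from fderiv_eq[OF dPsi[OF this]] show ?thesis
        by (simp add: linear_add[OF lam] linear_cmul[OF lam] e)
    qed
  qed
qed

section \<open>Flat boxes and compatibility of integral manifolds\<close>

locale closed_form_mfd = M: hausdorff_mfd M for M :: "('p, 'm::euclidean_space) atlas" +
  fixes \<eta> :: "('p, 'm) form1" and \<xi> :: "('p, 'm) vfield"
  assumes one_form: "one_form M \<eta>" and transverse: "\<xi> \<in> vector_fields M" "\<And>p. p \<in> points M \<Longrightarrow> \<eta> p (\<xi> p) \<noteq> 0"
    and closed: "\<And>X Y p. X \<in> vector_fields M \<Longrightarrow> Y \<in> vector_fields M \<Longrightarrow> p \<in> points M \<Longrightarrow> ext_deriv1 M \<eta> X Y p = 0"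
begin

text \<open>Test closedness on two fields with constant components near the point: their bracket
  vanishes there, and what remains is the symmetry of the derivatives of the coefficients.\<close>

lemma frep_closed:
  assumes c: "c \<in> M" and x: "x \<in> chart_img c"
  shows "fderiv (\<lambda>x. frep M c \<eta> x u) x v = fderiv (\<lambda>x. frep M c \<eta> x v) x u"
proof -
  define p where "p = coord_inv c x"
  have cp: "c \<in> charts_at M p" unfolding p_def by (rule M.coord_inv_charts_at[OF c x])
  have xp: "coord c p = x" unfolding p_def by (rule M.coord_coord_inv[OF x])
  obtain X S where X: "X \<in> vector_fields M" "open S" "coord c p \<in> S" "S \<subseteq> chart_img c"
    "\<And>x. x \<in> S \<Longrightarrow> vrep c X x = u" by (rule M.extend_constant_field[OF cp, where u = u]) (rule that)
  obtain Y T where Y: "Y \<in> vector_fields M" "open T" "coord c p \<in> T" "T \<subseteq> chart_img c"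
    "\<And>x. x \<in> T \<Longrightarrow> vrep c Y x = v" by (rule M.extend_constant_field[OF cp, where u = v]) (rule that)
  have at: "X p c = u" "Y p c = v" using X(3,5) Y(3,5) M.vrep_coord[OF cp] by metis+
  have const: "fderiv (vrep c Z) x w = 0" if "open S" "coord c p \<in> S" "\<And>x. x \<in> S \<Longrightarrow> vrep c Z x = k" for Z S k w
  proof -
    have "fderiv (vrep c Z) x = fderiv (\<lambda>x. k) x" by (rule fderiv_cong[OF that(1)]) (use that xp in auto)
    then show ?thesis by (simp add: fderiv_eq[OF has_derivative_const])
  qed
  have "lie_bracket M X Y p = 0"
    by (rule M.tangent_eqI[OF M.vf_tangent[OF M.vf_lie_bracket[OF X(1) Y(1)]] M.tangent_zero cp])
      (simp add: M.lie_bracket_chart[OF cp] xp const[OF X(2,3,5)] const[OF Y(2,3,5)])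
  moreover have "\<eta> p 0 = 0" using M.one_formD(2)[OF one_form M.tangent_zero, of p 0] by simp
  ultimately have eq: "vf_deriv M X (\<lambda>q. \<eta> q (Y q)) p = vf_deriv M Y (\<lambda>q. \<eta> q (X q)) p"
    using closed[OF X(1) Y(1) charts_at_points[OF cp]] by (simp add: ext_deriv1_def)
  have d: "vf_deriv M Z (\<lambda>q. \<eta> q (W q)) p = fderiv (\<lambda>x. frep M c \<eta> x k) x (Z p c)"
    if Z: "Z \<in> vector_fields M" and W: "W \<in> vector_fields M" "open S" "coord c p \<in> S" "S \<subseteq> chart_img c"
      "\<And>x. x \<in> S \<Longrightarrow> vrep c W x = k" for Z W S k
  proof -
    have D: "((\<lambda>x. frep M c \<eta> x k) has_derivative fderiv (\<lambda>x. frep M c \<eta> x k) x) (at (coord c p))"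
      unfolding xp by (rule smooth_on_has_derivative[OF M.smooth_frep[OF one_form c] M.open_chart_img[OF c] x])
    have "((\<lambda>q. \<eta> q (W q)) \<circ> coord_inv c has_derivative fderiv (\<lambda>x. frep M c \<eta> x k) x) (at (coord c p))"
    proof (rule has_derivative_transform_within_open[OF D W(2,3)])
      fix y assume y: "y \<in> S"
      then have "y \<in> chart_img c" using W(4) by blast
      from M.frep_vrep[OF W(1) c this, of \<eta>] W(5)[OF y]
      show "frep M c \<eta> y k = ((\<lambda>q. \<eta> q (W q)) \<circ> coord_inv c) y" by simp
    qed
    from M.vf_deriv_chart[OF cp Z this] show ?thesis .
  qed
  show ?thesis using d[OF X(1) Y] d[OF Y(1) X] eq at by simp
qed

text \<open>A Frobenius chart for a closed form: \<open>\<Psi>\<close>, with inverse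
  \<open>G\<close>, straightens \<eta> on \<open>B\<close> to the constant covector \<mu>, so
  integral manifolds run locally in level sets of \<open>\<mu> \<circ> \<Psi>\<close>.\<close>

definition flat_box ::
  "('p, 'm) chart \<Rightarrow> 'p \<Rightarrow> 'm set \<Rightarrow> 'm set \<Rightarrow> ('m \<Rightarrow> 'm) \<Rightarrow> ('m \<Rightarrow> 'm) \<Rightarrow> ('m \<Rightarrow> real) \<Rightarrow> bool" where
  "flat_box c p B V \<Psi> G \<mu> \<longleftrightarrow>
    open B \<and> coord c p \<in> B \<and> B \<subseteq> chart_img c \<and> open V \<and> \<Psi> ` B = V \<and> G ` V = B \<and>
    (\<forall>x\<in>B. G (\<Psi> x) = x) \<and> (\<forall>y\<in>V. \<Psi> (G y) = y) \<and> smooth_on \<Psi> B \<and> smooth_on G V \<and>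
    (\<forall>x\<in>B. inj (fderiv \<Psi> x)) \<and> \<Psi> (coord c p) = 0 \<and> linear \<mu> \<and> (\<exists>e. \<mu> e \<noteq> 0) \<and>
    (\<forall>x\<in>B. \<forall>u. \<mu> (fderiv \<Psi> x u) = frep M c \<eta> x u)"

lemma flat_box_exists:
  assumes c: "c \<in> charts_at M p"
  shows "\<exists>B V \<Psi> G \<mu>. flat_box c p B V \<Psi> G \<mu>"
proof -
  note cM = charts_atD(1)[OF c]
  obtain r where r: "0 < r" "ball (coord c p) r \<subseteq> chart_img c"
    using M.open_chart_img[OF cM] M.coord_in_img[OF c] open_contains_ball by blast
  have nz: "frep M c \<eta> (coord c p) (\<xi> p c) \<noteq> 0"
    using M.frep_coord[OF c M.vf_tangent[OF transverse(1)], of \<eta>] transverse(2)[OF charts_at_points[OF c]] by simp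
  show ?thesis
  proof (rule straighten_closed_form[where \<omega> = "frep M c \<eta>", OF r(1) _ _ _ nz])
    show "smooth_on (\<lambda>x. frep M c \<eta> x u) (ball (coord c p) r)" for u
      by (rule smooth_on_subset[OF M.smooth_frep[OF one_form cM] open_ball r(2)])
    show "linear (frep M c \<eta> x)" if "x \<in> ball (coord c p) r" for x
      using M.linear_frep[OF one_form cM] that r(2) by blast
    show "fderiv (\<lambda>x. frep M c \<eta> x u) x v = fderiv (\<lambda>x. frep M c \<eta> x v) x u" if "x \<in> ball (coord c p) r" for x u v
      using frep_closed[OF cM] that r(2) by blast
  next
    fix B V \<Psi> G \<mu> assume *: "open B" "coord c p \<in> B" "B \<subseteq> ball (coord c p) r" "open V" "\<Psi> ` B = V" "G ` V = B"
      "\<And>x. x \<in> B \<Longrightarrow> G (\<Psi> x) = x" "\<And>y. y \<in> V \<Longrightarrow> \<Psi> (G y) = y" "smooth_on \<Psi> B" "smooth_on G V"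
      "\<And>x. x \<in> B \<Longrightarrow> inj (fderiv \<Psi> x)" "\<Psi> (coord c p) = 0" "linear \<mu>" "\<mu> (\<xi> p c) \<noteq> 0"
      "\<And>x u. x \<in> B \<Longrightarrow> \<mu> (fderiv \<Psi> x u) = frep M c \<eta> x u"
    have "flat_box c p B V \<Psi> G \<mu>" unfolding flat_box_def
      using * r(2) by (intro conjI ballI allI exI[of _ "\<xi> p c"]) (assumption | blast)+
    then show ?thesis by blast
  qed
qed

lemma flat_boxD:
  assumes "flat_box c p B V \<Psi> G \<mu>"
  shows "open B" "coord c p \<in> B" "B \<subseteq> chart_img c" "open V" "\<Psi> ` B = V" "G ` V = B"
    "\<And>x. x \<in> B \<Longrightarrow> G (\<Psi> x) = x" "\<And>y. y \<in> V \<Longrightarrow> \<Psi> (G y) = y" "smooth_on \<Psi> B" "smooth_on G V"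
    "\<And>x. x \<in> B \<Longrightarrow> inj (fderiv \<Psi> x)" "\<Psi> (coord c p) = 0" "linear \<mu>" "\<exists>e. \<mu> e \<noteq> 0"
    "\<And>x u. x \<in> B \<Longrightarrow> \<mu> (fderiv \<Psi> x u) = frep M c \<eta> x u"
  using assms unfolding flat_box_def by simp_all

text \<open>The derivative of \<open>\<mu> \<circ> \<Psi> \<circ> irep b c\<close> is \<eta> on
  vectors tangent to \<open>L\<close>, hence zero. On a ball the function is constant, and its value
  at the centre is 0 because \<open>\<Psi>\<close> sends the centre to the origin.\<close>

lemma integral_mfd_flat:
  fixes L :: "('p, 'l::euclidean_space) atlas"
  assumes L: "integral_mfd M L \<eta>" and b: "b \<in> charts_at L p" and c: "c \<in> charts_at M p"
    and box: "flat_box c p B V \<Psi> G \<mu>"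
  obtains S where "open S" "coord b p \<in> S" "S \<subseteq> idom b c" "\<And>u. u \<in> S \<Longrightarrow> irep b c u \<in> B"
    "\<And>u. u \<in> S \<Longrightarrow> \<mu> (\<Psi> (irep b c u)) = 0"
proof -
  interpret I: integral_mfd M L \<eta> by (rule L)
  note bL = charts_atD(1)[OF b] and cM = charts_atD(1)[OF c]
  note bx = flat_boxD[OF box]
  have "open (idom b c \<inter> irep b c -` B)"
    by (rule continuous_open_preimage[OF smooth_on_continuous[OF I.smooth_irep[OF bL cM]] I.open_idom[OF bL cM] bx(1)])
  moreover have "coord b p \<in> idom b c \<inter> irep b c -` B"
    using I.idom_memI[OF b c] bx(2) by (simp add: I.irep_coord[OF b])
  ultimately obtain r where r: "0 < r" "ball (coord b p) r \<subseteq> idom b c \<inter> irep b c -` B"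
    using open_contains_ball by metis
  let ?S = "ball (coord b p) r"
  have d0: "((\<lambda>u. \<mu> (\<Psi> (irep b c u))) has_derivative (\<lambda>v. 0)) (at u)" if u: "u \<in> ?S" for u
  proof -
    have u': "u \<in> idom b c" "irep b c u \<in> B" using u r by blast+
    have "((\<lambda>u. \<mu> (\<Psi> (irep b c u))) has_derivative (\<lambda>v. \<mu> (fderiv \<Psi> (irep b c u) (fderiv (irep b c) u v)))) (at u)"
      by (rule bounded_linear.has_derivative[OF linear_conv_bounded_linear[THEN iffD1, OF bx(13)]
          has_derivative_compose[OF smooth_on_has_derivative[OF I.smooth_irep[OF bL cM] I.open_idom[OF bL cM] u'(1)]
            smooth_on_has_derivative[OF bx(9,1) u'(2)]]])
    then show ?thesis by (simp add: bx(15)[OF u'(2)] I.irep_at(3)[OF bL cM u'(1)])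
  qed
  have c0: "coord b p \<in> ?S" using r by simp
  show thesis
  proof (rule that[OF open_ball c0])
    show "?S \<subseteq> idom b c" "\<And>u. u \<in> ?S \<Longrightarrow> irep b c u \<in> B" using r by blast+
    fix u assume u: "u \<in> ?S"
    have "\<mu> (\<Psi> (irep b c u)) = \<mu> (\<Psi> (irep b c (coord b p)))"
      by (rule has_derivative_zero_unique_connected[OF open_ball connected_ball d0 u c0])
    then show "\<mu> (\<Psi> (irep b c u)) = 0" by (simp add: I.irep_coord[OF b] bx(12) linear_0[OF bx(13)])
  qed
qed

text \<open>In a flat box both integral manifolds are open parts of the same linear hyperplane.\<close>

lemma integral_mfd_compatible:
  fixes L1 L2 :: "('p, 'l::euclidean_space) atlas"
  assumes dim: "DIM('m) = DIM('l) + 1"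
    and L1: "integral_mfd M L1 \<eta>" and L2: "integral_mfd M L2 \<eta>"
    and b1: "b1 \<in> charts_at L1 p" and b2: "b2 \<in> charts_at L2 p"
  obtains W where "open W" "coord b2 p \<in> W" "W \<subseteq> overlap b2 b1" "smooth_on (transition b2 b1) W"
proof -
  interpret I1: integral_mfd M L1 \<eta> by (rule L1)
  interpret I2: integral_mfd M L2 \<eta> by (rule L2)
  have "p \<in> points M" using I1.points_subset charts_at_points[OF b1] by blast
  then obtain c where c: "c \<in> charts_at M p" by (rule chart_atE)
  note b1L = charts_atD(1)[OF b1] and b2L = charts_atD(1)[OF b2] and cM = charts_atD(1)[OF c]
  obtain B V \<Psi> G \<mu> where box: "flat_box c p B V \<Psi> G \<mu>" using flat_box_exists[OF c] by blast
  note bx = flat_boxD[OF box]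
  obtain e where e: "\<mu> e \<noteq> 0" using bx(14) by blast
  obtain \<kappa> :: "'l \<Rightarrow> 'm" and P
    where \<kappa>: "linear \<kappa>" "linear P" "\<And>u. \<mu> (\<kappa> u) = 0" "\<And>u. P (\<kappa> u) = u" "\<And>z. \<mu> z = 0 \<Longrightarrow> \<kappa> (P z) = z"
    by (rule hyperplane_parametrization[OF bx(13) e dim]) (rule that)
  have Pb: "bounded_linear P" using \<kappa>(2) linear_conv_bounded_linear by blast
  obtain S1 where S1: "open S1" "coord b1 p \<in> S1" "S1 \<subseteq> idom b1 c" "\<And>u. u \<in> S1 \<Longrightarrow> irep b1 c u \<in> B"
    "\<And>u. u \<in> S1 \<Longrightarrow> \<mu> (\<Psi> (irep b1 c u)) = 0" by (rule integral_mfd_flat[OF L1 b1 c box]) (rule that)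
  obtain S2 where S2: "open S2" "coord b2 p \<in> S2" "S2 \<subseteq> idom b2 c" "\<And>u. u \<in> S2 \<Longrightarrow> irep b2 c u \<in> B"
    "\<And>u. u \<in> S2 \<Longrightarrow> \<mu> (\<Psi> (irep b2 c u)) = 0" by (rule integral_mfd_flat[OF L2 b2 c box]) (rule that)
  \<comment> \<open>\<open>i\<close> and \<open>j\<close> describe the two integral manifolds in
    common coordinates on the hyperplane.\<close>
  define i where "i u = P (\<Psi> (irep b1 c u))" for u
  define j where "j u = P (\<Psi> (irep b2 c u))" for u
  have si: "smooth_on i S1" unfolding i_def
    by (rule smooth_on_linear_comp[OF Pb S1(1)], rule smooth_on_compose[OF S1(1) bx(1) _ _ bx(9)])
      (use S1(4) in blast, rule smooth_on_subset[OF I1.smooth_irep[OF b1L cM] S1(1,3)])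
  have sj: "smooth_on j S2" unfolding j_def
    by (rule smooth_on_linear_comp[OF Pb S2(1)], rule smooth_on_compose[OF S2(1) bx(1) _ _ bx(9)])
      (use S2(4) in blast, rule smooth_on_subset[OF I2.smooth_irep[OF b2L cM] S2(1,3)])
  \<comment> \<open>Applying \<open>P\<close> loses nothing, since the derivatives of
    \<open>\<Psi> \<circ> irep b1 c\<close> lie in the kernel of \<mu>, on which \<open>P\<close> is
    injective.\<close>
  have "inj (fderiv i (coord b1 p))"
  proof (rule injI)
    fix v w assume eq: "fderiv i (coord b1 p) v = fderiv i (coord b1 p) w"
    have x: "coord b1 p \<in> idom b1 c" "irep b1 c (coord b1 p) \<in> B" using S1 by blast+
    let ?D = "\<lambda>v. fderiv \<Psi> (coord c p) (fderiv (irep b1 c) (coord b1 p) v)"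
    have D0: "((\<lambda>u. \<Psi> (irep b1 c u)) has_derivative
        (\<lambda>v. fderiv \<Psi> (irep b1 c (coord b1 p)) (fderiv (irep b1 c) (coord b1 p) v))) (at (coord b1 p))"
      by (rule has_derivative_compose[OF I1.irep_deriv[OF b1 c] smooth_on_has_derivative[OF bx(9,1) x(2)]])
    then have D: "((\<lambda>u. \<Psi> (irep b1 c u)) has_derivative ?D) (at (coord b1 p))" by (simp add: I1.irep_coord[OF b1])
    have "fderiv i (coord b1 p) v = P (?D v)" for v
      using fderiv_eq[OF bounded_linear.has_derivative[OF Pb D]] by (simp add: i_def[abs_def])
    moreover have "\<mu> (?D v) = 0" for v
      using bx(15)[OF bx(2)] I1.irep_at(3)[OF b1L cM x(1)] by (simp add: I1.irep_coord[OF b1])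
    ultimately have "?D v = ?D w" using \<kappa>(5) eq by metis
    then have "fderiv (irep b1 c) (coord b1 p) v = fderiv (irep b1 c) (coord b1 p) w"
      using bx(11)[OF bx(2)] by (auto dest: injD)
    then show "v = w" using I1.inj_irep[OF b1 c] by (auto dest: injD)
  qed
  note inj_i = this
  obtain U1 V1 h where h: "open U1" "coord b1 p \<in> U1" "U1 \<subseteq> S1" "open V1"
    "i ` U1 = V1" "h ` V1 = U1" "\<And>x. x \<in> U1 \<Longrightarrow> h (i x) = x" "\<And>y. y \<in> V1 \<Longrightarrow> i (h y) = y" "smooth_on h V1"
      "\<And>x. x \<in> U1 \<Longrightarrow> inj (fderiv i x)" by (rule smooth_local_inverse[OF si S1(1,2) inj_i]) (rule that)
  \<comment> \<open>The points of the second manifold whose hyperplane coordinate is attained by the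
    first; there the transition map is \<open>h \<circ> j\<close>.\<close>
  define W where "W = S2 \<inter> j -` V1"
  have oW: "open W" unfolding W_def by (rule continuous_open_preimage[OF smooth_on_continuous[OF sj] S2(1) h(4)])
  have WS: "W \<subseteq> S2" by (auto simp: W_def)
  have k: "coord_inv b1 (h (j w)) = coord_inv b2 w" "h (j w) \<in> S1" if w: "w \<in> W" for w
  proof -
    have w': "w \<in> S2" "j w \<in> V1" using w by (auto simp: W_def)
    then show u: "h (j w) \<in> S1" using h(3,6) by blast
    have "i (h (j w)) = j w" using h(8) w'(2) .
    then have "\<Psi> (irep b1 c (h (j w))) = \<Psi> (irep b2 c w)"
      using \<kappa>(5)[OF S1(5)[OF u]] \<kappa>(5)[OF S2(5)[OF w'(1)]] by (simp add: i_def j_def)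
    then have "irep b1 c (h (j w)) = irep b2 c w" using bx(7)[OF S1(4)[OF u]] bx(7)[OF S2(4)[OF w'(1)]] by metis
    then show "coord_inv b1 (h (j w)) = coord_inv b2 w"
      using I1.idomD(3)[OF b1L cM subsetD[OF S1(3) u]] I2.idomD(3)[OF b2L cM subsetD[OF S2(3) w'(1)]] by simp
  qed
  have sub: "w \<in> overlap b2 b1" "transition b2 b1 w = h (j w)" if w: "w \<in> W" for w
  proof -
    have "h (j w) \<in> idom b1 c" "w \<in> idom b2 c" using k(2)[OF w] S1(3) S2(3) WS w by blast+
    note d1 = I1.idomD[OF b1L cM this(1)] and d2 = I2.idomD[OF b2L cM this(2)]
    have "coord_inv b2 w \<in> chart_dom b2 \<inter> chart_dom b1"
      using charts_atD(2)[OF d2(4)] charts_atD(2)[OF d1(4)] k(1)[OF w] by simp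
    from imageI[OF this, of "coord b2"] show "w \<in> overlap b2 b1" by (simp only: d2(6))
    show "transition b2 b1 w = h (j w)" using d1(6) k(1)[OF w] by (simp add: transition_def)
  qed
  show thesis
  proof (rule that[OF oW])
    have "j (coord b2 p) = i (coord b1 p)" by (simp add: i_def j_def I1.irep_coord[OF b1] I2.irep_coord[OF b2])
    then show "coord b2 p \<in> W" using S2(2) h(2,5) by (auto simp: W_def)
    show "W \<subseteq> overlap b2 b1" using sub(1) by blast
    have "smooth_on (\<lambda>w. h (j w)) W"
      by (rule smooth_on_compose[OF oW h(4) _ smooth_on_subset[OF sj oW WS] h(9)]) (auto simp: W_def)
    then show "smooth_on (transition b2 b1) W"
      by (rule smooth_on_cong[OF oW, rotated]) (simp add: sub(2))
  qed
qed

lemma connected_integral_manifoldD: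
  fixes L :: "('p, 'l::euclidean_space) atlas"
  assumes "connected_integral_manifold M \<eta> L"
  shows "integral_mfd M L \<eta>" "Hausdorff_space (manifold_topology L)" "connected_space (manifold_topology L)"
proof -
  show "integral_mfd M L \<eta>"
    by unfold_locales (use assms one_form in \<open>auto simp: connected_integral_manifold_def\<close>)
qed (use assms in \<open>auto simp: connected_integral_manifold_def\<close>)

section \<open>Plaques and leaves\<close>

text \<open>The Hausdorff property is inherited from \<open>M\<close> along the continuous injective
  inclusion.\<close>

lemma connected_integral_manifoldI:
  fixes L :: "('p, 'l::euclidean_space) atlas"
  assumes "smooth_atlas L" "smooth_map L M (\<lambda>p. p)" and conn: "connected_space (manifold_topology L)" and ne: "points L \<noteq> {}"
    and imm: "\<And>p. p \<in> points L \<Longrightarrow> \<exists>b\<in>charts_at L p. \<exists>c\<in>charts_at M p. inj (fderiv (irep b c) (coord b p)) \<and>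
      range (fderiv (irep b c) (coord b p)) = {u. frep M c \<eta> (coord c p) u = 0}"
  shows "connected_integral_manifold M \<eta> L"
proof -
  interpret I: smooth_incl M L by unfold_locales (rule assms)+
  have "Hausdorff_space (manifold_topology L)"
    by (rule Hausdorff_space_injective_preimage[OF M.hausdorff I.continuous_incl]) simp
  then show ?thesis
    unfolding connected_integral_manifold_def
    using assms(1-4) imm I.incl_inj_img by blast
qed

text \<open>A small ball of the hyperplane, carried to \<open>M\<close> by \<open>G\<close> and the
  inverse chart, becomes an integral manifold with a single chart. The ball supplies
  connectedness.\<close>

lemma plaque_exists:
  assumes dim: "DIM('m) = DIM('l::euclidean_space) + 1" and p: "p \<in> points M"
  shows "\<exists>L :: ('p, 'l::euclidean_space) atlas. connected_integral_manifold M \<eta> L \<and> p \<in> points L"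
proof -
  obtain c where c: "c \<in> charts_at M p" using p by (rule chart_atE)
  note cM = charts_atD(1)[OF c]
  obtain B V \<Psi> G \<mu> where box: "flat_box c p B V \<Psi> G \<mu>" using flat_box_exists[OF c] by blast
  note bx = flat_boxD[OF box]
  obtain e where e: "\<mu> e \<noteq> 0" using bx(14) by blast
  obtain \<kappa> :: "'l \<Rightarrow> 'm" and P
    where \<kappa>: "linear \<kappa>" "linear P" "\<And>u. \<mu> (\<kappa> u) = 0" "\<And>u. P (\<kappa> u) = u" "\<And>z. \<mu> z = 0 \<Longrightarrow> \<kappa> (P z) = z"
    by (rule hyperplane_parametrization[OF bx(13) e dim]) (rule that)
  have kb: "bounded_linear \<kappa>" using \<kappa>(1) linear_conv_bounded_linear by blast
  have "open (\<kappa> -` V)"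
    using continuous_open_preimage[OF linear_continuous_on[OF kb] open_UNIV bx(4)] by simp
  moreover have "0 \<in> \<kappa> -` V" using linear_0[OF \<kappa>(1)] bx(2,5,12) by force
  ultimately obtain r where r: "0 < r" "ball 0 r \<subseteq> \<kappa> -` V" using open_contains_ball by metis
  define S where "S = ball (0 :: 'l) r"
  have S: "open S" "\<And>x. x \<in> S \<Longrightarrow> \<kappa> x \<in> V" "0 \<in> S" "connected S" using r by (auto simp: S_def)
  define i where "i x = G (\<kappa> x)" for x
  have iB: "i x \<in> B" "\<Psi> (i x) = \<kappa> x" if "x \<in> S" for x
    using S(2)[OF that] bx(6,8) by (auto simp: i_def)
  have iimg: "i x \<in> chart_img c" if "x \<in> S" for x using iB(1)[OF that] bx(3) by blast
  have si: "smooth_on i S" unfolding i_def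
    by (rule smooth_on_compose[OF S(1) bx(4) _ smooth_on_bounded_linear[OF kb S(1)] bx(10)]) (use S(2) in blast)
  define E where "E x = coord_inv c (i x)" for x
  have Ec: "coord c (E x) = i x" "c \<in> charts_at M (E x)" if "x \<in> S" for x
    unfolding E_def by (rule M.coord_coord_inv[OF iimg[OF that]], rule M.coord_inv_charts_at[OF cM iimg[OF that]])
  have injE: "inj_on E S"
  proof (rule inj_onI)
    fix x y assume x: "x \<in> S" and y: "y \<in> S" and "E x = E y"
    then have "\<kappa> x = \<kappa> y" using Ec(1) iB(2) by metis
    then show "x = y" using \<kappa>(4) by metis
  qed
  define b :: "('p, 'l) chart" where "b = (E ` S, inv_into S E)"
  have bE: "coord b (E x) = x" if "x \<in> S" for x using that injE by (simp add: b_def)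
  have bdom: "chart_dom b = E ` S" by (simp add: b_def)
  have bimg: "chart_img b = S"
    unfolding bdom image_image using bE by (auto simp: image_iff)
  have binj: "inj_on (coord b) (chart_dom b)"
    unfolding bdom by (rule inj_onI) (use bE in auto)
  have binv: "coord_inv b x = E x" if "x \<in> S" for x
    unfolding coord_inv_def using inv_into_f_f[OF binj, of "E x"] that bE[OF that] by (simp add: bdom)
  define L where "L = {b}"
  have atl: "smooth_atlas L"
    unfolding smooth_atlas_def L_def
  proof (simp add: bimg S(1) binj)
    show "smooth_on (transition b b) S"
      by (rule smooth_on_cong[OF S(1) _ smooth_on_id[OF S(1)]]) (simp add: transition_def binv bE)
  qed
  interpret L: smooth_mfd L by unfold_locales (rule atl)
  have bL: "b \<in> L" by (simp add: L_def)
  have pts: "points L = E ` S" by (simp add: points_def L_def bdom)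
  have irep_b: "irep b d x = coord d (E x)" if "x \<in> S" for d :: "('p, 'm) chart" and x
    using that by (simp add: irep_def binv)
  have sm: "smooth_map L M (\<lambda>p. p)"
    unfolding smooth_map_def
  proof (intro conjI ballI)
    show "(\<lambda>p. p) ` points L \<subseteq> points M" using pts Ec(2) charts_at_points by fastforce
    fix b' d assume "b' \<in> L" and d: "d \<in> M"
    then have b': "b' = b" by (simp add: L_def)
    have dom: "coord b ` (chart_dom b \<inter> (\<lambda>p. p) -` chart_dom d) = S \<inter> i -` overlap c d"
    proof (intro set_eqI iffI)
      fix x assume "x \<in> coord b ` (chart_dom b \<inter> (\<lambda>p. p) -` chart_dom d)"
      then obtain y where y: "y \<in> S" "E y \<in> chart_dom d" "x = coord b (E y)" by (auto simp: bdom)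
      then have "i y \<in> overlap c d" using Ec[OF y(1)] charts_atD(2)[OF Ec(2)[OF y(1)]] by (metis IntI imageI)
      then show "x \<in> S \<inter> i -` overlap c d" using y bE by simp
    next
      fix x assume x: "x \<in> S \<inter> i -` overlap c d"
      then have "E x \<in> chart_dom d" using M.overlapD(3)[OF cM _ d, of "i x"] by (simp add: E_def)
      then show "x \<in> coord b ` (chart_dom b \<inter> (\<lambda>p. p) -` chart_dom d)"
        using x bE by (force simp: bdom)
    qed
    have o: "open (S \<inter> i -` overlap c d)"
      by (rule continuous_open_preimage[OF smooth_on_continuous[OF si] S(1) M.open_overlap[OF cM d]])
    show "open (coord b' ` (chart_dom b' \<inter> (\<lambda>p. p) -` chart_dom d))" unfolding b' dom by (rule o)
    show "smooth_on (coord d \<circ> (\<lambda>p. p) \<circ> coord_inv b') (coord b' ` (chart_dom b' \<inter> (\<lambda>p. p) -` chart_dom d))"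
      unfolding b' dom
    proof (rule smooth_on_cong[OF o])
      show "smooth_on (\<lambda>x. transition c d (i x)) (S \<inter> i -` overlap c d)"
        by (rule smooth_on_compose[OF o M.open_overlap[OF cM d] _ smooth_on_subset[OF si o] M.smooth_transition[OF cM d]]) auto
      show "transition c d (i x) = (coord d \<circ> (\<lambda>p. p) \<circ> coord_inv b) x" if "x \<in> S \<inter> i -` overlap c d" for x
        using that by (simp add: transition_def binv E_def)
    qed
  qed
  have conn: "connected_space (manifold_topology L)"
  proof -
    have "connectedin (subtopology euclidean (chart_img b)) S"
      using S(4) by (simp add: connectedin_subtopology bimg)
    from connectedin_continuous_map_image[OF L.continuous_coord_inv[OF bL] this]
    have "connectedin (manifold_topology L) (coord_inv b ` S)" .
    moreover have "coord_inv b ` S = topspace (manifold_topology L)"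
      unfolding L.topspace_manifold pts using binv by force
    ultimately show ?thesis by (simp add: connectedin_topspace)
  qed
  have "connected_integral_manifold M \<eta> L"
  proof (rule connected_integral_manifoldI[OF atl sm conn])
    show "points L \<noteq> {}" using S(3) pts by blast
    fix q assume "q \<in> points L"
    then obtain x where x: "x \<in> S" "q = E x" using pts by blast
    have bq: "b \<in> charts_at L q" using x by (simp add: charts_at_def bL bdom)
    have cq: "c \<in> charts_at M q" and cqx: "coord c q = i x" and bqx: "coord b q = x" using Ec[OF x(1)] bE x by simp_all
    have "(i has_derivative fderiv i x) (at x)" by (rule smooth_on_has_derivative[OF si S(1) x(1)])
    have di: "fderiv (irep b c) x = fderiv i x"
      by (rule fderiv_cong[OF S(1) x(1)]) (simp add: irep_b Ec(1))
    \<comment> \<open>\<open>\<Psi> \<circ> i\<close> is the linear map \<open>\<kappa>\<close>,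
      hence its own derivative; injectivity and range of the derivative of \<open>i\<close> follow
      from those of \<open>\<kappa>\<close>.\<close>
    have "((\<lambda>x. \<Psi> (i x)) has_derivative (\<lambda>v. fderiv \<Psi> (i x) (fderiv i x v))) (at x)"
      by (rule has_derivative_compose[OF smooth_on_has_derivative[OF si S(1) x(1)] smooth_on_has_derivative[OF bx(9,1) iB(1)[OF x(1)]]])
    then have "(\<kappa> has_derivative (\<lambda>v. fderiv \<Psi> (i x) (fderiv i x v))) (at x)"
      by (rule has_derivative_transform_within_open[OF _ S(1) x(1)]) (rule iB(2))
    from has_derivative_unique[OF this bounded_linear_imp_has_derivative[OF kb]]
    have dk: "fderiv \<Psi> (i x) (fderiv i x v) = \<kappa> v" for v by metis
    have "inj (fderiv i x)" by (rule injI) (metis dk \<kappa>(4))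
    moreover have "range (fderiv i x) = {u. frep M c \<eta> (i x) u = 0}"
    proof (intro set_eqI iffI)
      fix u assume "u \<in> range (fderiv i x)"
      then obtain v where "u = fderiv i x v" by blast
      then show "u \<in> {u. frep M c \<eta> (i x) u = 0}"
        using bx(15)[OF iB(1)[OF x(1)], of "fderiv i x v"] by (simp add: dk \<kappa>(3))
    next
      fix u assume "u \<in> {u. frep M c \<eta> (i x) u = 0}"
      then have "\<mu> (fderiv \<Psi> (i x) u) = 0" using bx(15)[OF iB(1)[OF x(1)]] by simp
      from \<kappa>(5)[OF this] dk have "fderiv \<Psi> (i x) (fderiv i x (P (fderiv \<Psi> (i x) u))) = fderiv \<Psi> (i x) u" by simp
      then have "fderiv i x (P (fderiv \<Psi> (i x) u)) = u" using bx(11)[OF iB(1)[OF x(1)]] by (auto dest: injD)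
      then show "u \<in> range (fderiv i x)" by (metis rangeI)
    qed
    ultimately show "\<exists>b\<in>charts_at L q. \<exists>c\<in>charts_at M q. inj (fderiv (irep b c) (coord b q)) \<and>
      range (fderiv (irep b c) (coord b q)) = {u. frep M c \<eta> (coord c q) u = 0}"
      using bq cq cqx bqx di by (intro bexI[of _ b] bexI[of _ c]) simp_all
  qed
  moreover have "p \<in> points L"
  proof -
    have "G 0 = coord c p" using bx(7)[OF bx(2)] bx(12) by simp
    then have "E 0 = p" using M.coord_inv_coord[OF charts_atD[OF c]] linear_0[OF \<kappa>(1)] by (simp add: E_def i_def)
    then show ?thesis using S(3) pts by force
  qed
  ultimately show ?thesis by blast
qed

text \<open>The leaf is the union of all connected integral manifolds through \<open>p\<close>.\<close>

lemma leaf_exists: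
  assumes dim: "DIM('m) = DIM('l::euclidean_space) + 1" and p: "p \<in> points M"
  shows "\<exists>L :: ('p, 'l::euclidean_space) atlas. leaf M \<eta> L \<and> p \<in> points L"
proof -
  define \<F> where "\<F> = {L :: ('p, 'l) atlas. connected_integral_manifold M \<eta> L \<and> p \<in> points L}"
  define N where "N = \<Union>\<F>"
  have F: "integral_mfd M L \<eta>" "connected_space (manifold_topology L)" "p \<in> points L" if "L \<in> \<F>" for L
    using that connected_integral_manifoldD unfolding \<F>_def by blast+
  have ptsN: "points N = (\<Union>L\<in>\<F>. points L)" by (auto simp: points_def N_def)
  have "\<F> \<noteq> {}" using plaque_exists[OF dim p] by (auto simp: \<F>_def)
  then have pN: "p \<in> points N" using F(3) ptsN by blast
  \<comment> \<open>Charts of different members come with unrelated topologies; that they overlap in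
    open sets at all is the content of \<open>integral_mfd_compatible\<close>.\<close>
  have compat: "\<exists>W. open W \<and> x \<in> W \<and> W \<subseteq> overlap b d \<and> smooth_on (transition b d) W"
    if b: "b \<in> L1" "L1 \<in> \<F>" and d: "d \<in> L2" "L2 \<in> \<F>" and x: "x \<in> overlap b d" for b d L1 L2 x
  proof -
    obtain q where q: "x = coord b q" "q \<in> chart_dom b" "q \<in> chart_dom d" using x by blast
    have "b \<in> charts_at L1 q" "d \<in> charts_at L2 q" using b d q by (simp_all add: charts_at_def)
    from integral_mfd_compatible[OF dim F(1)[OF d(2)] F(1)[OF b(2)] this(2,1)]
    show ?thesis unfolding q(1) by metis
  qed
  have atl: "smooth_atlas N"
    unfolding smooth_atlas_def
  proof (intro conjI ballI)
    fix b assume "b \<in> N"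
    then obtain L where L: "b \<in> L" "L \<in> \<F>" by (auto simp: N_def)
    interpret I: integral_mfd M L \<eta> by (rule F(1)[OF L(2)])
    show "inj_on (coord b) (chart_dom b)" "open (chart_img b)"
      by (rule I.L.inj_coord[OF L(1)], rule I.L.open_chart_img[OF L(1)])
  next
    fix b d assume "b \<in> N" "d \<in> N"
    then obtain L1 L2 where L: "b \<in> L1" "L1 \<in> \<F>" "d \<in> L2" "L2 \<in> \<F>" by (auto simp: N_def)
    show "open (overlap b d)"
      by (subst open_subopen) (use compat[OF L] in blast)
    show "smooth_on (transition b d) (overlap b d)"
      by (rule smooth_on_local) (use compat[OF L] in blast)
  qed
  interpret N: smooth_mfd N by unfold_locales (rule atl)
  have sm: "smooth_map N M (\<lambda>p. p)"
    unfolding smooth_map_def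
  proof (intro conjI ballI)
    show "(\<lambda>p. p) ` points N \<subseteq> points M"
      using ptsN smooth_incl.points_subset integral_mfd.axioms(1) F(1) by fastforce
    fix b c assume "b \<in> N" and c: "c \<in> M"
    then obtain L where L: "b \<in> L" "L \<in> \<F>" by (auto simp: N_def)
    interpret I: integral_mfd M L \<eta> by (rule F(1)[OF L(2)])
    show "open (coord b ` (chart_dom b \<inter> (\<lambda>p. p) -` chart_dom c))"
      "smooth_on (coord c \<circ> (\<lambda>p. p) \<circ> coord_inv b) (coord b ` (chart_dom b \<inter> (\<lambda>p. p) -` chart_dom c))"
      using I.incl_smooth L(1) c unfolding smooth_map_def by blast+
  qed
  have conn: "connected_space (manifold_topology N)"
  proof -
    \<comment> \<open>Each member maps continuously into the union, and all of them contain
      \<open>p\<close>.\<close>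
    have "connectedin (manifold_topology N) (points L)" if L: "L \<in> \<F>" for L
    proof -
      interpret I: integral_mfd M L \<eta> by (rule F(1)[OF L])
      have "continuous_map (manifold_topology L) (manifold_topology N) (\<lambda>p. p)"
        unfolding continuous_map_def I.L.topspace_manifold N.topspace_manifold
      proof (intro conjI allI impI)
        show "(\<lambda>p. p) \<in> points L \<rightarrow> points N" using L ptsN by auto
        fix W assume W: "openin (manifold_topology N) W"
        have "coord b ` ({q \<in> points L. q \<in> W} \<inter> chart_dom b) = coord b ` (W \<inter> chart_dom b)" if "b \<in> L" for b
          using that by (auto simp: points_def)
        moreover have "open (coord b ` (W \<inter> chart_dom b))" if "b \<in> L" for b
        proof -
          have "b \<in> N" using that L unfolding N_def by blast
          then show ?thesis using W N.openin_manifold by blast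
        qed
        ultimately show "openin (manifold_topology L) {q \<in> points L. q \<in> W}" by (auto simp: I.L.openin_manifold)
      qed
      from connectedin_continuous_map_image[OF this, of "points L"] F(2)[OF L]
      show ?thesis by (simp add: connectedin_topspace[symmetric] I.L.topspace_manifold)
    qed
    moreover have "p \<in> \<Inter>(points ` \<F>)" using F(3) by blast
    ultimately have "connectedin (manifold_topology N) (\<Union>(points ` \<F>))"
      by (intro connectedin_Union) auto
    then show ?thesis by (simp add: connectedin_topspace[symmetric] N.topspace_manifold ptsN)
  qed
  have cim: "connected_integral_manifold M \<eta> N"
  proof (rule connected_integral_manifoldI[OF atl sm conn])
    show "points N \<noteq> {}" using pN by blast
    fix q assume "q \<in> points N"
    then obtain L where L: "L \<in> \<F>" "q \<in> points L" using ptsN by blast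
    interpret I: integral_mfd M L \<eta> by (rule F(1)[OF L(1)])
    obtain b where b: "b \<in> charts_at L q" using L(2) by (rule chart_atE)
    obtain c where c: "c \<in> charts_at M q" using L(2) I.points_subset by (meson chart_atE subsetD)
    have "b \<in> charts_at N q" using b L(1) by (auto simp: charts_at_def N_def)
    then show "\<exists>b\<in>charts_at N q. \<exists>c\<in>charts_at M q. inj (fderiv (irep b c) (coord b q)) \<and>
      range (fderiv (irep b c) (coord b q)) = {u. frep M c \<eta> (coord c q) u = 0}"
      using c I.inj_irep[OF b c] I.range_irep[OF b c] by blast
  qed
  have "leaf M \<eta> N"
    unfolding leaf_def
  proof (intro conjI allI impI cim)
    fix L' :: "('p, 'l) atlas" assume L': "connected_integral_manifold M \<eta> L'" "points N \<subseteq> points L'"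
    \<comment> \<open>A larger connected integral manifold still contains \<open>p\<close>, hence
      belongs to the family and adds no new points.\<close>
    then have "L' \<in> \<F>" using pN by (auto simp: \<F>_def)
    then show "points L' = points N" using L'(2) ptsN by blast
  qed
  then show ?thesis using pN by blast
qed

end

section \<open>Characterization of para-Kaehler leaves\<close>

text \<open>The coefficients of \<open>u\<close> in the orthonormal basis are, up to sign, its
  products with the basis vectors.\<close>

lemma has_signature_nondegenerate:
  assumes sig: "has_signature V b r s"
    and lin: "\<And>v. v \<in> V \<Longrightarrow> linear_on_subspace V (\<lambda>u. b u v)"
    and u: "u \<in> V" and 0: "\<And>v. v \<in> V \<Longrightarrow> b u v = 0"
  shows "u = 0"
proof -
  obtain P N where PN: "finite P" "finite N" "independent (P \<union> N)" "span (P \<union> N) = V"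
    "\<And>u v. u \<in> P \<union> N \<Longrightarrow> v \<in> P \<union> N \<Longrightarrow> u \<noteq> v \<Longrightarrow> b u v = 0"
    "\<And>u. u \<in> P \<Longrightarrow> b u u = 1" "\<And>u. u \<in> N \<Longrightarrow> b u u = - 1"
    using sig unfolding has_signature_def by metis
  define S where "S = P \<union> N"
  have fin: "finite S" using PN by (simp add: S_def)
  have SV: "S \<subseteq> V" unfolding S_def PN(4)[symmetric] by (rule span_superset)
  obtain a where a: "u = (\<Sum>w\<in>S. a w *\<^sub>R w)"
    using u unfolding PN(4)[symmetric] S_def[symmetric] span_finite[OF fin] by auto
  have "b (\<Sum>w\<in>F. a w *\<^sub>R w) v = (\<Sum>w\<in>F. a w * b w v)" if F: "F \<subseteq> S" and v: "v \<in> S" for F v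
  proof -
    have vV: "v \<in> V" using v SV by blast
    have sub: "subspace V" using PN(4) subspace_span by metis
    have "finite F" using F fin finite_subset by blast
    then show ?thesis using F
    proof (induction F)
      case empty
      show ?case using linear_on_subspaceD(2)[OF lin[OF vV] u, of 0] linear_on_subspaceD(2)[OF lin[OF vV] vV, of 0] by simp
    next
      case (insert w F)
      have "w \<in> V" using insert.prems SV by auto
      moreover have "(\<Sum>w\<in>F. a w *\<^sub>R w) \<in> V"
        using insert.prems SV by (intro subspace_sum[OF sub] subspace_scale[OF sub]) auto
      ultimately show ?case
        using insert linear_on_subspaceD(1)[OF lin[OF vV], of "a w *\<^sub>R w"] linear_on_subspaceD(2)[OF lin[OF vV], of w "a w"]
          subspace_scale[OF sub] by simp
    qed
  qed
  then have bu: "b u v = (\<Sum>w\<in>S. a w * b w v)" if "v \<in> S" for v using that a by blast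
  have "a v = 0" if v: "v \<in> S" for v
  proof -
    have "(\<Sum>w\<in>S. a w * b w v) = (\<Sum>w\<in>S. if w = v then a v * b v v else 0)"
      by (rule sum.cong) (use PN(5) v in \<open>auto simp: S_def\<close>)
    then have "a v * b v v = 0" using bu[OF v] 0[of v] v SV fin by (auto simp: subset_iff)
    moreover have "b v v \<noteq> 0" using PN(6,7) v by (auto simp: S_def)
    ultimately show ?thesis by simp
  qed
  then show ?thesis using a by simp
qed

text \<open>The identities required by the locale follow algebraically from the formulas for
  \<open>\<phi>\<^sup>2\<close> and for the metric on images of \<phi>; nondegeneracy comes from the
  signature.\<close>

lemma almost_paracosymplectic_mfd:
  assumes "almost_paracosymplectic n M \<alpha> \<phi> \<xi> \<eta> g"
  shows "paracosymplectic_mfd M g (levi_civita M g) \<phi> \<xi> \<eta> \<alpha>"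
proof -
  have apm: "almost_paracontact_metric n M \<phi> \<xi> \<eta> g" using assms by (simp add: almost_paracosymplectic_def)
  have J: "endo_field M \<phi>" and \<xi>: "\<xi> \<in> vector_fields M" and \<eta>: "one_form M \<eta>"
    and pm: "pseudo_metric M g (n + 1) n" and sm: "smooth_manifold M"
    using apm by (simp_all add: almost_paracontact_metric_def)
  have eta_xi: "\<eta> p (\<xi> p) = 1"
    and phi2: "\<And>u. u \<in> tangent_space M p \<Longrightarrow> \<phi> p (\<phi> p u) = u - \<eta> p u *\<^sub>R \<xi> p"
    and compat: "\<And>u v. u \<in> tangent_space M p \<Longrightarrow> v \<in> tangent_space M p \<Longrightarrow>
      g p (\<phi> p u) (\<phi> p v) = - g p u v + \<eta> p u * \<eta> p v" if "p \<in> points M" for p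
    using apm that unfolding almost_paracontact_metric_def by blast+
  interpret hausdorff_mfd M
    by unfold_locales (use sm in \<open>simp_all add: smooth_manifold_def\<close>)
  have g: "bilinear_field M g" using pm by (simp add: pseudo_metric_def)
  interpret metric_mfd M g
  proof
    show "bilinear_field M g" by (rule g)
    show "g p u v = g p v u" if "p \<in> points M" "u \<in> tangent_space M p" "v \<in> tangent_space M p" for p u v
      using pm that by (simp add: pseudo_metric_def)
    fix p u assume p: "p \<in> points M" and u: "u \<in> tangent_space M p" "\<And>v. v \<in> tangent_space M p \<Longrightarrow> g p u v = 0"
    show "u = 0"
      by (rule has_signature_nondegenerate[where V = "tangent_space M p" and b = "g p", OF _ _ u])
        (use pm p g in \<open>auto simp: pseudo_metric_def bilinear_field_def\<close>)
  qed
  note x = vf_tangent[OF \<xi>]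
  note Jt = endo_fieldD(3)[OF J]
  have J0: "\<phi> p 0 = 0" for p using endo_fieldD(2)[OF J tangent_zero, of p 0] by simp
  \<comment> \<open>\<open>\<phi> (\<phi> \<xi>) = 0\<close>, and the formula for
    \<open>\<phi>\<^sup>2\<close> at \<open>\<phi> \<xi>\<close> gives
    \<open>\<phi> \<xi> = a \<xi>\<close>; applying \<phi> once more gives
    \<open>a * a = 0\<close>.\<close>
  have phi_xi: "\<phi> p (\<xi> p) = 0" if p: "p \<in> points M" for p
  proof -
    have 0: "\<phi> p (\<phi> p (\<xi> p)) = 0" using phi2[OF p x] eta_xi[OF p] by simp
    define a where "a = \<eta> p (\<phi> p (\<xi> p))"
    have a: "\<phi> p (\<xi> p) = a *\<^sub>R \<xi> p" using phi2[OF p Jt[OF x]] 0 J0 by (simp add: a_def)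
    have "\<phi> p (\<phi> p (\<xi> p)) = a *\<^sub>R (a *\<^sub>R \<xi> p)" using endo_fieldD(2)[OF J x, of p a] a by simp
    then have "(a * a) *\<^sub>R \<xi> p = 0" using 0 by simp
    from arg_cong[OF this, of "\<eta> p"] have "a * a = \<eta> p 0"
      using one_formD(2)[OF \<eta> x, of p "a * a"] eta_xi[OF p] by simp
    then have "a = 0" using one_formD(2)[OF \<eta> tangent_zero, of p 0] by simp
    then show ?thesis using a by simp
  qed
  \<comment> \<open>The cube of \<phi> at \<open>u\<close>, evaluated in two ways, gives
    \<open>\<phi> u\<close> and \<open>\<phi> u - \<eta> (\<phi> u) \<xi>\<close>.\<close>
  have eta_phi: "\<eta> p (\<phi> p u) = 0" if p: "p \<in> points M" and u: "u \<in> tangent_space M p" for p u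
  proof -
    note s = tangent_scaleR[OF x, of "\<eta> p u" p]
    have "\<phi> p (u - \<eta> p u *\<^sub>R \<xi> p) + \<phi> p (\<eta> p u *\<^sub>R \<xi> p) = \<phi> p u"
      using endo_fieldD(1)[OF J tangent_diff[OF u s] s] by simp
    then have "\<phi> p (\<phi> p (\<phi> p u)) = \<phi> p u"
      using phi2[OF p u] endo_fieldD(2)[OF J x, of p "\<eta> p u"] phi_xi[OF p] by simp
    then have "\<eta> p (\<phi> p u) *\<^sub>R \<xi> p = 0" using phi2[OF p Jt[OF u]] by simp
    from arg_cong[OF this, of "\<eta> p"] show ?thesis
      using one_formD(2)[OF \<eta> x, of p "\<eta> p (\<phi> p u)"] one_formD(2)[OF \<eta> tangent_zero, of p 0] eta_xi[OF p] by simp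
  qed
  have g_xi: "g p u (\<xi> p) = \<eta> p u" if p: "p \<in> points M" and u: "u \<in> tangent_space M p" for p u
    using compat[OF p u x] phi_xi[OF p] eta_xi[OF p] bilinear_fieldD(4)[OF g u u Jt[OF u], of 0] by simp
  \<comment> \<open>Compatibility is applied to \<open>\<phi> u\<close> and \<open>v\<close>, where
    the term with \<eta> drops out.\<close>
  have skew: "g p (\<phi> p u) v = - g p u (\<phi> p v)"
    if p: "p \<in> points M" and u: "u \<in> tangent_space M p" and v: "v \<in> tangent_space M p" for p u v
  proof -
    note s = tangent_scaleR[OF x, of "\<eta> p u" p]
    have "g p (\<xi> p) (\<phi> p v) = 0" using g_sym[OF p x Jt[OF v]] g_xi[OF p Jt[OF v]] eta_phi[OF p v] by simp
    then have "g p (\<phi> p (\<phi> p u)) (\<phi> p v) = g p u (\<phi> p v)"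
      unfolding phi2[OF p u] bilinear_field_diff(1)[OF g u s Jt[OF v]] bilinear_fieldD(3)[OF g x x Jt[OF v]] by simp
    then show ?thesis using compat[OF p Jt[OF u] v] eta_phi[OF p u] by simp
  qed
  show ?thesis
    by unfold_locales
      (use levi_civita J skew \<xi> \<eta> eta_xi phi2 phi_xi eta_phi g_xi assms in \<open>auto simp: almost_paracosymplectic_def\<close>)
qed

theorem proposition5:
  fixes M :: "('p, 'm::euclidean_space) atlas"
    and \<phi> :: "('p, 'm) endo" and \<xi> :: "('p, 'm) vfield"
    and \<eta> :: "('p, 'm) form1" and g :: "('p, 'm) form2"
    and \<alpha> :: "'p \<Rightarrow> real" and n :: nat
  assumes "almost_paracosymplectic n M \<alpha> \<phi> \<xi> \<eta> g"
    and "DIM('l::euclidean_space) = 2 * n"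
  shows "para_kaehler_leaves TYPE('l) M \<phi> \<eta> g \<longleftrightarrow>
    (\<forall>X\<in>vector_fields M. \<forall>Y\<in>vector_fields M. \<forall>p\<in>points M.
       cov_deriv_endo (levi_civita M g) \<phi> X Y p =
         (\<alpha> p * g p (\<phi> p (X p)) (Y p)) *\<^sub>R \<xi> p
         + g p (h_op M \<phi> \<xi> X p) (Y p) *\<^sub>R \<xi> p
         - (\<alpha> p * \<eta> p (Y p)) *\<^sub>R \<phi> p (X p)
         - \<eta> p (Y p) *\<^sub>R h_op M \<phi> \<xi> X p)"
proof -
  interpret P: paracosymplectic_mfd M g "levi_civita M g" \<phi> \<xi> \<eta> \<alpha>
    by (rule almost_paracosymplectic_mfd[OF assms(1)])
  interpret C: closed_form_mfd M \<eta> \<xi>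
    by unfold_locales (use P.\<eta> P.\<xi> P.eta_xi P.d_eta in simp_all)
  have dim: "DIM('m) = DIM('l) + 1"
    using assms by (simp add: almost_paracosymplectic_def almost_paracontact_metric_def)
  \<comment> \<open>Isolated as a condition on a single point, so that quantifying over leaves and
    quantifying over points can be exchanged.\<close>
  define T where "T p \<longleftrightarrow> (\<forall>X\<in>vector_fields M. \<forall>Y\<in>vector_fields M. \<forall>Z\<in>vector_fields M.
    g p (P.DJ (P.tangential X) (P.tangential Y) p) (P.tangential Z p) = 0)" for p
  have leaf: "points L \<subseteq> points M"
    "para_kaehler L (leaf_endo M \<phi> L) (leaf_metric M g L) \<longleftrightarrow> (\<forall>p\<in>points L. T p)"
    if "leaf M \<eta> L" for L :: "('p, 'l) atlas"
  proof -
    have cim: "connected_integral_manifold M \<eta> L" using that by (simp add: leaf_def)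
    interpret I: integral_mfd M L \<eta> by (rule C.connected_integral_manifoldD(1)[OF cim])
    interpret R: integral_paracosymplectic M g "levi_civita M g" \<phi> \<xi> \<eta> \<alpha> L
      by unfold_locales (rule C.connected_integral_manifoldD(2)[OF cim])
    show "points L \<subseteq> points M" by (rule I.points_subset)
    show "para_kaehler L (leaf_endo M \<phi> L) (leaf_metric M g L) \<longleftrightarrow> (\<forall>p\<in>points L. T p)"
      unfolding R.para_kaehler_iff T_def by blast
  qed
  \<comment> \<open>The leaves are contained in \<open>M\<close> and cover it, so holding along
    every leaf is holding at every point.\<close>
  have "para_kaehler_leaves TYPE('l) M \<phi> \<eta> g \<longleftrightarrow> (\<forall>p\<in>points M. T p)"
    unfolding para_kaehler_leaves_def using leaf C.leaf_exists[OF dim] by blast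
  then show ?thesis unfolding P.structure_equation_iff T_def by blast
qed

end
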